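(* Let $H$ be a Hopf algebra over $\mathbb{C}$ and let $V$ be a simple vertex operator algebra which is an $H$-module VOA and is semisimple as an $H$-module. Let $\{M_i \mid i\in I\}$ be the set of (representatives of the isomorphism classes of) inequivalent simple $H$-modules occurring in $V$, and let $V=\bigoplus_{i\in I} M_i\otimes V_{M_i}$ be the corresponding decomposition, where $V_{M_i}$ is the multiplicity space of $M_i$ in $V$, viewed as a $V^H$-module. Then: (i) $V^H$ is a simple vertex operator algebra and each $V_{M_i}$ ($i\in I$) is a simple $V^H$-module. (ii) For $i,j\in I$, $V_{M_i}$ and $V_{M_j}$ are isomorphic $V^H$-modules if and only if $i=j$.
   Context: Everything is over $\mathbb{C}$. A Hopf algebra $H$ has comultiplication $\Delta(h)=\sum h_1\otimes h_2$ (Sweedler notation), counit $\epsilon$ and antipode $S$. A vertex operator algebra (VOA) is $(V,Y,\mathbf 1,\omega)$ with $V=\bigoplus_{n\in\mathbb{Z}}V_n$, $\dim V_n<\infty$, $V_n=0$ for $n\ll 0$, $\mathbf 1\in V_0$, $\omega\in V_2$, and a linear map $u\mapsto Y(u,z)=\sum_{n\in\mathbb{Z}}u_nz^{-n-1}\in \mathrm{End}(V)[[z,z^{-1}]]$ such that: $u_nv=0$ for $n\gg0$; $Y(\mathbf 1,z)v=v$ and $\lim_{z\to0}Y(v,z)\mathbf 1=v$; writing $Y(\omega,z)=\sum_n L(n)z^{-n-2}$, one has $V_n=\{v\mid L(0)v=nv\}$, $Y(L(-1)v,z)=\frac{d}{dz}Y(v,z)$ and $[L(n),L(m)]=(n-m)L(n+m)+\delta_{n+m,0}\frac{n^3-n}{12}c$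 for some $c\in\mathbb{C}$; and the Jacobi identity holds: $$z_0^{-1}\delta\!\left(\tfrac{z_1-z_2}{z_0}\right)Y(u,z_1)Y(v,z_2)-z_0^{-1}\delta\!\left(\tfrac{-z_2+z_1}{z_0}\right)Y(v,z_2)Y(u,z_1)=z_1^{-1}\delta\!\left(\tfrac{z_2+z_0}{z_1}\right)Y(Y(u,z_0)v,z_2),$$ where $\delta(z)=\sum_{n\in\mathbb{Z}}z^n$ and $(z_1+z_2)^n=\sum_{i\ge0}\binom{n}{i}z_1^iz_2^{n-i}$. $V$ is simple if it is nonzero and has no nontrivial ideals. A weak module $M$ for a VOA $U$ has a linear map $u\mapsto Y_M(u,z)=\sum_{n\in\mathbb{Z}}u_nz^{-n-1}\in\mathrm{End}(M)[[z,z^{-1}]]$ with $u_nw=0$ for $n\gg0$, $Y_M(\mathbf 1,z)=\mathrm{Id}_M$ and the analogous Jacobi identity. A $U$-module is a weak module $M=\bigoplus_{\lambda\in\mathbb{C}}M_\lambda$ graded by $L(0)$-eigenspaces, with each $M_\lambda$ finite dimensional and, for each fixed $\lambda$, $M_{\lambda+n}=0$ for all sufficiently small integers $n$. $V$ is an $H$-module VOA if: (i) $V$ is an $H$-module; (ii) $h\omega=\epsilon(h)\omega$ for all $h\in H$; (iii) $hY(u,z)v=\sum Y(h_1u,z)h_2v$ for all $h\in H$, $u,v\in V$. $V^H=\{v\in V\mid hv=\epsilon(h)v\ \text{for all } h\in H\}$; it is a vertex operator subalgebra of $V$ (with the same $\mathbf 1$ and $\omega$). $H$ preserves each $V_n$,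 so each $M_i$ is finite dimensional. The multiplicity space is realized as $V_{M_i}=\{f(w_i)\mid f\in\mathrm{Hom}_H(M_i,V)\}\subset V$ for a fixed nonzero $w_i\in M_i$; the operators $u_n$ ($u\in V^H$) commute with $H$, hence preserve $V_{M_i}$, and this gives its $V^H$-module structure (independent of $w_i$ up to isomorphism).
   Formalization: In the Jacobi identity, (z1+z2)^n is expanded in nonnegative powers of the second summand z2 (the standard convention), not of z1 as printed in the definitions; with the printed expansion the products are undefined and no nonzero vertex operator algebra exists. *)

theory Defs
  imports Complex_Main "HOL-Library.Poly_Mapping" "HOL-Library.Groups_Big_Fun"
begin

section \<open>Complex vector spaces and algebras\<close>

class scaleC =
  fixes scaleC :: "complex \<Rightarrow> 'a \<Rightarrow> 'a" (infixr \<open>*\<^sub>C\<close> 75)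

class complex_vector = scaleC + ab_group_add +
  assumes scaleC_add_right: "c *\<^sub>C (x + y) = c *\<^sub>C x + c *\<^sub>C y"
    and scaleC_add_left: "(c + d) *\<^sub>C x = c *\<^sub>C x + d *\<^sub>C x"
    and scaleC_scaleC: "c *\<^sub>C d *\<^sub>C x = (c * d) *\<^sub>C x"
    and scaleC_one: "1 *\<^sub>C x = x"

class complex_algebra_1 = complex_vector + ring_1 +
  assumes mult_scaleC_left: "(c *\<^sub>C x) * y = c *\<^sub>C (x * y)"
    and mult_scaleC_right: "x * (c *\<^sub>C y) = c *\<^sub>C (x * y)"

global_interpretation complex_vector: vector_space "scaleC :: complex \<Rightarrow> 'a \<Rightarrow> 'a::complex_vector"
  defines csubspace = complex_vector.subspace
    and cspan = complex_vector.span
  by unfold_locales (simp_all add: scaleC_add_right scaleC_add_left scaleC_scaleC scaleC_one)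

instantiation complex :: complex_algebra_1
begin
definition scaleC_complex :: "complex \<Rightarrow> complex \<Rightarrow> complex" where
  "scaleC_complex c x = c * x"
instance by standard (simp_all add: scaleC_complex_def algebra_simps)
end

instantiation poly_mapping :: (type, complex_vector) complex_vector
begin
definition scaleC_poly_mapping :: "complex \<Rightarrow> ('a \<Rightarrow>\<^sub>0 'b) \<Rightarrow> ('a \<Rightarrow>\<^sub>0 'b)" where
  "scaleC_poly_mapping c f = Poly_Mapping.map (scaleC c) f"

lemma lookup_scaleC: "Poly_Mapping.lookup (c *\<^sub>C f) k = c *\<^sub>C Poly_Mapping.lookup f k"
  for f :: "'a \<Rightarrow>\<^sub>0 'b"
  by (simp add: scaleC_poly_mapping_def Poly_Mapping.map.rep_eq when_def)

instance
  by standard (auto intro!: poly_mapping_eqI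
      simp: lookup_scaleC lookup_add scaleC_add_right scaleC_add_left scaleC_scaleC scaleC_one)
end

definition clinear_on :: "'a::complex_vector set \<Rightarrow> ('a \<Rightarrow> 'b::complex_vector) \<Rightarrow> bool" where
  "clinear_on A f \<longleftrightarrow>
     (\<forall>x\<in>A. \<forall>y\<in>A. f (x + y) = f x + f y) \<and> (\<forall>c. \<forall>x\<in>A. f (c *\<^sub>C x) = c *\<^sub>C f x)"

definition cbilinear :: "('a::complex_vector \<Rightarrow> 'b::complex_vector \<Rightarrow> 'c::complex_vector) \<Rightarrow> bool" where
  "cbilinear \<beta> \<longleftrightarrow> (\<forall>a. clinear_on UNIV (\<beta> a)) \<and> (\<forall>b. clinear_on UNIV (\<lambda>a. \<beta> a b))"

definition finite_dimensional :: "'a::complex_vector set \<Rightarrow> bool" where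
  "finite_dimensional W \<longleftrightarrow> (\<exists>B. finite B \<and> W \<subseteq> cspan B)"

definition internal_direct_sum ::
  "'v::complex_vector set \<Rightarrow> 'k set \<Rightarrow> ('k \<Rightarrow> 'v set) \<Rightarrow> bool" where
  "internal_direct_sum V K W \<longleftrightarrow>
     csubspace V \<and> (\<forall>k\<in>K. csubspace (W k) \<and> W k \<subseteq> V) \<and>
     (\<forall>v\<in>V. \<exists>!f. finite {k. f k \<noteq> 0} \<and> (\<forall>k\<in>K. f k \<in> W k) \<and> (\<forall>k. k \<notin> K \<longrightarrow> f k = 0) \<and>
        v = (\<Sum>k | f k \<noteq> 0. f k))"


section \<open>Tensor products\<close>

text \<open>The tensor product is the free vector space on the pairs modulo the bilinearity relations.\<close>

definition tensor_relations ::
  "(('a::complex_vector \<times> 'b::complex_vector) \<Rightarrow>\<^sub>0 complex) set" where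
  "tensor_relations =
     {Poly_Mapping.single (a + a', b) 1 - Poly_Mapping.single (a, b) 1 - Poly_Mapping.single (a', b) 1
        | a a' b. True} \<union>
     {Poly_Mapping.single (a, b + b') 1 - Poly_Mapping.single (a, b) 1 - Poly_Mapping.single (a, b') 1
        | a b b'. True} \<union>
     {Poly_Mapping.single (c *\<^sub>C a, b) 1 - Poly_Mapping.single (a, b) c | c a b. True} \<union>
     {Poly_Mapping.single (a, c *\<^sub>C b) 1 - Poly_Mapping.single (a, b) c | c a b. True}"

definition tensor_equiv ::
  "(('a::complex_vector \<times> 'b::complex_vector) \<Rightarrow>\<^sub>0 complex) \<Rightarrow> (('a \<times> 'b) \<Rightarrow>\<^sub>0 complex) \<Rightarrow> bool" where
  "tensor_equiv s t \<longleftrightarrow> s - t \<in> cspan tensor_relations"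

lemma equivp_tensor_equiv:
  "equivp (tensor_equiv :: (('a::complex_vector \<times> 'b::complex_vector) \<Rightarrow>\<^sub>0 complex) \<Rightarrow> _)"
proof (rule equivpI)
  show "reflp (tensor_equiv :: (('a \<times> 'b) \<Rightarrow>\<^sub>0 complex) \<Rightarrow> _)"
    by (simp add: reflp_def tensor_equiv_def complex_vector.span_zero)
  show "symp (tensor_equiv :: (('a \<times> 'b) \<Rightarrow>\<^sub>0 complex) \<Rightarrow> _)"
  proof (rule sympI)
    fix s t :: "('a \<times> 'b) \<Rightarrow>\<^sub>0 complex"
    assume "tensor_equiv s t"
    then have "- (s - t) \<in> cspan tensor_relations"
      unfolding tensor_equiv_def by (rule complex_vector.span_neg)
    then show "tensor_equiv t s" by (simp add: tensor_equiv_def)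
  qed
  show "transp (tensor_equiv :: (('a \<times> 'b) \<Rightarrow>\<^sub>0 complex) \<Rightarrow> _)"
  proof (rule transpI)
    fix s t r :: "('a \<times> 'b) \<Rightarrow>\<^sub>0 complex"
    assume "tensor_equiv s t" "tensor_equiv t r"
    then have "(s - t) + (t - r) \<in> cspan tensor_relations"
      unfolding tensor_equiv_def by (rule complex_vector.span_add)
    then show "tensor_equiv s r" by (simp add: tensor_equiv_def)
  qed
qed

quotient_type (overloaded) ('a, 'b) tensor =
  "('a::complex_vector \<times> 'b::complex_vector) \<Rightarrow>\<^sub>0 complex" / tensor_equiv
  by (rule equivp_tensor_equiv)

instantiation tensor :: (complex_vector, complex_vector) complex_vector
begin

lift_definition zero_tensor :: "('a, 'b) tensor" is 0 .

lift_definition plus_tensor :: "('a, 'b) tensor \<Rightarrow> ('a, 'b) tensor \<Rightarrow> ('a, 'b) tensor" is "(+)"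
proof -
  fix s s' t t' :: "('a \<times> 'b) \<Rightarrow>\<^sub>0 complex"
  assume "tensor_equiv s s'" "tensor_equiv t t'"
  then have "(s - s') + (t - t') \<in> cspan tensor_relations"
    unfolding tensor_equiv_def by (rule complex_vector.span_add)
  then show "tensor_equiv (s + t) (s' + t')" by (simp add: tensor_equiv_def add_diff_add)
qed

lift_definition uminus_tensor :: "('a, 'b) tensor \<Rightarrow> ('a, 'b) tensor" is uminus
proof -
  fix s s' :: "('a \<times> 'b) \<Rightarrow>\<^sub>0 complex"
  assume "tensor_equiv s s'"
  then have "- (s - s') \<in> cspan tensor_relations"
    unfolding tensor_equiv_def by (rule complex_vector.span_neg)
  then show "tensor_equiv (- s) (- s')" by (simp add: tensor_equiv_def)
qed

lift_definition minus_tensor :: "('a, 'b) tensor \<Rightarrow> ('a, 'b) tensor \<Rightarrow> ('a, 'b) tensor" is "(-)"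
proof -
  fix s s' t t' :: "('a \<times> 'b) \<Rightarrow>\<^sub>0 complex"
  assume "tensor_equiv s s'" "tensor_equiv t t'"
  then have "(s - s') - (t - t') \<in> cspan tensor_relations"
    unfolding tensor_equiv_def by (rule complex_vector.span_diff)
  moreover have "(s - t) - (s' - t') = (s - s') - (t - t')" by simp
  ultimately show "tensor_equiv (s - t) (s' - t')" by (simp only: tensor_equiv_def)
qed

lift_definition scaleC_tensor :: "complex \<Rightarrow> ('a, 'b) tensor \<Rightarrow> ('a, 'b) tensor" is scaleC
proof -
  fix c :: complex and s s' :: "('a \<times> 'b) \<Rightarrow>\<^sub>0 complex"
  assume "tensor_equiv s s'"
  then have "c *\<^sub>C (s - s') \<in> cspan tensor_relations"
    unfolding tensor_equiv_def by (rule complex_vector.span_scale)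
  then show "tensor_equiv (c *\<^sub>C s) (c *\<^sub>C s')"
    by (simp add: tensor_equiv_def complex_vector.scale_right_diff_distrib)
qed

instance
  by (standard; transfer)
    (simp_all add: scaleC_add_right scaleC_add_left scaleC_scaleC scaleC_one algebra_simps
      equivp_reflp[OF equivp_tensor_equiv])

end

lift_definition pure_tensor ::
  "'a::complex_vector \<Rightarrow> 'b::complex_vector \<Rightarrow> ('a, 'b) tensor" is
  "\<lambda>a b. Poly_Mapping.single (a, b) 1" .

definition free_lift ::
  "('a::complex_vector \<Rightarrow> 'b::complex_vector \<Rightarrow> 'c::complex_vector) \<Rightarrow>
     (('a \<times> 'b) \<Rightarrow>\<^sub>0 complex) \<Rightarrow> 'c" where
  "free_lift \<beta> s = (\<Sum>(a, b)\<in>Poly_Mapping.keys s. Poly_Mapping.lookup s (a, b) *\<^sub>C \<beta> a b)"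

lemma free_lift_superset:
  assumes "finite K" "Poly_Mapping.keys s \<subseteq> K"
  shows "free_lift \<beta> s = (\<Sum>p\<in>K. Poly_Mapping.lookup s p *\<^sub>C \<beta> (fst p) (snd p))"
  unfolding free_lift_def case_prod_beta prod.collapse
  by (rule sum.mono_neutral_left) (use assms in \<open>auto simp: in_keys_iff\<close>)

lemma free_lift_add: "free_lift \<beta> (s + t) = free_lift \<beta> s + free_lift \<beta> t"
proof -
  let ?K = "Poly_Mapping.keys s \<union> Poly_Mapping.keys t"
  have "Poly_Mapping.keys (s + t) \<subseteq> ?K" by (rule keys_add)
  then show ?thesis
    by (simp add: free_lift_superset[of ?K] lookup_add scaleC_add_left sum.distrib)
qed

lemma free_lift_scale: "free_lift \<beta> (c *\<^sub>C s) = c *\<^sub>C free_lift \<beta> s"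
proof -
  have "Poly_Mapping.keys (c *\<^sub>C s) \<subseteq> Poly_Mapping.keys s"
    by (auto simp: in_keys_iff lookup_scaleC)
  then show ?thesis
    by (simp add: free_lift_superset[of "Poly_Mapping.keys s"] lookup_scaleC scaleC_complex_def
        complex_vector.scale_sum_right scaleC_scaleC)
qed

lemma free_lift_diff: "free_lift \<beta> (s - t) = free_lift \<beta> s - free_lift \<beta> t"
  by (metis free_lift_add add_diff_cancel_right' diff_add_cancel)

lemma free_lift_single [simp]: "free_lift \<beta> (Poly_Mapping.single (a, b) c) = c *\<^sub>C \<beta> a b"
  by (simp add: free_lift_superset[of "{(a, b)}"])

lemma free_lift_relations:
  assumes "cbilinear \<beta>" "s \<in> cspan tensor_relations"
  shows "free_lift \<beta> s = 0"
  using assms(2)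
proof (induction rule: complex_vector.span_induct)
  case base
  show ?case
    unfolding complex_vector.subspace_def
    by (auto simp: free_lift_add free_lift_scale) (simp add: free_lift_def)
next
  case (step x)
  then show ?case
    using assms(1) unfolding tensor_relations_def cbilinear_def clinear_on_def
    by (auto simp: free_lift_diff scaleC_one)
qed

text \<open>The universal property: the linear map with \<open>a \<otimes> b \<mapsto> \<beta> a b\<close>,
  i.e. \<open>tensor_lift \<beta> (\<Delta> h)\<close> is Sweedler's \<open>\<Sum> \<beta> h\<^sub>1 h\<^sub>2\<close>.
  Junk value 0 if \<open>\<beta>\<close> is not bilinear.\<close>

lift_definition tensor_lift ::
  "('a::complex_vector \<Rightarrow> 'b::complex_vector \<Rightarrow> 'c::complex_vector) \<Rightarrow> ('a, 'b) tensor \<Rightarrow> 'c" is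
  "\<lambda>\<beta> s. if cbilinear \<beta> then free_lift \<beta> s else 0"
proof -
  fix \<beta> :: "'a \<Rightarrow> 'b \<Rightarrow> 'c" and s t :: "('a \<times> 'b) \<Rightarrow>\<^sub>0 complex"
  assume "tensor_equiv s t"
  then have "free_lift \<beta> (s - t) = 0" if "cbilinear \<beta>"
    using that unfolding tensor_equiv_def by (intro free_lift_relations)
  then show "(if cbilinear \<beta> then free_lift \<beta> s else 0) = (if cbilinear \<beta> then free_lift \<beta> t else 0)"
    by (simp add: free_lift_diff)
qed

lemma tensor_lift_pure: "cbilinear \<beta> \<Longrightarrow> tensor_lift \<beta> (pure_tensor a b) = \<beta> a b"
  by transfer (simp add: scaleC_one)

lemma clinear_tensor_lift: "clinear_on UNIV (tensor_lift \<beta>)"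
proof -
  have "tensor_lift \<beta> (s + t) = tensor_lift \<beta> s + tensor_lift \<beta> t" for s t
    by transfer (simp add: free_lift_add)
  moreover have "tensor_lift \<beta> (c *\<^sub>C s) = c *\<^sub>C tensor_lift \<beta> s" for c s
    by transfer (simp add: free_lift_scale)
  ultimately show ?thesis by (simp add: clinear_on_def)
qed

lemma cbilinear_pure_tensor: "cbilinear pure_tensor"
proof -
  have single_scale: "Poly_Mapping.single p c = c *\<^sub>C Poly_Mapping.single p 1"
    for c and p :: "'a::complex_vector \<times> 'b::complex_vector"
    by (rule poly_mapping_eqI) (simp add: lookup_scaleC lookup_single scaleC_complex_def when_def)
  have "pure_tensor (a + a') b = pure_tensor a b + pure_tensor a' b" for a a' :: 'a and b :: 'b
  proof (transfer, unfold tensor_equiv_def diff_add_eq_diff_diff_swap, rule complex_vector.span_base)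
    fix a a' :: 'a and b :: 'b
    have "Poly_Mapping.single (a' + a, b) 1 - Poly_Mapping.single (a', b) 1 - Poly_Mapping.single (a, b) 1
        \<in> tensor_relations"
      unfolding tensor_relations_def by blast
    then show "Poly_Mapping.single (a + a', b) 1 - Poly_Mapping.single (a', b) 1 - Poly_Mapping.single (a, b) 1
        \<in> tensor_relations"
      by (simp only: add.commute)
  qed
  moreover have "pure_tensor a (b + b') = pure_tensor a b + pure_tensor a b'" for a :: 'a and b b' :: 'b
  proof (transfer, unfold tensor_equiv_def diff_add_eq_diff_diff_swap, rule complex_vector.span_base)
    fix a :: 'a and b b' :: 'b
    have "Poly_Mapping.single (a, b' + b) 1 - Poly_Mapping.single (a, b') 1 - Poly_Mapping.single (a, b) 1
        \<in> tensor_relations"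
      unfolding tensor_relations_def by blast
    then show "Poly_Mapping.single (a, b + b') 1 - Poly_Mapping.single (a, b') 1 - Poly_Mapping.single (a, b) 1
        \<in> tensor_relations"
      by (simp only: add.commute)
  qed
  moreover have "pure_tensor (c *\<^sub>C a) b = c *\<^sub>C pure_tensor a b" for c and a :: 'a and b :: 'b
    by (transfer, unfold tensor_equiv_def single_scale[symmetric], rule complex_vector.span_base,
        unfold tensor_relations_def) blast
  moreover have "pure_tensor a (c *\<^sub>C b) = c *\<^sub>C pure_tensor a b" for c and a :: 'a and b :: 'b
    by (transfer, unfold tensor_equiv_def single_scale[symmetric], rule complex_vector.span_base,
        unfold tensor_relations_def) blast
  ultimately show ?thesis
    by (simp add: cbilinear_def clinear_on_def)
qed

definition tensor_mult ::
  "('a::complex_algebra_1, 'b::complex_algebra_1) tensor \<Rightarrow> ('a, 'b) tensor \<Rightarrow> ('a, 'b) tensor" where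
  "tensor_mult s t =
     tensor_lift (\<lambda>a b. tensor_lift (\<lambda>a' b'. pure_tensor (a * a') (b * b')) t) s"

definition tensor_assoc ::
  "(('a::complex_vector, 'b::complex_vector) tensor, 'c::complex_vector) tensor
     \<Rightarrow> ('a, ('b, 'c) tensor) tensor" where
  "tensor_assoc =
     tensor_lift (\<lambda>s c. tensor_lift (\<lambda>a b. pure_tensor a (pure_tensor b c)) s)"


section \<open>Hopf algebras and their modules\<close>

locale hopf_algebra =
  fixes \<Delta> :: "'h::complex_algebra_1 \<Rightarrow> ('h, 'h) tensor"
    and \<epsilon> :: "'h \<Rightarrow> complex"
    and S :: "'h \<Rightarrow> 'h"
  assumes comult_linear: "clinear_on UNIV \<Delta>"
    and comult_one: "\<Delta> 1 = pure_tensor 1 1"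
    and comult_mult: "\<Delta> (g * h) = tensor_mult (\<Delta> g) (\<Delta> h)"
    and counit_linear: "clinear_on UNIV \<epsilon>"
    and counit_one: "\<epsilon> 1 = 1"
    and counit_mult: "\<epsilon> (g * h) = \<epsilon> g * \<epsilon> h"
    and coassoc: "tensor_assoc (tensor_lift (\<lambda>a b. pure_tensor (\<Delta> a) b) (\<Delta> h)) =
                  tensor_lift (\<lambda>a b. pure_tensor a (\<Delta> b)) (\<Delta> h)"
    and counit_left: "tensor_lift (\<lambda>a b. \<epsilon> a *\<^sub>C b) (\<Delta> h) = h"
    and counit_right: "tensor_lift (\<lambda>a b. \<epsilon> b *\<^sub>C a) (\<Delta> h) = h"
    and antipode_linear: "clinear_on UNIV S"
    and antipode_left: "tensor_lift (\<lambda>a b. S a * b) (\<Delta> h) = \<epsilon> h *\<^sub>C 1"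
    and antipode_right: "tensor_lift (\<lambda>a b. a * S b) (\<Delta> h) = \<epsilon> h *\<^sub>C 1"

text \<open>Modules live on a subspace \<open>M\<close> of an ambient type;
  the action outside \<open>M\<close> is irrelevant.\<close>

definition alg_module ::
  "('h::complex_algebra_1 \<Rightarrow> 'm::complex_vector \<Rightarrow> 'm) \<Rightarrow> 'm set \<Rightarrow> bool" where
  "alg_module act M \<longleftrightarrow>
     csubspace M \<and> (\<forall>h. \<forall>x\<in>M. act h x \<in> M) \<and>
     (\<forall>h. clinear_on M (act h)) \<and> (\<forall>x\<in>M. clinear_on UNIV (\<lambda>h. act h x)) \<and>
     (\<forall>x\<in>M. act 1 x = x) \<and> (\<forall>g h. \<forall>x\<in>M. act (g * h) x = act g (act h x))"

definition alg_submodule ::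
  "('h::complex_algebra_1 \<Rightarrow> 'm::complex_vector \<Rightarrow> 'm) \<Rightarrow> 'm set \<Rightarrow> 'm set \<Rightarrow> bool" where
  "alg_submodule act W M \<longleftrightarrow> csubspace W \<and> W \<subseteq> M \<and> (\<forall>h. \<forall>x\<in>W. act h x \<in> W)"

definition simple_alg_module ::
  "('h::complex_algebra_1 \<Rightarrow> 'm::complex_vector \<Rightarrow> 'm) \<Rightarrow> 'm set \<Rightarrow> bool" where
  "simple_alg_module act M \<longleftrightarrow>
     alg_module act M \<and> M \<noteq> {0} \<and> (\<forall>W. alg_submodule act W M \<longrightarrow> W = {0} \<or> W = M)"

definition semisimple_alg_module ::
  "('h::complex_algebra_1 \<Rightarrow> 'm::complex_vector \<Rightarrow> 'm) \<Rightarrow> 'm set \<Rightarrow> bool" where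
  "semisimple_alg_module act M \<longleftrightarrow>
     alg_module act M \<and>
     (\<exists>\<W>. (\<forall>W\<in>\<W>. alg_submodule act W M \<and> simple_alg_module act W) \<and>
          internal_direct_sum M \<W> (\<lambda>W. W))"

definition alg_hom ::
  "('h::complex_algebra_1 \<Rightarrow> 'm::complex_vector \<Rightarrow> 'm) \<Rightarrow> 'm set \<Rightarrow>
   ('h \<Rightarrow> 'n::complex_vector \<Rightarrow> 'n) \<Rightarrow> 'n set \<Rightarrow> ('m \<Rightarrow> 'n) set" where
  "alg_hom act M act' N =
     {f. clinear_on M f \<and> f ` M \<subseteq> N \<and> (\<forall>h. \<forall>x\<in>M. f (act h x) = act' h (f x))}"

definition alg_module_iso ::
  "('h::complex_algebra_1 \<Rightarrow> 'm::complex_vector \<Rightarrow> 'm) \<Rightarrow> 'm set \<Rightarrow>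
   ('h \<Rightarrow> 'n::complex_vector \<Rightarrow> 'n) \<Rightarrow> 'n set \<Rightarrow> bool" where
  "alg_module_iso act M act' N \<longleftrightarrow> (\<exists>f\<in>alg_hom act M act' N. bij_betw f M N)"

definition simple_constituents ::
  "('h::complex_algebra_1 \<Rightarrow> 'v::complex_vector \<Rightarrow> 'v) \<Rightarrow> 'v set \<Rightarrow>
   'i set \<Rightarrow> ('i \<Rightarrow> 'h \<Rightarrow> 'm::complex_vector \<Rightarrow> 'm) \<Rightarrow> ('i \<Rightarrow> 'm set) \<Rightarrow> bool" where
  "simple_constituents act V I \<rho> M \<longleftrightarrow>
     (\<forall>i\<in>I. simple_alg_module (\<rho> i) (M i) \<and>
        (\<exists>W. alg_submodule act W V \<and> alg_module_iso (\<rho> i) (M i) act W)) \<and>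
     (\<forall>i\<in>I. \<forall>j\<in>I. i \<noteq> j \<longrightarrow> \<not> alg_module_iso (\<rho> i) (M i) (\<rho> j) (M j)) \<and>
     (\<forall>W. alg_submodule act W V \<and> simple_alg_module act W \<longrightarrow>
        (\<exists>i\<in>I. alg_module_iso (\<rho> i) (M i) act W))"

definition invariants :: "('h \<Rightarrow> complex) \<Rightarrow> ('h \<Rightarrow> 'v::complex_vector \<Rightarrow> 'v) \<Rightarrow> 'v set \<Rightarrow> 'v set" where
  "invariants \<epsilon> act V = {v\<in>V. \<forall>h. act h v = \<epsilon> h *\<^sub>C v}"

text \<open>For simple \<open>M\<close> and \<open>0 \<noteq> w \<in> M\<close>, evaluation at \<open>w\<close> identifies \<open>Hom\<^sub>H(M, V)\<close> with this subspace
  of \<open>V\<close>; the vertex operators of the invariants act on it by restriction of \<open>Y\<close>.\<close>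

definition multiplicity_space ::
  "('h::complex_algebra_1 \<Rightarrow> 'm::complex_vector \<Rightarrow> 'm) \<Rightarrow> 'm set \<Rightarrow> 'm \<Rightarrow>
   ('h \<Rightarrow> 'v::complex_vector \<Rightarrow> 'v) \<Rightarrow> 'v set \<Rightarrow> 'v set" where
  "multiplicity_space \<rho> M w act V = {f w | f. f \<in> alg_hom \<rho> M act V}"


section \<open>Vertex operator algebras and their modules\<close>

text \<open>A vertex operator map is given by its modes: \<open>Y u n v\<close> is \<open>u\<^sub>n v\<close>.\<close>

text \<open>Coefficient of \<open>x\<^sup>p y\<^sup>q\<close> in \<open>(x + y)\<^sup>n\<close>, expanded in nonnegative powers of the second
  summand \<open>y\<close>. This is the standard convention; with the opposite one the products in
  the Jacobi identity would not be defined.\<close>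

definition binomial_coeff :: "int \<Rightarrow> int \<Rightarrow> int \<Rightarrow> complex" where
  "binomial_coeff n p q = (if 0 \<le> q \<and> p + q = n then of_int n gchoose nat q else 0)"

text \<open>Coefficients of \<open>z\<^sub>0\<^sup>a z\<^sub>1\<^sup>p z\<^sub>2\<^sup>q\<close> in the three expanded delta functions,
  e.g. \<open>z\<^sub>0\<^sup>-\<^sup>1 \<delta>((z\<^sub>1 - z\<^sub>2)/z\<^sub>0) = (\<Sum>n. z\<^sub>0\<^sup>-\<^sup>n\<^sup>-\<^sup>1 (z\<^sub>1 - z\<^sub>2)\<^sup>n)\<close>.\<close>

definition delta_12_0 :: "int \<Rightarrow> int \<Rightarrow> int \<Rightarrow> complex" \<comment> \<open>\<open>z\<^sub>0\<^sup>-\<^sup>1 \<delta>((z\<^sub>1 - z\<^sub>2)/z\<^sub>0)\<close>\<close> where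
  "delta_12_0 a p q = (- 1) powi q * binomial_coeff (- a - 1) p q"

definition delta_21_0 :: "int \<Rightarrow> int \<Rightarrow> int \<Rightarrow> complex" \<comment> \<open>\<open>z\<^sub>0\<^sup>-\<^sup>1 \<delta>((-z\<^sub>2 + z\<^sub>1)/z\<^sub>0)\<close>\<close> where
  "delta_21_0 a p q = (- 1) powi q * binomial_coeff (- a - 1) q p"

definition delta_20_1 :: "int \<Rightarrow> int \<Rightarrow> int \<Rightarrow> complex" \<comment> \<open>\<open>z\<^sub>1\<^sup>-\<^sup>1 \<delta>((z\<^sub>2 + z\<^sub>0)/z\<^sub>1)\<close>\<close> where
  "delta_20_1 a p q = binomial_coeff (- p - 1) q a"

text \<open>The Jacobi identity applied to \<open>w\<close>, as equality of the coefficients of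
  \<open>z\<^sub>0\<^sup>a z\<^sub>1\<^sup>b z\<^sub>2\<^sup>c\<close>. In the presence of the truncation condition each of the three
  sums has finite support, so that \<^const>\<open>Sum_any\<close> is the actual sum.\<close>

definition jacobi_identity ::
  "('u \<Rightarrow> int \<Rightarrow> 'u \<Rightarrow> 'u) \<Rightarrow> ('u \<Rightarrow> int \<Rightarrow> 'm \<Rightarrow> 'm::complex_vector) \<Rightarrow> 'u \<Rightarrow> 'u \<Rightarrow> 'm \<Rightarrow> bool" where
  "jacobi_identity Y Y\<^sub>M u v w \<longleftrightarrow> (\<forall>a b c.
     Sum_any (\<lambda>(p, q). delta_12_0 a p q *\<^sub>C Y\<^sub>M u (p - b - 1) (Y\<^sub>M v (q - c - 1) w)) -
     Sum_any (\<lambda>(p, q). delta_21_0 a p q *\<^sub>C Y\<^sub>M v (q - c - 1) (Y\<^sub>M u (p - b - 1) w)) =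
     Sum_any (\<lambda>(p, q). delta_20_1 p b q *\<^sub>C Y\<^sub>M (Y u (p - a - 1) v) (q - c - 1) w))"

text \<open>\<open>Y(\<omega>,z) = (\<Sum>n. L(n) z\<^sup>-\<^sup>n\<^sup>-\<^sup>2)\<close>, hence \<open>L(n) = \<omega>\<^bsub>n+1\<^esub>\<close>.\<close>

definition virasoro :: "('u \<Rightarrow> int \<Rightarrow> 'm \<Rightarrow> 'm) \<Rightarrow> 'u \<Rightarrow> int \<Rightarrow> 'm \<Rightarrow> 'm" where
  "virasoro Y \<omega> n = Y \<omega> (n + 1)"

definition weight_space ::
  "'m::complex_vector set \<Rightarrow> ('u \<Rightarrow> int \<Rightarrow> 'm \<Rightarrow> 'm) \<Rightarrow> 'u \<Rightarrow> complex \<Rightarrow> 'm set" where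
  "weight_space M Y \<omega> \<mu> = {w\<in>M. virasoro Y \<omega> 0 w = \<mu> *\<^sub>C w}"

text \<open>The grading is not a separate datum: \<open>V\<^sub>n\<close> is the \<open>L(0)\<close>-eigenspace of eigenvalue \<open>n\<close>.\<close>

locale vertex_operator_algebra =
  fixes V :: "'v::complex_vector set"
    and Y :: "'v \<Rightarrow> int \<Rightarrow> 'v \<Rightarrow> 'v"
    and vac :: 'v
    and \<omega> :: 'v
  assumes grading: "internal_direct_sum V UNIV (\<lambda>n::int. weight_space V Y \<omega> (of_int n))"
    and weight_finite_dim: "finite_dimensional (weight_space V Y \<omega> (of_int n))"
    and weight_bounded: "\<exists>N::int. \<forall>n<N. weight_space V Y \<omega> (of_int n) = {0}"
    and vac_weight: "vac \<in> weight_space V Y \<omega> 0"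
    and omega_weight: "\<omega> \<in> weight_space V Y \<omega> 2"
    and mode_closed: "\<lbrakk>u \<in> V; v \<in> V\<rbrakk> \<Longrightarrow> Y u n v \<in> V"
    and mode_linear: "u \<in> V \<Longrightarrow> clinear_on V (Y u n)"
    and vertex_map_linear: "v \<in> V \<Longrightarrow> clinear_on V (\<lambda>u. Y u n v)"
    and truncation: "\<lbrakk>u \<in> V; v \<in> V\<rbrakk> \<Longrightarrow> \<exists>N. \<forall>n\<ge>N. Y u n v = 0"
    and vacuum: "v \<in> V \<Longrightarrow> Y vac n v = (if n = - 1 then v else 0)"
    and creation: "v \<in> V \<Longrightarrow> Y v (- 1) vac = v"
    and creation_regular: "\<lbrakk>v \<in> V; 0 \<le> n\<rbrakk> \<Longrightarrow> Y v n vac = 0"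
    and translation: "\<lbrakk>u \<in> V; v \<in> V\<rbrakk> \<Longrightarrow>
      Y (virasoro Y \<omega> (- 1) u) n v = of_int (- n) *\<^sub>C Y u (n - 1) v"
    and virasoro_relations: "\<exists>c. \<forall>m n. \<forall>v\<in>V.
      virasoro Y \<omega> m (virasoro Y \<omega> n v) - virasoro Y \<omega> n (virasoro Y \<omega> m v) =
        of_int (m - n) *\<^sub>C virasoro Y \<omega> (m + n) v +
        (if m + n = 0 then (of_int (m ^ 3 - m) / 12 * c) *\<^sub>C v else 0)"
    and jacobi: "\<lbrakk>u \<in> V; v \<in> V; w \<in> V\<rbrakk> \<Longrightarrow> jacobi_identity Y Y u v w"

definition voa_ideal :: "'v::complex_vector set \<Rightarrow> ('v \<Rightarrow> int \<Rightarrow> 'v \<Rightarrow> 'v) \<Rightarrow> 'v set \<Rightarrow> bool" where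
  "voa_ideal V Y J \<longleftrightarrow>
     csubspace J \<and> J \<subseteq> V \<and> (\<forall>u\<in>V. \<forall>v\<in>J. \<forall>n. Y u n v \<in> J \<and> Y v n u \<in> J)"

definition simple_voa ::
  "'v::complex_vector set \<Rightarrow> ('v \<Rightarrow> int \<Rightarrow> 'v \<Rightarrow> 'v) \<Rightarrow> 'v \<Rightarrow> 'v \<Rightarrow> bool" where
  "simple_voa V Y vac \<omega> \<longleftrightarrow>
     vertex_operator_algebra V Y vac \<omega> \<and> V \<noteq> {0} \<and> (\<forall>J. voa_ideal V Y J \<longrightarrow> J = {0} \<or> J = V)"

locale weak_voa_module =
  fixes U :: "'u::complex_vector set"
    and Y :: "'u \<Rightarrow> int \<Rightarrow> 'u \<Rightarrow> 'u"
    and vac :: 'u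
    and M :: "'m::complex_vector set"
    and Y\<^sub>M :: "'u \<Rightarrow> int \<Rightarrow> 'm \<Rightarrow> 'm"
  assumes module_subspace: "csubspace M"
    and module_closed: "\<lbrakk>u \<in> U; w \<in> M\<rbrakk> \<Longrightarrow> Y\<^sub>M u n w \<in> M"
    and module_mode_linear: "u \<in> U \<Longrightarrow> clinear_on M (Y\<^sub>M u n)"
    and module_map_linear: "w \<in> M \<Longrightarrow> clinear_on U (\<lambda>u. Y\<^sub>M u n w)"
    and module_truncation: "\<lbrakk>u \<in> U; w \<in> M\<rbrakk> \<Longrightarrow> \<exists>N. \<forall>n\<ge>N. Y\<^sub>M u n w = 0"
    and module_vacuum: "w \<in> M \<Longrightarrow> Y\<^sub>M vac n w = (if n = - 1 then w else 0)"
    and module_jacobi: "\<lbrakk>u \<in> U; v \<in> U; w \<in> M\<rbrakk> \<Longrightarrow> jacobi_identity Y Y\<^sub>M u v w"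

locale voa_module = weak_voa_module U Y vac M Y\<^sub>M
  for U :: "'u::complex_vector set"
    and Y :: "'u \<Rightarrow> int \<Rightarrow> 'u \<Rightarrow> 'u"
    and vac :: 'u
    and \<omega> :: 'u
    and M :: "'m::complex_vector set"
    and Y\<^sub>M :: "'u \<Rightarrow> int \<Rightarrow> 'm \<Rightarrow> 'm" +
  assumes module_grading: "internal_direct_sum M UNIV (weight_space M Y\<^sub>M \<omega>)"
    and module_weight_finite_dim: "finite_dimensional (weight_space M Y\<^sub>M \<omega> \<mu>)"
    and module_weight_bounded: "\<exists>N::int. \<forall>n<N. weight_space M Y\<^sub>M \<omega> (\<mu> + of_int n) = {0}"

definition simple_voa_module ::
  "'u::complex_vector set \<Rightarrow> ('u \<Rightarrow> int \<Rightarrow> 'u \<Rightarrow> 'u) \<Rightarrow> 'u \<Rightarrow> 'u \<Rightarrow>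
   'm::complex_vector set \<Rightarrow> ('u \<Rightarrow> int \<Rightarrow> 'm \<Rightarrow> 'm) \<Rightarrow> bool" where
  "simple_voa_module U Y vac \<omega> M Y\<^sub>M \<longleftrightarrow>
     voa_module U Y vac \<omega> M Y\<^sub>M \<and> M \<noteq> {0} \<and>
     (\<forall>N. csubspace N \<and> N \<subseteq> M \<and> (\<forall>u\<in>U. \<forall>n. \<forall>w\<in>N. Y\<^sub>M u n w \<in> N) \<longrightarrow> N = {0} \<or> N = M)"

definition voa_module_iso ::
  "'u set \<Rightarrow> 'm::complex_vector set \<Rightarrow> ('u \<Rightarrow> int \<Rightarrow> 'm \<Rightarrow> 'm) \<Rightarrow>
   'n::complex_vector set \<Rightarrow> ('u \<Rightarrow> int \<Rightarrow> 'n \<Rightarrow> 'n) \<Rightarrow> bool" where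
  "voa_module_iso U M Y\<^sub>M N Y\<^sub>N \<longleftrightarrow>
     (\<exists>f. clinear_on M f \<and> bij_betw f M N \<and>
        (\<forall>u\<in>U. \<forall>n. \<forall>w\<in>M. f (Y\<^sub>M u n w) = Y\<^sub>N u n (f w)))"

definition hopf_module_voa ::
  "('h::complex_algebra_1 \<Rightarrow> ('h, 'h) tensor) \<Rightarrow> ('h \<Rightarrow> complex) \<Rightarrow>
   ('h \<Rightarrow> 'v::complex_vector \<Rightarrow> 'v) \<Rightarrow> 'v set \<Rightarrow> ('v \<Rightarrow> int \<Rightarrow> 'v \<Rightarrow> 'v) \<Rightarrow> 'v \<Rightarrow> bool" where
  "hopf_module_voa \<Delta> \<epsilon> act V Y \<omega> \<longleftrightarrow>
     alg_module act V \<and>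
     (\<forall>h. act h \<omega> = \<epsilon> h *\<^sub>C \<omega>) \<and>
     (\<forall>h. \<forall>u\<in>V. \<forall>v\<in>V. \<forall>n.
        act h (Y u n v) = tensor_lift (\<lambda>a b. Y (act a u) n (act b v)) (\<Delta> h))"

end

(*
  By the commutator and associativity formulas, left ideals of a VOA are ideals and, on a finite
  set of vectors, a composite of modes is a sum of single modes. Hence for simple V the Jacobson
  density theorem applies to the modes: on a finite-dimensional subspace W, every linear map
  W -> V is a sum of modes u_n. If W is H-stable and the map f is H-linear, the vectors u can be
  taken in V^H. Indeed (c u)_n = sum c_1 u_n S(c_2), so that replacing each u by c u changes f to
  eps(c) f; and since V is semisimple there is an element c with eps(c) = 1 which maps the finitely
  many vectors u into V^H (it kills their components in nontrivial simple submodules).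

  For H-homomorphisms f, g from M_i to V with f nonzero, apply this to g f^{-1} on W = f(M_i): some
  sum of modes of V^H maps f(w_i) to g(w_i), so V_{M_i} is simple. For M_i and M_j not isomorphic,
  apply it to the projection of f(M_i) + g(M_j) onto f(M_i): some sum of modes of V^H fixes f(w_i)
  and kills g(w_j), so no V^H-isomorphism maps f(w_i) to g(w_j). The simplicity of V^H is the case
  of the trivial module. Subspaces of V stable under L(0) inherit the grading.
*)

theory Submission
  imports Defs "HOL-Computational_Algebra.Fundamental_Theorem_Algebra"
begin

section \<open>Eigenvectors and density\<close>

text \<open>Two finiteness problems shape the proof. The number of single modes needed for a
  composite grows with the vectors it is applied to, so the algebra for the density theorem consists
  of the operators that agree with some sum of modes on each finite set; sums of modes themselves
  need not be closed under composition. Density also needs a finite-dimensional source, while H may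
  be infinite-dimensional. Since \<omega> is invariant, H preserves the finite-dimensional weight
  spaces, and the submodule generated by one vector lies in the sum of finitely many of them. For
  the same reason H may have no integral to average with. The element c is therefore built for the
  given finitely many vectors. It turns f into eps(c) f because H-linearity rewrites sum c_1 f
  S(c_2) as (sum c_1 S(c_2)) f.\<close>

lemma clinear_on_add: "\<lbrakk>clinear_on A f; x \<in> A; y \<in> A\<rbrakk> \<Longrightarrow> f (x + y) = f x + f y"
  by (simp add: clinear_on_def)

lemma clinear_on_scale: "\<lbrakk>clinear_on A f; x \<in> A\<rbrakk> \<Longrightarrow> f (c *\<^sub>C x) = c *\<^sub>C f x"
  by (simp add: clinear_on_def)

lemma clinear_on_zero:
  assumes "csubspace A" "clinear_on A f"
  shows "f 0 = 0"
  using clinear_on_scale[OF assms(2) complex_vector.subspace_0[OF assms(1)], of 0] by simp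

lemma clinear_on_diff:
  assumes "csubspace A" "clinear_on A f" "x \<in> A" "y \<in> A"
  shows "f (x - y) = f x - f y"
  using clinear_on_add[OF assms(2) complex_vector.subspace_diff[OF assms(1,3,4)] assms(4)]
  by (simp add: algebra_simps)

lemma clinear_on_sum:
  assumes "csubspace A" "clinear_on A f" "\<And>k. k \<in> K \<Longrightarrow> x k \<in> A"
  shows "f (\<Sum>k\<in>K. x k) = (\<Sum>k\<in>K. f (x k))"
  using assms(3)
proof (induction K rule: infinite_finite_induct)
  case (insert k K)
  then show ?case
    by (simp add: clinear_on_add[OF assms(2)] complex_vector.subspace_sum[OF assms(1)])
qed (simp_all add: clinear_on_zero[OF assms(1,2)])

lemma clinear_on_subset: "\<lbrakk>clinear_on A f; B \<subseteq> A\<rbrakk> \<Longrightarrow> clinear_on B f"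
  unfolding clinear_on_def by blast

lemma clinear_on_compose:
  "\<lbrakk>clinear_on A f; clinear_on B g; f ` A \<subseteq> B\<rbrakk> \<Longrightarrow> clinear_on A (\<lambda>x. g (f x))"
  by (simp add: clinear_on_def image_subset_iff)

lemma clinear_on_eq_on_span:
  assumes A: "csubspace A" "clinear_on A f" "clinear_on A g"
    and B: "B \<subseteq> A" "A \<subseteq> cspan B" "\<And>b. b \<in> B \<Longrightarrow> f b = g b" and x: "x \<in> A"
  shows "f x = g x"
proof -
  have "csubspace {x\<in>A. f x = g x}"
    using A by (auto simp: complex_vector.subspace_def clinear_on_zero clinear_on_add
        clinear_on_scale)
  moreover have "B \<subseteq> {x\<in>A. f x = g x}" using B by auto
  ultimately have "cspan B \<subseteq> {x\<in>A. f x = g x}"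
    by (rule complex_vector.span_minimal[rotated])
  then show ?thesis using B x by auto
qed

lemma finite_basis_exists:
  assumes "finite_dimensional W"
  obtains B where "finite B" "B \<subseteq> W" "\<not> complex_vector.dependent B" "W \<subseteq> cspan B"
proof -
  obtain B where B: "B \<subseteq> W" "\<not> complex_vector.dependent B" "W \<subseteq> cspan B"
    by (rule complex_vector.maximal_independent_subset)
  moreover obtain F where "finite F" "W \<subseteq> cspan F"
    using assms by (auto simp: finite_dimensional_def)
  ultimately have "finite B"
    using complex_vector.independent_span_bound[of F B] by auto
  with B that show thesis by blast
qed

lemma finite_dimensional_subset: "\<lbrakk>finite_dimensional W; U \<subseteq> W\<rbrakk> \<Longrightarrow> finite_dimensional U"
  unfolding finite_dimensional_def by blast

lemma finite_dimensional_UN: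
  assumes "finite K" "\<And>k. k \<in> K \<Longrightarrow> finite_dimensional (W k)"
  shows "finite_dimensional (cspan (\<Union>k\<in>K. W k))"
proof -
  obtain B where B: "\<And>k. k \<in> K \<Longrightarrow> finite (B k) \<and> W k \<subseteq> cspan (B k)"
    using assms(2) unfolding finite_dimensional_def by metis
  have "cspan (\<Union>k\<in>K. W k) \<subseteq> cspan (\<Union>k\<in>K. B k)"
  proof (rule complex_vector.span_minimal)
    show "(\<Union>k\<in>K. W k) \<subseteq> cspan (\<Union>k\<in>K. B k)"
    proof
      fix x assume "x \<in> (\<Union>k\<in>K. W k)"
      then obtain k where "k \<in> K" "x \<in> W k" by auto
      then have "x \<in> cspan (B k)" using B by auto
      moreover have "cspan (B k) \<subseteq> cspan (\<Union>k\<in>K. B k)"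
        using \<open>k \<in> K\<close> by (intro complex_vector.span_mono) auto
      ultimately show "x \<in> cspan (\<Union>k\<in>K. B k)" by blast
    qed
  qed (rule complex_vector.subspace_span)
  moreover have "finite (\<Union>k\<in>K. B k)" using assms(1) B by auto
  ultimately show ?thesis unfolding finite_dimensional_def by blast
qed

section \<open>Polynomials in an operator and existence of eigenvectors\<close>

definition poly_apply :: "('v::complex_vector \<Rightarrow> 'v) \<Rightarrow> complex poly \<Rightarrow> 'v \<Rightarrow> 'v" where
  "poly_apply \<phi> p x = (\<Sum>i\<le>degree p. coeff p i *\<^sub>C (\<phi> ^^ i) x)"

lemma poly_apply_bound:
  "degree p \<le> d \<Longrightarrow> poly_apply \<phi> p x = (\<Sum>i\<le>d. coeff p i *\<^sub>C (\<phi> ^^ i) x)"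
  unfolding poly_apply_def
  by (rule sum.mono_neutral_left) (auto simp: coeff_eq_0)

text \<open>The \<open>card F + 1\<close> iterates of \<open>x\<close> lie in the span of
  \<open>F\<close>, hence are dependent, and the coefficients of a dependence are those of
  \<open>p\<close>. The polynomial is evaluated at a vector, not formed as an operator, since \<phi>
  is controlled on \<open>W\<close> only.\<close>

lemma finite_dimensional_poly_relation:
  fixes x :: "'v::complex_vector"
  assumes W: "finite_dimensional W" "\<And>y. y \<in> W \<Longrightarrow> \<phi> y \<in> W" and x: "x \<in> W"
  shows "\<exists>p. p \<noteq> 0 \<and> poly_apply \<phi> p x = 0"
proof -
  obtain F where F: "finite F" "W \<subseteq> cspan F" using W by (auto simp: finite_dimensional_def)
  let ?s = "\<lambda>i. (\<phi> ^^ i) x"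
  let ?I = "{..card F}"
  have s: "?s i \<in> W" for i by (induction i) (use W x in auto)
  show ?thesis
  proof (cases "inj_on ?s ?I")
    \<comment> \<open>Dependence is a property of sets, so coinciding iterates are a case of their
      own; here X^i - X^j is the relation.\<close>
    case False
    then obtain i j where ij: "i \<noteq> j" "?s i = ?s j" by (auto simp: inj_on_def)
    let ?p = "monom 1 i - monom 1 j :: complex poly"
    have "coeff ?p i = 1" using ij by simp
    then have "?p \<noteq> 0" by (metis coeff_0 zero_neq_one)
    moreover have "degree ?p \<le> max i j"
      by (rule degree_diff_le) (auto intro: order_trans[OF degree_monom_le])
    then have "poly_apply \<phi> ?p x = (\<Sum>k\<le>max i j. (if k = i then ?s k else 0) - (if k = j then ?s k else 0))"
      by (subst poly_apply_bound) (auto intro!: sum.cong simp: scaleC_one)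
    then have "poly_apply \<phi> ?p x = ?s i - ?s j"
      by (simp only: sum_subtractf sum.delta[OF finite_atMost]) simp
    ultimately show ?thesis using ij by (intro exI[of _ ?p]) simp
  next
    case inj: True
    have "complex_vector.dependent (?s ` ?I)"
    proof (rule ccontr)
      assume "\<not> complex_vector.dependent (?s ` ?I)"
      moreover have "?s ` ?I \<subseteq> cspan F" using s F by auto
      ultimately have "card (?s ` ?I) \<le> card F"
        using complex_vector.independent_span_bound[OF F(1)] by blast
      then show False using card_image[OF inj] by simp
    qed
    then obtain u k where u: "(\<Sum>v\<in>?s ` ?I. u v *\<^sub>C v) = 0" and k: "k \<in> ?I" "u (?s k) \<noteq> 0"
      by (subst (asm) complex_vector.dependent_finite) auto
    define p where "p = (\<Sum>i\<in>?I. monom (u (?s i)) i)"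
    have c: "coeff p i = (if i \<le> card F then u (?s i) else 0)" for i
      by (simp add: p_def coeff_sum if_distrib)
    have "p \<noteq> 0" using k c[of k] by (metis atMost_iff coeff_0)
    moreover have "degree p \<le> card F" using c by (intro degree_le) auto
    then have "poly_apply \<phi> p x = 0"
      using u by (subst poly_apply_bound) (auto simp: c sum.reindex[OF inj])
    ultimately show ?thesis by blast
  qed
qed

lemma poly_apply_linear_factor:
  assumes W: "csubspace W" "clinear_on W \<phi>" "\<And>y. y \<in> W \<Longrightarrow> \<phi> y \<in> W" and x: "x \<in> W"
  shows "poly_apply \<phi> ([:- z, 1:] * q) x = \<phi> (poly_apply \<phi> q x) - z *\<^sub>C poly_apply \<phi> q x"
proof -
  let ?s = "\<lambda>i. (\<phi> ^^ i) x"
  let ?d = "degree q"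
  have s: "?s i \<in> W" for i by (induction i) (use W x in auto)
  have "degree ([:- z, 1:] * q) \<le> Suc ?d"
    using degree_mult_le[of "[:- z, 1:]" q] by simp
  then have "poly_apply \<phi> ([:- z, 1:] * q) x =
      (\<Sum>i\<le>Suc ?d. coeff (pCons 0 q) i *\<^sub>C ?s i - (z * coeff q i) *\<^sub>C ?s i)"
    by (subst poly_apply_bound)
      (auto intro!: sum.cong simp: complex_vector.scale_left_diff_distrib[symmetric])
  also have "\<dots> = (\<Sum>i\<le>Suc ?d. coeff (pCons 0 q) i *\<^sub>C ?s i) - (\<Sum>i\<le>Suc ?d. (z * coeff q i) *\<^sub>C ?s i)"
    by (rule sum_subtractf)
  also have "(\<Sum>i\<le>Suc ?d. coeff (pCons 0 q) i *\<^sub>C ?s i) = (\<Sum>i\<le>?d. coeff q i *\<^sub>C \<phi> (?s i))"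
    by (subst sum.atMost_Suc_shift) simp
  also have "\<dots> = \<phi> (poly_apply \<phi> q x)"
    unfolding poly_apply_def
    by (subst clinear_on_sum[OF W(1,2)])
      (auto simp: clinear_on_scale[OF W(2)] s complex_vector.subspace_scale[OF W(1)])
  also have "(\<Sum>i\<le>Suc ?d. (z * coeff q i) *\<^sub>C ?s i) = z *\<^sub>C poly_apply \<phi> q x"
    by (simp add: poly_apply_def complex_vector.scale_sum_right scaleC_scaleC coeff_eq_0)
  finally show ?thesis .
qed

text \<open>A relation \<open>p\<close> of least degree for a nonzero vector \<open>x\<close> has a
  root \<open>z\<close>, so p = (X - z) q. By minimality q(\<phi>) x is nonzero, and \<phi> - z
  kills it.\<close>

lemma eigenvector_exists:
  fixes \<phi> :: "'v::complex_vector \<Rightarrow> 'v"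
  assumes W: "csubspace W" "finite_dimensional W" "W \<noteq> {0}"
    and \<phi>: "clinear_on W \<phi>" "\<And>y. y \<in> W \<Longrightarrow> \<phi> y \<in> W"
  shows "\<exists>z. \<exists>y\<in>W. y \<noteq> 0 \<and> \<phi> y = z *\<^sub>C y"
proof -
  obtain x where x: "x \<in> W" "x \<noteq> 0"
    using W(3) complex_vector.subspace_0[OF W(1)] by auto
  let ?R = "\<lambda>p. p \<noteq> 0 \<and> poly_apply \<phi> p x = 0"
  define p where "p = arg_min degree ?R"
  have "\<exists>p. ?R p" by (rule finite_dimensional_poly_relation[OF W(2) \<phi>(2) x(1)])
  then obtain p' where p': "?R p'" ..
  have p: "p \<noteq> 0" "poly_apply \<phi> p x = 0"
    using arg_min_natI[of ?R p' degree, OF p'] unfolding p_def by simp_all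
  have minimal: "degree p \<le> degree q" if "q \<noteq> 0" "poly_apply \<phi> q x = 0" for q
    using arg_min_nat_le[of ?R q degree] that unfolding p_def by simp
  have "\<not> constant (poly p)"
  proof
    assume "constant (poly p)"
    then have d: "degree p = 0" by (simp add: constant_degree)
    then have "coeff p 0 *\<^sub>C x = 0" using p(2) by (simp add: poly_apply_def)
    then show False using x p(1) d by (metis complex_vector.scale_eq_0_iff leading_coeff_0_iff)
  qed
  then obtain z where "poly p z = 0" using fundamental_theorem_of_algebra by blast
  then obtain q where q: "p = [:- z, 1:] * q" by (metis poly_eq_0_iff_dvd dvdE)
  have q0: "q \<noteq> 0" using p q by auto
  then have "degree p = Suc (degree q)" unfolding q by (subst degree_mult_eq) auto
  then have "poly_apply \<phi> q x \<noteq> 0" using minimal q0 by fastforce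
  moreover have "\<phi> (poly_apply \<phi> q x) = z *\<^sub>C poly_apply \<phi> q x"
    using p(2) poly_apply_linear_factor[OF W(1) \<phi> x(1)] unfolding q by simp
  moreover have "(\<phi> ^^ i) x \<in> W" for i by (induction i) (use \<phi> x in auto)
  then have "poly_apply \<phi> q x \<in> W"
    unfolding poly_apply_def
    by (intro complex_vector.subspace_sum[OF W(1)] complex_vector.subspace_scale[OF W(1)])
  ultimately show ?thesis by blast
qed

section \<open>Gradings by eigenspaces\<close>

lemma eigenvector_component_mem:
  fixes x :: "'k \<Rightarrow> 'v::complex_vector"
  assumes V: "csubspace V" "clinear_on V L"
    and N: "csubspace N" "\<And>v. v \<in> N \<Longrightarrow> L v \<in> N"
    and K: "finite K" "inj_on \<kappa> K"
    and x: "\<And>k. k \<in> K \<Longrightarrow> x k \<in> V \<and> L (x k) = \<kappa> k *\<^sub>C x k"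
    and sum: "(\<Sum>k\<in>K. x k) \<in> N" and k: "k \<in> K"
  shows "x k \<in> N"
  using K x sum k
proof (induction K arbitrary: x k)
  case (insert j K)
  let ?s = "\<Sum>i\<in>insert j K. x i"
  have "L ?s = (\<Sum>i\<in>insert j K. \<kappa> i *\<^sub>C x i)"
    using insert.prems(2) by (subst clinear_on_sum[OF V]) auto
  \<comment> \<open>Subtracting \<kappa> j from \<open>L\<close> removes the component at
    \<open>j\<close> and multiplies the others by the nonzero \<kappa> i - \<kappa> j; the induction
    hypothesis applies to these scaled components.\<close>
  then have "L ?s - \<kappa> j *\<^sub>C ?s = (\<Sum>i\<in>insert j K. \<kappa> i *\<^sub>C x i - \<kappa> j *\<^sub>C x i)"
    by (simp only: sum_subtractf complex_vector.scale_sum_right)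
  also have "\<dots> = (\<Sum>i\<in>K. (\<kappa> i - \<kappa> j) *\<^sub>C x i)"
    using insert.hyps by (simp add: complex_vector.scale_left_diff_distrib)
  finally have "(\<Sum>i\<in>K. (\<kappa> i - \<kappa> j) *\<^sub>C x i) = L ?s - \<kappa> j *\<^sub>C ?s" by simp
  moreover have "\<dots> \<in> N"
    using insert.prems N by (intro complex_vector.subspace_diff complex_vector.subspace_scale) auto
  moreover have "(\<kappa> i - \<kappa> j) *\<^sub>C x i \<in> V \<and>
      L ((\<kappa> i - \<kappa> j) *\<^sub>C x i) = \<kappa> i *\<^sub>C (\<kappa> i - \<kappa> j) *\<^sub>C x i" if "i \<in> K" for i
    using insert.prems(2)[of i] that V
    by (simp add: clinear_on_scale complex_vector.subspace_scale scaleC_scaleC mult.commute)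
  ultimately have scaled: "(\<kappa> i - \<kappa> j) *\<^sub>C x i \<in> N" if "i \<in> K" for i
    using insert.IH[of "\<lambda>i. (\<kappa> i - \<kappa> j) *\<^sub>C x i" i] insert.prems(1) that by auto
  have others: "x i \<in> N" if "i \<in> K" for i
  proof -
    have "\<kappa> i - \<kappa> j \<noteq> 0"
      using insert.prems(1) insert.hyps that by (auto simp: inj_on_def)
    then have "x i = inverse (\<kappa> i - \<kappa> j) *\<^sub>C (\<kappa> i - \<kappa> j) *\<^sub>C x i"
      by (simp add: scaleC_scaleC scaleC_one)
    then show ?thesis using scaled[OF that] N(1) by (metis complex_vector.subspace_scale)
  qed
  have "x j = ?s - (\<Sum>i\<in>K. x i)" using insert.hyps by simp
  also have "\<dots> \<in> N"
    using others
    by (rule complex_vector.subspace_diff[OF N(1) insert.prems(3) complex_vector.subspace_sum[OF N(1)]])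
  finally show ?case using others insert.prems(4) by auto
qed simp

text \<open>Components of an element of \<open>N\<close> stay in \<open>N\<close> by
  \<open>eigenvector_component_mem\<close>; its case N = {0} is the independence of eigenvectors
  that makes the decomposition unique. Eigenvalues are indexed by an injective \<kappa> so that
  integer and complex gradings are both covered.\<close>

lemma internal_direct_sum_eigenspaces:
  fixes L :: "'v::complex_vector \<Rightarrow> 'v"
  assumes V: "csubspace V" "clinear_on V L"
    and N: "csubspace N" "N \<subseteq> V" "\<And>v. v \<in> N \<Longrightarrow> L v \<in> N"
    and \<kappa>: "inj \<kappa>"
    and decomp: "\<And>v. v \<in> N \<Longrightarrow>
      \<exists>F x. finite F \<and> (\<forall>k\<in>F. x k \<in> V \<and> L (x k) = \<kappa> k *\<^sub>C x k) \<and> v = (\<Sum>k\<in>F. x k)"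
  shows "internal_direct_sum N UNIV (\<lambda>k. {v\<in>N. L v = \<kappa> k *\<^sub>C v})"
proof -
  have inj: "inj_on \<kappa> F" for F using \<kappa> by (rule inj_on_subset) simp
  have unique: "f = g"
    if f: "finite {k. f k \<noteq> 0}" "\<And>k. f k \<in> N \<and> L (f k) = \<kappa> k *\<^sub>C f k" "v = (\<Sum>k | f k \<noteq> 0. f k)"
      and g: "finite {k. g k \<noteq> 0}" "\<And>k. g k \<in> N \<and> L (g k) = \<kappa> k *\<^sub>C g k" "v = (\<Sum>k | g k \<noteq> 0. g k)"
    for f g v
  proof
    fix k
    let ?K = "insert k ({k. f k \<noteq> 0} \<union> {k. g k \<noteq> 0})"
    have K: "finite ?K" using f g by simp
    have "sum f {k. f k \<noteq> 0} = sum f ?K" "sum g {k. g k \<noteq> 0} = sum g ?K"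
      using K by (auto intro!: sum.mono_neutral_left)
    then have "sum f ?K = sum g ?K" using f(3) g(3) by simp
    then have "(\<Sum>k\<in>?K. f k - g k) \<in> {0}" by (simp only: sum_subtractf) simp
    moreover have "f k - g k \<in> V \<and> L (f k - g k) = \<kappa> k *\<^sub>C (f k - g k)" for k
      using f(2)[of k] g(2)[of k] N(2) V
      using clinear_on_diff[OF V, of "f k" "g k"] complex_vector.subspace_diff[OF V(1), of "f k" "g k"]
      by (simp add: subset_iff complex_vector.scale_right_diff_distrib)
    ultimately have "f k - g k \<in> {0}"
      by (intro eigenvector_component_mem[OF V complex_vector.subspace_single_0 _ K inj[of ?K],
            where x = "\<lambda>k. f k - g k"])
        (simp_all add: clinear_on_zero[OF V])
    then show "f k = g k" by simp
  qed
  have exists: "\<exists>f. finite {k. f k \<noteq> 0} \<and> (\<forall>k. f k \<in> N \<and> L (f k) = \<kappa> k *\<^sub>C f k) \<and>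
      v = (\<Sum>k | f k \<noteq> 0. f k)" if v: "v \<in> N" for v
  proof -
    obtain F x where F: "finite F" and x: "\<And>k. k \<in> F \<Longrightarrow> x k \<in> V \<and> L (x k) = \<kappa> k *\<^sub>C x k"
      and s: "v = (\<Sum>k\<in>F. x k)" using decomp[OF v] by blast
    define f where "f k = (if k \<in> F then x k else 0)" for k
    have "f k \<in> N \<and> L (f k) = \<kappa> k *\<^sub>C f k" for k
    proof (cases "k \<in> F")
      case True
      have "x k \<in> N"
        by (rule eigenvector_component_mem[OF V N(1,3) F inj x])
          (use v s True in auto)
      then show ?thesis using x True by (simp add: f_def)
    qed (simp add: f_def clinear_on_zero[OF V] complex_vector.subspace_0[OF N(1)])
    moreover have fin: "{k. f k \<noteq> 0} \<subseteq> F" by (auto simp: f_def)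
    moreover have "v = (\<Sum>k | f k \<noteq> 0. f k)"
      unfolding s using fin F by (intro sum.mono_neutral_cong_right) (auto simp: f_def)
    ultimately show ?thesis using finite_subset[OF fin F] by blast
  qed
  have "csubspace {v\<in>N. L v = \<kappa> k *\<^sub>C v}" for k
    using N(1) clinear_on_subset[OF V(2) N(2)]
    by (auto simp: complex_vector.subspace_def clinear_on_def clinear_on_zero
        scaleC_add_right scaleC_scaleC mult.commute)
  then show ?thesis
    unfolding internal_direct_sum_def
    using N(1) by (auto intro!: ex_ex1I dest: exists intro: unique)
qed

text \<open>Induction on the independent set. A new vector b can be handled once some operator kills
  \<open>B\<close> but not b. If there were none, the value of an operator at b would be determined
  by its values on \<open>B\<close>, and the Schur hypothesis would make b a combination of
  \<open>B\<close>.\<close>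

lemma jacobson_density:
  fixes V :: "'v::complex_vector set" and \<A> :: "('v \<Rightarrow> 'v) set"
  assumes V: "csubspace V"
    and linear: "\<And>T. T \<in> \<A> \<Longrightarrow> clinear_on V T"
    and closed: "\<And>T v. \<lbrakk>T \<in> \<A>; v \<in> V\<rbrakk> \<Longrightarrow> T v \<in> V"
    and id: "(\<lambda>v. v) \<in> \<A>"
    and add: "\<And>T T'. \<lbrakk>T \<in> \<A>; T' \<in> \<A>\<rbrakk> \<Longrightarrow> (\<lambda>v. T v + T' v) \<in> \<A>"
    and scale: "\<And>T c. T \<in> \<A> \<Longrightarrow> (\<lambda>v. c *\<^sub>C T v) \<in> \<A>"
    and comp: "\<And>T T'. \<lbrakk>T \<in> \<A>; T' \<in> \<A>\<rbrakk> \<Longrightarrow> (\<lambda>v. T (T' v)) \<in> \<A>"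
    and irreducible: "\<And>N. \<lbrakk>csubspace N; N \<subseteq> V; \<And>T v. \<lbrakk>T \<in> \<A>; v \<in> N\<rbrakk> \<Longrightarrow> T v \<in> N\<rbrakk>
      \<Longrightarrow> N = {0} \<or> N = V"
    and schur: "\<And>\<phi>. \<lbrakk>clinear_on V \<phi>; \<And>v. v \<in> V \<Longrightarrow> \<phi> v \<in> V;
        \<And>T v. \<lbrakk>T \<in> \<A>; v \<in> V\<rbrakk> \<Longrightarrow> \<phi> (T v) = T (\<phi> v)\<rbrakk> \<Longrightarrow> \<exists>z. \<forall>v\<in>V. \<phi> v = z *\<^sub>C v"
    and B: "finite B" "B \<subseteq> V" "\<not> complex_vector.dependent B"
    and g: "\<And>b. b \<in> B \<Longrightarrow> g b \<in> V"
  shows "\<exists>T\<in>\<A>. \<forall>b\<in>B. T b = g b"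
  using B g
proof (induction B arbitrary: g)
  case empty
  then show ?case using id by blast
next
  case (insert b B)
  have b: "b \<in> V" "b \<notin> cspan B" and B: "B \<subseteq> V" "\<not> complex_vector.dependent B" "finite B"
    using insert.prems insert.hyps by (auto simp: complex_vector.independent_insert)
  note IH = insert.IH[OF B(1,2)]
  have diff: "(\<lambda>v. T v - T' v) \<in> \<A>" if "T \<in> \<A>" "T' \<in> \<A>" for T T'
    using add[OF that(1) scale[OF that(2), of "- 1"]] by (simp add: scaleC_one)
  have sum: "(\<lambda>v. \<Sum>c\<in>C. T c v) \<in> \<A>" if "finite C" "\<And>c. c \<in> C \<Longrightarrow> T c \<in> \<A>" for T and C :: "'v set"
    using that
  proof (induction C)
    case empty
    show ?case using scale[OF id, of 0] by simp
  qed (simp add: add)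
  have separate: "\<exists>T\<in>\<A>. (\<forall>c\<in>B. T c = 0) \<and> T b \<noteq> 0"
  proof (rule ccontr)
    assume "\<not> ?thesis"
    then have vanish: "T b = 0" if "T \<in> \<A>" "\<And>c. c \<in> B \<Longrightarrow> T c = 0" for T using that by blast
    have agree: "T b = T' b" if "T \<in> \<A>" "T' \<in> \<A>" "\<And>c. c \<in> B \<Longrightarrow> T c = T' c" for T T'
      using vanish[OF diff[OF that(1,2)]] that(3) by simp
    have "\<exists>T\<in>\<A>. \<forall>a\<in>B. T a = (if a = c then v else 0)" if "v \<in> V" for c v
      using IH[of "\<lambda>a. if a = c then v else 0"] that complex_vector.subspace_0[OF V] by simp
    then have "\<forall>c v. \<exists>T. v \<in> V \<longrightarrow> T \<in> \<A> \<and> (\<forall>a\<in>B. T a = (if a = c then v else 0))"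
      by blast
    \<comment> \<open>For \<open>c\<close> in \<open>B\<close>, the operator \<open>E c v\<close>
      sends \<open>c\<close> to \<open>v\<close> and kills the rest of \<open>B\<close>. By
      \<open>agree\<close> its value at \<open>b\<close> does not depend on the choice of the
      operator, so it is linear in \<open>v\<close> and commutes with the algebra.\<close>
    then obtain E where "\<forall>c v. v \<in> V \<longrightarrow> E c v \<in> \<A> \<and> (\<forall>a\<in>B. E c v a = (if a = c then v else 0))"
      unfolding choice_iff by blast
    then have E: "\<And>c v. v \<in> V \<Longrightarrow> E c v \<in> \<A>"
      "\<And>c v a. \<lbrakk>v \<in> V; a \<in> B\<rbrakk> \<Longrightarrow> E c v a = (if a = c then v else 0)"
      by blast+
    have "\<exists>z. \<forall>v\<in>V. E c v b = z *\<^sub>C v" for c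
    proof (rule schur)
      show "clinear_on V (\<lambda>v. E c v b)"
        unfolding clinear_on_def
      proof (intro conjI ballI allI)
        fix x y assume xy: "x \<in> V" "y \<in> V"
        then have "x + y \<in> V" by (rule complex_vector.subspace_add[OF V])
        with xy show "E c (x + y) b = E c x b + E c y b"
          by (intro agree[of _ "\<lambda>v. E c x v + E c y v"] add) (auto simp: E)
      next
        fix z x assume x: "x \<in> V"
        then have "z *\<^sub>C x \<in> V" by (rule complex_vector.subspace_scale[OF V])
        with x show "E c (z *\<^sub>C x) b = z *\<^sub>C E c x b"
          by (intro agree[of _ "\<lambda>v. z *\<^sub>C E c x v"] scale) (auto simp: E)
      qed
      show "E c v b \<in> V" if "v \<in> V" for v using E closed b that by blast
      show "E c (T v) b = T (E c v b)" if T: "T \<in> \<A>" and v: "v \<in> V" for T v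
        using E closed[OF T v] v clinear_on_zero[OF V linear[OF T]]
        by (intro agree[of _ "\<lambda>x. T (E c v x)"] comp[OF T]) auto
    qed
    then obtain z where z: "\<And>c v. v \<in> V \<Longrightarrow> E c v b = z c *\<^sub>C v" by metis
    \<comment> \<open>The identity and the sum of the \<open>E c c\<close> agree on
      \<open>B\<close>, hence also at \<open>b\<close>.\<close>
    have "b = (\<Sum>c\<in>B. E c c b)"
    proof (rule agree[OF id sum[OF B(3)]])
      show "E c c \<in> \<A>" if "c \<in> B" for c using E(1) B(1) that by blast
      show "a = (\<Sum>c\<in>B. E c c a)" if a: "a \<in> B" for a
      proof -
        have "(\<Sum>c\<in>B. E c c a) = (\<Sum>c\<in>B. if c = a then c else 0)"
          using E(2) B(1) a by (intro sum.cong) auto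
        then show ?thesis using a B(3) by simp
      qed
    qed
    also have "\<dots> = (\<Sum>c\<in>B. z c *\<^sub>C c)" using z B by (intro sum.cong) auto
    also have "\<dots> \<in> cspan B"
      by (intro complex_vector.span_sum complex_vector.span_scale complex_vector.span_base)
    finally show False using b by simp
  qed
  then obtain T0 where T0: "T0 \<in> \<A>" "\<And>c. c \<in> B \<Longrightarrow> T0 c = 0" "T0 b \<noteq> 0" by blast
  have T0b: "T0 b \<in> V" using closed T0 b by blast
  \<comment> \<open>The vectors reached from \<open>T0 b\<close> form a nonzero stable subspace,
    hence all of \<open>V\<close>. The value at \<open>b\<close> can thus be corrected through
    \<open>T0\<close> without disturbing the values on \<open>B\<close>.\<close>
  let ?N = "{T (T0 b) | T. T \<in> \<A>}"
  have "?N = {0} \<or> ?N = V"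
  proof (rule irreducible)
    show "csubspace ?N"
      unfolding complex_vector.subspace_def
    proof (intro conjI ballI allI)
      have "(\<lambda>v. 0) \<in> \<A>" using scale[OF id, of 0] by simp
      then show "0 \<in> ?N" by force
      show "x + y \<in> ?N" if "x \<in> ?N" "y \<in> ?N" for x y
        using that add by (auto 4 4)
      show "c *\<^sub>C x \<in> ?N" if "x \<in> ?N" for c x
        using that scale by (auto 4 4)
    qed
    show "?N \<subseteq> V" using closed T0b by auto
    show "T v \<in> ?N" if "T \<in> \<A>" "v \<in> ?N" for T v
      using comp that by fastforce
  qed
  moreover have "T0 b \<in> ?N" using id by force
  ultimately have N: "?N = V" using T0 by auto
  obtain T1 where T1: "T1 \<in> \<A>" "\<And>c. c \<in> B \<Longrightarrow> T1 c = g c" using IH[of g] insert.prems by auto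
  have "g b - T1 b \<in> ?N"
    unfolding N using insert.prems T1 closed b by (intro complex_vector.subspace_diff[OF V]) auto
  then obtain T2 where T2: "T2 \<in> \<A>" "g b - T1 b = T2 (T0 b)" by blast
  have "(\<lambda>v. T1 v + T2 (T0 v)) \<in> \<A>" by (rule add[OF T1(1) comp[OF T2(1) T0(1)]])
  moreover have "\<forall>c\<in>insert b B. T1 c + T2 (T0 c) = g c"
  proof
    fix c assume "c \<in> insert b B"
    then consider "c = b" | "c \<in> B" by blast
    then show "T1 c + T2 (T0 c) = g c"
    proof cases
      case 1
      then show ?thesis by (simp flip: T2(2))
    next
      case 2
      then show ?thesis by (simp add: T0(2) T1(2) clinear_on_zero[OF V linear[OF T2(1)]])
    qed
  qed
  ultimately show ?case by (intro bexI[of _ "\<lambda>v. T1 v + T2 (T0 v)"])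
qed

section \<open>Modes of a vertex operator algebra\<close>

text \<open>Each expanded delta function restricts the double sum to a line p + q = l with one
  exponent nonnegative, and truncation or a vanishing binomial coefficient cuts it off at
  \<open>K\<close>. Here the first exponent is the nonnegative one; the companion lemma treats the
  second.\<close>

lemma Sum_any_diagonal_fst:
  fixes g :: "int \<times> int \<Rightarrow> 'v::complex_vector"
  assumes "\<And>p q. \<not> (0 \<le> p \<and> p + q = l) \<Longrightarrow> g (p, q) = 0"
    and "\<And>i. K \<le> i \<Longrightarrow> g (int i, l - int i) = 0"
  shows "Sum_any g = (\<Sum>i<K. g (int i, l - int i))"
proof -
  let ?h = "\<lambda>i. (int i, l - int i)"
  have "{x. g x \<noteq> 0} \<subseteq> ?h ` {..<K}"
  proof
    fix x assume "x \<in> {x. g x \<noteq> 0}"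
    then obtain p q where x: "x = (p, q)" "g (p, q) \<noteq> 0" by (cases x) auto
    then have pq: "0 \<le> p" "p + q = l" using assms(1) by blast+
    then have x': "x = ?h (nat p)" using x by auto
    then have "nat p < K" using assms(2)[of "nat p"] x by (metis not_le)
    with x' show "x \<in> ?h ` {..<K}" by blast
  qed
  then have "Sum_any g = sum g (?h ` {..<K})" by (intro Sum_any.expand_superset) auto
  also have "\<dots> = (\<Sum>i<K. g (?h i))" by (subst sum.reindex) (auto simp: inj_on_def)
  finally show ?thesis .
qed

lemma Sum_any_diagonal_snd:
  fixes g :: "int \<times> int \<Rightarrow> 'v::complex_vector"
  assumes "\<And>p q. \<not> (0 \<le> q \<and> p + q = l) \<Longrightarrow> g (p, q) = 0"
    and "\<And>i. K \<le> i \<Longrightarrow> g (l - int i, int i) = 0"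
  shows "Sum_any g = (\<Sum>i<K. g (l - int i, int i))"
proof -
  let ?h = "\<lambda>i. (l - int i, int i)"
  have "{x. g x \<noteq> 0} \<subseteq> ?h ` {..<K}"
  proof
    fix x assume "x \<in> {x. g x \<noteq> 0}"
    then obtain p q where x: "x = (p, q)" "g (p, q) \<noteq> 0" by (cases x) auto
    then have pq: "0 \<le> q" "p + q = l" using assms(1) by blast+
    then have x': "x = ?h (nat q)" using x by auto
    then have "nat q < K" using assms(2)[of "nat q"] x by (metis not_le)
    with x' show "x \<in> ?h ` {..<K}" by blast
  qed
  then have "Sum_any g = sum g (?h ` {..<K})" by (intro Sum_any.expand_superset) auto
  also have "\<dots> = (\<Sum>i<K. g (?h i))" by (subst sum.reindex) (auto simp: inj_on_def)
  finally show ?thesis .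
qed

text \<open>Lists turn addition into concatenation and allow repetitions; scalar factors are
  absorbed into the vectors \<open>u\<close>.\<close>

definition mode_sum :: "('u \<Rightarrow> int \<Rightarrow> 'm \<Rightarrow> 'm) \<Rightarrow> ('u \<times> int) list \<Rightarrow> 'm \<Rightarrow> 'm::complex_vector" where
  "mode_sum Y xs w = (\<Sum>(u, n)\<leftarrow>xs. Y u n w)"

lemma mode_sum_simps [simp]:
  "mode_sum Y [] w = 0"
  "mode_sum Y ((u, n) # xs) w = Y u n w + mode_sum Y xs w"
  "mode_sum Y (xs @ ys) w = mode_sum Y xs w + mode_sum Y ys w"
  by (simp_all add: mode_sum_def)

text \<open>Agreement is asked on \<open>F\<close> only, because the list that represents a
  composite of modes depends on where the modes begin to vanish on the given vectors.\<close>

definition locally_modes ::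
  "('u \<Rightarrow> int \<Rightarrow> 'm \<Rightarrow> 'm) \<Rightarrow> 'u set \<Rightarrow> 'm set \<Rightarrow> ('m \<Rightarrow> 'm::complex_vector) \<Rightarrow> bool" where
  "locally_modes Y U F T \<longleftrightarrow> (\<exists>xs. fst ` set xs \<subseteq> U \<and> (\<forall>w\<in>F. T w = mode_sum Y xs w))"

lemma locally_modes_cong:
  "(\<And>w. w \<in> F \<Longrightarrow> T w = T' w) \<Longrightarrow> locally_modes Y U F T \<longleftrightarrow> locally_modes Y U F T'"
  by (simp add: locally_modes_def)

lemma locally_modes_mode: "u \<in> U \<Longrightarrow> locally_modes Y U F (Y u n)"
  unfolding locally_modes_def by (intro exI[of _ "[(u, n)]"]) simp

lemma locally_modes_zero: "locally_modes Y U F (\<lambda>w. 0)"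
  unfolding locally_modes_def by (intro exI[of _ "[]"]) simp

lemma locally_modes_add:
  assumes "locally_modes Y U F T" "locally_modes Y U F T'"
  shows "locally_modes Y U F (\<lambda>w. T w + T' w)"
proof -
  obtain xs where "fst ` set xs \<subseteq> U" "\<forall>w\<in>F. T w = mode_sum Y xs w"
    using assms(1) unfolding locally_modes_def by blast
  moreover obtain ys where "fst ` set ys \<subseteq> U" "\<forall>w\<in>F. T' w = mode_sum Y ys w"
    using assms(2) unfolding locally_modes_def by blast
  ultimately show ?thesis
    unfolding locally_modes_def by (intro exI[of _ "xs @ ys"]) (simp add: image_Un)
qed

lemma locally_modes_sum:
  "(\<And>k. k \<in> K \<Longrightarrow> locally_modes Y U F (T k)) \<Longrightarrow> locally_modes Y U F (\<lambda>w. \<Sum>k\<in>K. T k w)"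
  by (induction K rule: infinite_finite_induct) (simp_all add: locally_modes_zero locally_modes_add)

section \<open>Consequences of the Jacobi identity and the algebra generated by the modes\<close>

context vertex_operator_algebra
begin

lemma subspace_V: "csubspace V"
  using grading by (simp add: internal_direct_sum_def)

lemma vac_mem: "vac \<in> V" and omega_mem: "\<omega> \<in> V"
  using vac_weight omega_weight by (simp_all add: weight_space_def)

lemma mode_zero_left: "v \<in> V \<Longrightarrow> Y 0 n v = 0"
  by (rule clinear_on_zero[OF subspace_V vertex_map_linear])

lemma mode_zero_right: "u \<in> V \<Longrightarrow> Y u n 0 = 0"
  by (rule clinear_on_zero[OF subspace_V mode_linear])

text \<open>This is the coefficient of z_0^(-1) z_1^(-m-1) z_2^(-n-1) in the Jacobi identity. The
  exponent -1 of z_0 selects the power (z_1 - z_2)^0, so each product on the left has a single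
  term.\<close>

lemma commutator_formula:
  assumes uvw: "u \<in> V" "v \<in> V" "w \<in> V" and K: "\<And>i. int K \<le> i \<Longrightarrow> Y u i v = 0"
  shows "Y u m (Y v n w) - Y v n (Y u m w) =
    (\<Sum>i<K. (of_int m gchoose i) *\<^sub>C Y (Y u (int i) v) (m + n - int i) w)"
proof -
  let ?a = "- 1 :: int" and ?b = "- m - 1" and ?c = "- n - 1"
  have choose0: "(0 :: complex) gchoose i = 0" if "1 \<le> i" for i
    using that by (cases i) simp_all
  have "Sum_any (\<lambda>(p, q). delta_12_0 ?a p q *\<^sub>C Y u (p - ?b - 1) (Y v (q - ?c - 1) w)) = Y u m (Y v n w)"
    by (subst Sum_any_diagonal_snd[where l = 0 and K = 1])
      (auto simp: delta_12_0_def binomial_coeff_def choose0 scaleC_one)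
  moreover have "Sum_any (\<lambda>(p, q). delta_21_0 ?a p q *\<^sub>C Y v (q - ?c - 1) (Y u (p - ?b - 1) w)) = Y v n (Y u m w)"
    by (subst Sum_any_diagonal_fst[where l = 0 and K = 1])
      (auto simp: delta_21_0_def binomial_coeff_def choose0 scaleC_one)
  moreover have "Sum_any (\<lambda>(p, q). delta_20_1 p ?b q *\<^sub>C Y (Y u (p - ?a - 1) v) (q - ?c - 1) w) =
      (\<Sum>i<K. (of_int m gchoose i) *\<^sub>C Y (Y u (int i) v) (m + n - int i) w)"
    by (subst Sum_any_diagonal_fst[where l = m and K = K])
      (auto simp: delta_20_1_def binomial_coeff_def K mode_zero_left uvw algebra_simps)
  moreover note jacobi[OF uvw, unfolded jacobi_identity_def, rule_format, of ?a ?b ?c]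
  ultimately show ?thesis by simp
qed

text \<open>This is the coefficient of z_0^(-l-1) z_1^(-N-1) z_2^(-n-1) in the Jacobi identity. The
  exponent of z_1 is chosen so that the product with \<open>u\<close> innermost involves only modes
  of \<open>u\<close> of index at least \<open>N\<close>, which kill \<open>w\<close>.\<close>

lemma associativity_formula:
  assumes uvw: "u \<in> V" "v \<in> V" "w \<in> V"
    and N: "\<And>i. int N \<le> i \<Longrightarrow> Y u i w = 0" and K: "\<And>i. n + int K \<le> i \<Longrightarrow> Y v i w = 0"
  shows "(\<Sum>i<K. ((- 1) ^ i * (of_int l gchoose i)) *\<^sub>C Y u (l + int N - int i) (Y v (n + int i) w)) =
    (\<Sum>i\<le>N. (of_nat N gchoose i) *\<^sub>C Y (Y u (l + int i) v) (n + int N - int i) w)"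
proof -
  let ?a = "- l - 1" and ?b = "- int N - 1" and ?c = "- n - 1"
  have chooseN: "(of_nat N :: complex) gchoose i = 0" if "Suc N \<le> i" for i
    using that by (simp flip: binomial_gbinomial)
  have "Sum_any (\<lambda>(p, q). delta_12_0 ?a p q *\<^sub>C Y u (p - ?b - 1) (Y v (q - ?c - 1) w)) =
      (\<Sum>i<K. ((- 1) ^ i * (of_int l gchoose i)) *\<^sub>C Y u (l + int N - int i) (Y v (n + int i) w))"
    by (subst Sum_any_diagonal_snd[where l = l and K = K])
      (auto simp: delta_12_0_def binomial_coeff_def K mode_zero_right uvw algebra_simps)
  moreover have "(\<lambda>(p, q). delta_21_0 ?a p q *\<^sub>C Y v (q - ?c - 1) (Y u (p - ?b - 1) w)) = (\<lambda>_. 0)"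
    by (auto simp: delta_21_0_def binomial_coeff_def N mode_zero_right uvw fun_eq_iff)
  then have "Sum_any (\<lambda>(p, q). delta_21_0 ?a p q *\<^sub>C Y v (q - ?c - 1) (Y u (p - ?b - 1) w)) = 0"
    by simp
  moreover have "Sum_any (\<lambda>(p, q). delta_20_1 p ?b q *\<^sub>C Y (Y u (p - ?a - 1) v) (q - ?c - 1) w) =
      (\<Sum>i<Suc N. (of_nat N gchoose i) *\<^sub>C Y (Y u (l + int i) v) (n + int N - int i) w)"
    by (subst Sum_any_diagonal_fst[where l = "int N" and K = "Suc N"])
      (auto simp: delta_20_1_def binomial_coeff_def chooseN algebra_simps simp del: sum.lessThan_Suc)
  moreover note jacobi[OF uvw, unfolded jacobi_identity_def, rule_format, of ?a ?b ?c]
  ultimately show ?thesis by (simp add: lessThan_Suc_atMost del: sum.lessThan_Suc)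
qed

lemma truncation_nat:
  assumes "u \<in> V" "v \<in> V"
  shows "\<exists>K. \<forall>i\<ge>int K. Y u i v = 0"
proof -
  obtain N where N: "\<forall>n\<ge>N. Y u n v = 0" using truncation[OF assms] by blast
  have "N \<le> i" if "int (nat N) \<le> i" for i using that by linarith
  with N have "\<forall>i\<ge>int (nat N). Y u i v = 0" by blast
  then show ?thesis ..
qed

lemma truncation_finite:
  assumes "u \<in> V" "finite F" "F \<subseteq> V"
  shows "\<exists>K. \<forall>i\<ge>int K. \<forall>v\<in>F. Y u i v = 0"
proof -
  have "\<forall>v\<in>F. \<exists>K. \<forall>i\<ge>int K. Y u i v = 0"
    using truncation_nat[OF assms(1)] assms(3) by blast
  then obtain K where K: "\<forall>v\<in>F. \<forall>i\<ge>int (K v). Y u i v = 0"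
    unfolding bchoice_iff by blast
  have "Y u i v = 0" if "int (Max (K ` F)) \<le> i" "v \<in> F" for i v
  proof -
    have "K v \<le> Max (K ` F)" using assms(2) that by simp
    then have "int (K v) \<le> i" using that by linarith
    then show ?thesis using K that by blast
  qed
  then show ?thesis by blast
qed

text \<open>Up to a nonzero factor, the mode of \<open>v\<close> of index -k-2 at \<open>vac\<close>
  is the mode of L(-1) v of index -k-1 at \<open>vac\<close>. Since L(-1) is a mode of \<omega>, it
  preserves \<open>J\<close>, and the induction passes from \<open>v\<close> to L(-1) v.\<close>

lemma mode_vac_mem:
  assumes J: "csubspace J" "J \<subseteq> V" "\<And>u v n. \<lbrakk>u \<in> V; v \<in> J\<rbrakk> \<Longrightarrow> Y u n v \<in> J"
    and v: "v \<in> J"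
  shows "Y v n vac \<in> J"
proof -
  have "Y v (- int (Suc k)) vac \<in> J" for k
    using v
  proof (induction k arbitrary: v)
    case 0
    then show ?case using creation J by auto
  next
    case (Suc k)
    let ?D = "virasoro Y \<omega> (- 1) v"
    have "?D \<in> J" using J(3)[OF omega_mem Suc.prems] by (simp add: virasoro_def)
    then have "Y ?D (- int (Suc k)) vac \<in> J" by (rule Suc.IH)
    moreover have "Y ?D (- int (Suc k)) vac = of_int (int (Suc k)) *\<^sub>C Y v (- int (Suc (Suc k))) vac"
      using translation[of v vac "- int (Suc k)"] Suc.prems J(2) vac_mem by (auto simp: algebra_simps)
    ultimately have "inverse (of_int (int (Suc k))) *\<^sub>C of_int (int (Suc k)) *\<^sub>C
        Y v (- int (Suc (Suc k))) vac \<in> J"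
      using complex_vector.subspace_scale[OF J(1)] by metis
    then show ?case by (simp add: scaleC_scaleC scaleC_one del: of_nat_Suc)
  qed
  from this[of "nat (- n - 1)"] show ?thesis
    using creation_regular[of v n] v J(2) complex_vector.subspace_0[OF J(1)]
    by (cases "0 \<le> n") auto
qed

text \<open>Left ideals are two-sided: \<open>v\<^sub>n u = v\<^sub>n u\<^sub>-\<^sub>1 \<one>\<close>, and the commutator of \<open>u\<^sub>-\<^sub>1\<close> with \<open>v\<^sub>n\<close>
  only involves modes of the vectors \<open>u\<^sub>i v\<close>.\<close>

lemma voa_idealI:
  assumes J: "csubspace J" "J \<subseteq> V" "\<And>u v n. \<lbrakk>u \<in> V; v \<in> J\<rbrakk> \<Longrightarrow> Y u n v \<in> J"
  shows "voa_ideal V Y J"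
proof -
  have "Y v n u \<in> J" if u: "u \<in> V" and v: "v \<in> J" for u v n
  proof -
    have vV: "v \<in> V" using v J(2) by blast
    obtain K where K: "\<And>i. int K \<le> i \<Longrightarrow> Y u i v = 0" using truncation_nat[OF u vV] by blast
    have "Y u (- 1) (Y v n vac) - Y v n u =
        (\<Sum>i<K. (of_int (- 1) gchoose i) *\<^sub>C Y (Y u (int i) v) (- 1 + n - int i) vac)"
      using commutator_formula[OF u vV vac_mem, of K "- 1" n] K creation[OF u] by simp
    then have "Y v n u = Y u (- 1) (Y v n vac) -
        (\<Sum>i<K. (of_int (- 1) gchoose i) *\<^sub>C Y (Y u (int i) v) (- 1 + n - int i) vac)"
      by (simp add: algebra_simps)
    also have "\<dots> \<in> J"
      using u v J(3)
      by (intro complex_vector.subspace_diff[OF J(1)] complex_vector.subspace_sum[OF J(1)]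
          complex_vector.subspace_scale[OF J(1)] mode_vac_mem[OF J] J(3)[OF u]) auto
    finally show ?thesis .
  qed
  with J show ?thesis by (auto simp: voa_ideal_def)
qed

lemma mode_sum_mem: "\<lbrakk>fst ` set xs \<subseteq> V; w \<in> V\<rbrakk> \<Longrightarrow> mode_sum Y xs w \<in> V"
  by (induction xs)
    (auto simp: complex_vector.subspace_0[OF subspace_V] complex_vector.subspace_add[OF subspace_V]
      mode_closed)

lemma locally_modes_scale:
  assumes "locally_modes Y V F T" "F \<subseteq> V"
  shows "locally_modes Y V F (\<lambda>w. c *\<^sub>C T w)"
proof -
  obtain xs where xs: "fst ` set xs \<subseteq> V" "\<forall>w\<in>F. T w = mode_sum Y xs w"
    using assms(1) unfolding locally_modes_def by blast
  let ?ys = "map (\<lambda>(u, n). (c *\<^sub>C u, n)) xs"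
  have "mode_sum Y ?ys w = c *\<^sub>C mode_sum Y xs w" if "w \<in> V" for w
    using xs(1)
    by (induction xs)
      (auto simp: scaleC_add_right clinear_on_scale[OF vertex_map_linear] that)
  moreover have "fst ` set ?ys \<subseteq> V"
    using xs(1) complex_vector.subspace_scale[OF subspace_V] by force
  ultimately show ?thesis
    unfolding locally_modes_def using xs assms(2) by (intro exI[of _ ?ys]) auto
qed

text \<open>Downward induction on \<open>n\<close>, starting where \<open>v\<^sub>n\<close> vanishes on \<open>F\<close>: the associativity formula
  expresses \<open>u\<^sub>k v\<^sub>n\<close> by single modes and the products \<open>u\<^bsub>k-i\<^esub> v\<^bsub>n+i\<^esub>\<close> with \<open>i > 0\<close>.\<close>

lemma locally_modes_mode_mode:
  assumes uv: "u \<in> V" "v \<in> V" and F: "finite F" "F \<subseteq> V"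
  shows "locally_modes Y V F (\<lambda>w. Y u k (Y v n w))"
proof -
  obtain N where N: "\<And>i w. \<lbrakk>int N \<le> i; w \<in> F\<rbrakk> \<Longrightarrow> Y u i w = 0"
    using truncation_finite[OF uv(1) F] by blast
  obtain K where K: "\<And>i w. \<lbrakk>int K \<le> i; w \<in> F\<rbrakk> \<Longrightarrow> Y v i w = 0"
    using truncation_finite[OF uv(2) F] by blast
  have "\<forall>k. locally_modes Y V F (\<lambda>w. Y u k (Y v n w))" if "nat (int K - n) = d" for n d
    using that
  proof (induction d arbitrary: n rule: less_induct)
    case (less d)
    show ?case
    proof (cases "int K \<le> n")
      case True
      then have "locally_modes Y V F (\<lambda>w. Y u k (Y v n w)) \<longleftrightarrow> locally_modes Y V F (\<lambda>w. 0)" for k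
        by (intro locally_modes_cong) (simp add: K mode_zero_right uv)
      then show ?thesis by (simp add: locally_modes_zero)
    next
      case False
      define m where "m = nat (int K - n) - 1"
      \<comment> \<open>The modes of \<open>v\<close> vanish on \<open>F\<close> from index
        \<open>K\<close> on, so the left side of the associativity formula has \<open>Suc m\<close>
        terms.\<close>
      have m: "int K = n + int (Suc m)" using False by (simp add: m_def)
      show ?thesis
      proof
        fix k
        \<comment> \<open>With this \<open>l\<close> the term i = 0 of the associativity formula is
          the wanted product; the other products have a larger index at \<open>v\<close> and fall
          under the induction hypothesis.\<close>
        let ?l = "k - int N"
        let ?c = "\<lambda>i. (- 1) ^ i * (of_int ?l gchoose i) :: complex"
        let ?R = "\<lambda>w. (\<Sum>i\<le>N. (of_nat N gchoose i) *\<^sub>C Y (Y u (?l + int i) v) (n + int N - int i) w)"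
        let ?L = "\<lambda>w. (\<Sum>i<m. (- ?c (Suc i)) *\<^sub>C Y u (k - int (Suc i)) (Y v (n + int (Suc i)) w))"
        have "Y u k (Y v n w) = ?R w + ?L w" if w: "w \<in> F" for w
        proof -
          have "(\<Sum>i<Suc m. ?c i *\<^sub>C Y u (?l + int N - int i) (Y v (n + int i) w)) = ?R w"
            using F(2) w K m by (intro associativity_formula uv N) auto
          then have "Y u k (Y v n w) +
              (\<Sum>i<m. ?c (Suc i) *\<^sub>C Y u (k - int (Suc i)) (Y v (n + int (Suc i)) w)) = ?R w"
            by (subst (asm) sum.lessThan_Suc_shift) (simp add: scaleC_one)
          then show ?thesis
            by (simp only: complex_vector.scale_minus_left sum_negf) (simp add: algebra_simps)
        qed
        moreover have "locally_modes Y V F ?R"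
          by (intro locally_modes_sum locally_modes_scale locally_modes_mode mode_closed uv F)
        moreover have "locally_modes Y V F ?L"
        proof (intro locally_modes_sum locally_modes_scale F)
          fix i
          have "nat (int K - (n + int (Suc i))) < d" using less.prems False by auto
          from less.IH[OF this refl]
          show "locally_modes Y V F (\<lambda>w. Y u (k - int (Suc i)) (Y v (n + int (Suc i)) w))" by blast
        qed
        ultimately show "locally_modes Y V F (\<lambda>w. Y u k (Y v n w))"
          using locally_modes_add[of Y V F ?R ?L]
            locally_modes_cong[of F "\<lambda>w. Y u k (Y v n w)" "\<lambda>w. ?R w + ?L w" Y V] by blast
      qed
    qed
  qed
  then show ?thesis by blast
qed

lemma weight_decomposition:
  assumes "v \<in> V"
  obtains F x where "finite F" "\<And>n. n \<in> F \<Longrightarrow> x n \<in> weight_space V Y \<omega> (of_int n)"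
    "v = (\<Sum>n\<in>F. x n)"
proof -
  from grading assms have "\<exists>!f. finite {k. f k \<noteq> 0} \<and> (\<forall>k\<in>UNIV. f k \<in> weight_space V Y \<omega> (of_int k)) \<and>
      (\<forall>k. k \<notin> UNIV \<longrightarrow> f k = 0) \<and> v = (\<Sum>k | f k \<noteq> 0. f k)"
    unfolding internal_direct_sum_def by (elim conjE) (rule bspec)
  then obtain f where "finite {k. f k \<noteq> 0} \<and> (\<forall>k\<in>UNIV. f k \<in> weight_space V Y \<omega> (of_int k)) \<and>
      (\<forall>k. k \<notin> UNIV \<longrightarrow> f k = 0) \<and> v = (\<Sum>k | f k \<noteq> 0. f k)"
    by (blast dest: ex1_implies_ex)
  then show thesis by (intro that[of "{k. f k \<noteq> 0}" f]) simp_all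
qed

text \<open>The closure of the sums of modes, in the finite topology, within the endomorphisms of
  \<open>V\<close>.\<close>

definition mode_operators :: "('v \<Rightarrow> 'v) set" where
  "mode_operators = {T. clinear_on V T \<and> T ` V \<subseteq> V \<and>
     (\<forall>F. finite F \<longrightarrow> F \<subseteq> V \<longrightarrow> locally_modes Y V F T)}"

lemma mode_operators_locally_modes:
  "\<lbrakk>T \<in> mode_operators; finite F; F \<subseteq> V\<rbrakk> \<Longrightarrow> locally_modes Y V F T"
  by (simp add: mode_operators_def)

lemma locally_modesE:
  assumes "locally_modes Y V F T"
  obtains xs where "fst ` set xs \<subseteq> V" "\<And>w. w \<in> F \<Longrightarrow> T w = mode_sum Y xs w"
  using assms by (auto simp: locally_modes_def)

lemma mode_operators_mode: "u \<in> V \<Longrightarrow> Y u n \<in> mode_operators"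
  by (auto simp: mode_operators_def mode_linear mode_closed locally_modes_mode)

lemma mode_operators_add:
  assumes "T \<in> mode_operators" "T' \<in> mode_operators"
  shows "(\<lambda>v. T v + T' v) \<in> mode_operators"
  using assms
  by (auto simp: mode_operators_def clinear_on_def scaleC_add_right locally_modes_add
      intro!: complex_vector.subspace_add[OF subspace_V])

lemma mode_operators_scale:
  assumes "T \<in> mode_operators"
  shows "(\<lambda>v. c *\<^sub>C T v) \<in> mode_operators"
  using assms
  by (auto simp: mode_operators_def clinear_on_def scaleC_add_right scaleC_scaleC mult.commute
      locally_modes_scale intro!: complex_vector.subspace_scale[OF subspace_V])

lemma locally_modes_mode_mode_sum:
  assumes "u \<in> V" "fst ` set ys \<subseteq> V" "finite F" "F \<subseteq> V"
  shows "locally_modes Y V F (\<lambda>w. Y u k (mode_sum Y ys w))"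
  using assms(2)
proof (induction ys)
  case Nil
  then show ?case by (simp add: mode_zero_right assms(1) locally_modes_zero)
next
  case (Cons y ys)
  obtain v n where y: "y = (v, n)" by (cases y)
  have v: "v \<in> V" "fst ` set ys \<subseteq> V" using Cons.prems y by auto
  have "Y u k (mode_sum Y (y # ys) w) = Y u k (Y v n w) + Y u k (mode_sum Y ys w)" if "w \<in> F" for w
    unfolding y mode_sum_simps using that assms(4) v
    by (intro clinear_on_add[OF mode_linear[OF assms(1)]] mode_closed mode_sum_mem) auto
  moreover have "locally_modes Y V F (\<lambda>w. Y u k (Y v n w) + Y u k (mode_sum Y ys w))"
    using v Cons.IH by (intro locally_modes_add locally_modes_mode_mode assms)
  ultimately show ?case by (subst locally_modes_cong)
qed

lemma locally_modes_mode_sum_mode_sum: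
  assumes "fst ` set xs \<subseteq> V" "fst ` set ys \<subseteq> V" "finite F" "F \<subseteq> V"
  shows "locally_modes Y V F (\<lambda>w. mode_sum Y xs (mode_sum Y ys w))"
  using assms(1)
proof (induction xs)
  case (Cons x xs)
  then show ?case
    by (cases x) (auto intro!: locally_modes_add locally_modes_mode_mode_sum assms)
qed (simp add: locally_modes_zero)

lemma mode_operators_comp:
  assumes "T \<in> mode_operators" "T' \<in> mode_operators"
  shows "(\<lambda>v. T (T' v)) \<in> mode_operators"
proof -
  have "locally_modes Y V F (\<lambda>v. T (T' v))" if F: "finite F" "F \<subseteq> V" for F
  proof -
    obtain ys where ys: "fst ` set ys \<subseteq> V" "\<And>w. w \<in> F \<Longrightarrow> T' w = mode_sum Y ys w"
      using locally_modesE[OF mode_operators_locally_modes[OF assms(2) F]] by blast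
    \<comment> \<open>The sum of modes for \<open>T\<close> is chosen on the image of
      \<open>F\<close> under \<open>T'\<close>, which is again a finite subset of
      \<open>V\<close>.\<close>
    have "T' ` F \<subseteq> V" using F assms(2) by (auto simp: mode_operators_def)
    then obtain xs where xs: "fst ` set xs \<subseteq> V" "\<And>w. w \<in> T' ` F \<Longrightarrow> T w = mode_sum Y xs w"
      using locally_modesE[OF mode_operators_locally_modes[OF assms(1) finite_imageI[OF F(1)]]]
      by blast
    have "locally_modes Y V F (\<lambda>v. T (T' v)) \<longleftrightarrow>
        locally_modes Y V F (\<lambda>w. mode_sum Y xs (mode_sum Y ys w))"
      by (rule locally_modes_cong) (simp add: xs ys flip: ys(2))
    then show ?thesis using locally_modes_mode_sum_mode_sum[OF xs(1) ys(1) F] by simp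
  qed
  then show ?thesis
    using assms clinear_on_compose[of V T' V T]
    by (simp add: mode_operators_def image_subset_iff)
qed

lemma mode_operators_id: "(\<lambda>v. v) \<in> mode_operators"
proof -
  have "locally_modes Y V F (\<lambda>v. v)" if "F \<subseteq> V" for F
    using locally_modes_mode[OF vac_mem, of Y F "- 1"] vacuum that
    by (subst locally_modes_cong[of F _ "Y vac (- 1)"]) auto
  then show ?thesis by (auto simp: mode_operators_def clinear_on_def)
qed

lemma nonzero_weight_space:
  assumes "V \<noteq> {0}"
  obtains n :: int where "weight_space V Y \<omega> (of_int n) \<noteq> {0}"
proof (rule ccontr)
  assume "\<not> thesis"
  then have zero: "weight_space V Y \<omega> (of_int n) = {0}" for n using that by blast
  have "v = 0" if "v \<in> V" for v
  proof -
    obtain F x where "\<And>n. n \<in> F \<Longrightarrow> x n \<in> weight_space V Y \<omega> (of_int n)" "v = (\<Sum>n\<in>F. x n)"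
      using weight_decomposition[OF \<open>v \<in> V\<close>] by blast
    then show ?thesis by (simp add: zero)
  qed
  then show False using assms complex_vector.subspace_0[OF subspace_V] by auto
qed

lemma subspace_weight_space: "csubspace (weight_space V Y \<omega> \<mu>)"
  using subspace_V mode_linear[OF omega_mem, of 1]
  by (auto simp: weight_space_def virasoro_def complex_vector.subspace_def clinear_on_def
      mode_zero_right omega_mem scaleC_add_right scaleC_scaleC mult.commute)

end

text \<open>Schur's lemma holds here because an endomorphism preserves the finite-dimensional weight
  spaces and hence has an eigenvector.\<close>

lemma simple_voa_density:
  assumes simple: "simple_voa V Y vac \<omega>"
    and W: "csubspace W" "finite_dimensional W" "W \<subseteq> V"
    and f: "clinear_on W f" "f ` W \<subseteq> V"
  obtains xs where "fst ` set xs \<subseteq> V" "\<And>w. w \<in> W \<Longrightarrow> f w = mode_sum Y xs w"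
proof -
  interpret vertex_operator_algebra V Y vac \<omega>
    using simple by (simp add: simple_voa_def)
  have V: "V \<noteq> {0}" "\<And>J. voa_ideal V Y J \<Longrightarrow> J = {0} \<or> J = V"
    using simple by (auto simp: simple_voa_def)
  obtain B where B: "finite B" "B \<subseteq> W" "\<not> complex_vector.dependent B" "W \<subseteq> cspan B"
    using finite_basis_exists[OF W(2)] .
  \<comment> \<open>A subspace stable under the operators is a left ideal, hence an ideal by
    \<open>voa_idealI\<close>.\<close>
  have irreducible: "N = {0} \<or> N = V"
    if N: "csubspace N" "N \<subseteq> V" "\<And>T v. \<lbrakk>T \<in> mode_operators; v \<in> N\<rbrakk> \<Longrightarrow> T v \<in> N" for N
    using N mode_operators_mode by (intro V(2) voa_idealI) blast+
  have schur: "\<exists>z. \<forall>v\<in>V. \<phi> v = z *\<^sub>C v"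
    if \<phi>: "clinear_on V \<phi>" "\<And>v. v \<in> V \<Longrightarrow> \<phi> v \<in> V"
      "\<And>T v. \<lbrakk>T \<in> mode_operators; v \<in> V\<rbrakk> \<Longrightarrow> \<phi> (T v) = T (\<phi> v)" for \<phi>
  proof -
    obtain n where n: "weight_space V Y \<omega> (of_int n) \<noteq> {0}" using nonzero_weight_space[OF V(1)] .
    let ?E = "weight_space V Y \<omega> (of_int n)"
    have "\<phi> y \<in> ?E" if "y \<in> ?E" for y
      using that \<phi>(2) \<phi>(3)[OF mode_operators_mode[OF omega_mem, of 1], of y] clinear_on_scale[OF \<phi>(1)]
      by (auto simp: weight_space_def virasoro_def)
    moreover have "clinear_on ?E \<phi>"
      by (rule clinear_on_subset[OF \<phi>(1)]) (auto simp: weight_space_def)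
    ultimately obtain z y where y: "y \<in> ?E" "y \<noteq> 0" "\<phi> y = z *\<^sub>C y"
      using eigenvector_exists[OF subspace_weight_space weight_finite_dim n, of \<phi>] by blast
    \<comment> \<open>The full eigenspace of \<phi> in \<open>V\<close> is stable under the
      operators; as it contains \<open>y\<close>, it is all of \<open>V\<close>.\<close>
    let ?N = "{v\<in>V. \<phi> v = z *\<^sub>C v}"
    have "?N = {0} \<or> ?N = V"
    proof (rule irreducible)
      show "csubspace ?N"
        using subspace_V \<phi>(1) clinear_on_zero[OF subspace_V \<phi>(1)]
        by (auto simp: complex_vector.subspace_def clinear_on_def scaleC_add_right scaleC_scaleC
            mult.commute)
      show "T v \<in> ?N" if "T \<in> mode_operators" "v \<in> ?N" for T v
        using that \<phi>(3)[of T v] by (auto simp: mode_operators_def clinear_on_def)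
    qed auto
    moreover have "y \<in> ?N" using y by (auto simp: weight_space_def)
    ultimately have "?N = V" using y by blast
    then show ?thesis by blast
  qed
  have "\<exists>T\<in>mode_operators. \<forall>b\<in>B. T b = f b"
  proof (rule jacobson_density[OF subspace_V])
    show "B \<subseteq> V" using B W by blast
    show "f b \<in> V" if "b \<in> B" for b using f B that by blast
  qed (use B irreducible schur in \<open>auto simp: mode_operators_add mode_operators_scale
        mode_operators_comp mode_operators_id, auto simp: mode_operators_def\<close>)
  then obtain T where T: "T \<in> mode_operators" "\<And>b. b \<in> B \<Longrightarrow> T b = f b" by blast
  then obtain xs where xs: "fst ` set xs \<subseteq> V" "\<And>b. b \<in> B \<Longrightarrow> T b = mode_sum Y xs b"
    using locally_modesE[OF mode_operators_locally_modes[OF T(1) B(1)]] B(2) W(3)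
    by (metis order_trans)
  \<comment> \<open>Density was applied to the basis \<open>B\<close> only; linearity of both sides
    carries the equality to \<open>W\<close>.\<close>
  have "clinear_on V (mode_sum Y xs)"
    using xs(1)
  proof (induction xs)
    case (Cons x xs)
    then show ?case
      using mode_linear by (cases x) (auto simp: clinear_on_def scaleC_add_right)
  qed (simp add: clinear_on_def)
  then have "clinear_on W (mode_sum Y xs)" using W(3) by (rule clinear_on_subset)
  then have "f w = mode_sum Y xs w" if "w \<in> W" for w
    by (rule clinear_on_eq_on_span[OF W(1) f(1) _ B(2,4) _ that]) (simp flip: T(2) add: xs(2))
  with xs(1) that show thesis by blast
qed

section \<open>Hopf algebra actions\<close>

text \<open>A tensor is the class of a finitely supported function on pairs, and such a function is
  built up one pair at a time. As Sweedler sums are linear in the tensor, identities between them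
  need checking on pure tensors only.\<close>

lemma tensor_induct [case_names pure add scale]:
  fixes t :: "('a::complex_vector, 'b::complex_vector) tensor"
  assumes pure: "\<And>a b. P (pure_tensor a b)"
    and add: "\<And>s t. \<lbrakk>P s; P t\<rbrakk> \<Longrightarrow> P (s + t)"
    and scale: "\<And>c t. P t \<Longrightarrow> P (c *\<^sub>C t)"
  shows "P t"
proof -
  obtain s where t: "t = abs_tensor s"
    using tensor.abs_induct[of "\<lambda>t. \<exists>s. t = abs_tensor s" t] by blast
  have single: "P (abs_tensor (Poly_Mapping.single p c))" for p :: "'a \<times> 'b" and c
  proof -
    obtain a b where p: "p = (a, b)" by (cases p)
    have "Poly_Mapping.single p c = c *\<^sub>C Poly_Mapping.single p 1"
      by (rule poly_mapping_eqI) (simp add: lookup_scaleC lookup_single scaleC_complex_def when_def)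
    then have "abs_tensor (Poly_Mapping.single p c) = c *\<^sub>C pure_tensor a b"
      by (simp add: p pure_tensor.abs_eq scaleC_tensor.abs_eq)
    then show ?thesis using pure scale by simp
  qed
  have "P (abs_tensor s)"
  proof (induction s rule: update_induct)
    case const
    show ?case using single[of undefined 0] by simp
  next
    case (update s p c)
    have "Poly_Mapping.update p c s = s + Poly_Mapping.single p c"
      using update.hyps(1)
      by (intro poly_mapping_eqI) (auto simp: lookup_update lookup_add lookup_single in_keys_iff when_def)
    then show ?case using add[OF update.IH single] by (simp add: plus_tensor.abs_eq)
  qed
  then show ?thesis using t by simp
qed

section \<open>Calculus of Sweedler sums\<close>

lemma tensor_lift_add: "tensor_lift \<beta> (s + t) = tensor_lift \<beta> s + tensor_lift \<beta> t"
  and tensor_lift_scale: "tensor_lift \<beta> (c *\<^sub>C s) = c *\<^sub>C tensor_lift \<beta> s"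
  using clinear_tensor_lift[of \<beta>] by (simp_all add: clinear_on_def)

lemma cbilinearI:
  assumes "\<And>a x y. \<beta> a (x + y) = \<beta> a x + \<beta> a y" "\<And>a c x. \<beta> a (c *\<^sub>C x) = c *\<^sub>C \<beta> a x"
    and "\<And>b x y. \<beta> (x + y) b = \<beta> x b + \<beta> y b" "\<And>b c x. \<beta> (c *\<^sub>C x) b = c *\<^sub>C \<beta> x b"
  shows "cbilinear \<beta>"
  using assms by (simp add: cbilinear_def clinear_on_def)

lemma cbilinear_add_right: "cbilinear \<beta> \<Longrightarrow> \<beta> a (b + b') = \<beta> a b + \<beta> a b'"
  and cbilinear_scale_right: "cbilinear \<beta> \<Longrightarrow> \<beta> a (c *\<^sub>C b) = c *\<^sub>C \<beta> a b"
  and cbilinear_add_left: "cbilinear \<beta> \<Longrightarrow> \<beta> (a + a') b = \<beta> a b + \<beta> a' b"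
  and cbilinear_scale_left: "cbilinear \<beta> \<Longrightarrow> \<beta> (c *\<^sub>C a) b = c *\<^sub>C \<beta> a b"
  by (simp_all add: cbilinear_def clinear_on_def)

lemmas cbilinear_simps =
  cbilinear_add_right cbilinear_scale_right cbilinear_add_left cbilinear_scale_left

text \<open>With \<open>F\<close> of the form h \<mapsto> h w, this is how the counit and antipode
  axioms, stated in H, are transported to vectors. The induction also carries membership in
  \<open>A\<close>, where alone \<open>F\<close> is linear.\<close>

lemma clinear_on_tensor_lift:
  assumes A: "csubspace A" "clinear_on A F" and \<beta>: "cbilinear \<beta>" "\<And>a b. \<beta> a b \<in> A"
  shows "F (tensor_lift \<beta> t) = tensor_lift (\<lambda>a b. F (\<beta> a b)) t"
proof -
  have F\<beta>: "cbilinear (\<lambda>a b. F (\<beta> a b))"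
    by (rule cbilinearI)
      (simp_all add: cbilinear_simps[OF \<beta>(1)] clinear_on_add[OF A(2)] clinear_on_scale[OF A(2)] \<beta>(2))
  have "tensor_lift \<beta> t \<in> A \<and> F (tensor_lift \<beta> t) = tensor_lift (\<lambda>a b. F (\<beta> a b)) t"
  proof (induction t rule: tensor_induct)
    case (pure a b)
    then show ?case by (simp add: tensor_lift_pure \<beta> F\<beta>)
  next
    case (add s t)
    then show ?case
      by (simp add: tensor_lift_add clinear_on_add[OF A(2)] complex_vector.subspace_add[OF A(1)])
  next
    case (scale c t)
    then show ?case
      by (simp add: tensor_lift_scale clinear_on_scale[OF A(2)] complex_vector.subspace_scale[OF A(1)])
  qed
  then show ?thesis ..
qed

text \<open>Bilinearity of both summands enters because \<open>tensor_lift\<close> takes the default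
  value 0 on maps that are not bilinear.\<close>

lemma tensor_lift_plus:
  assumes "cbilinear \<beta>" "cbilinear \<gamma>"
  shows "tensor_lift (\<lambda>a b. \<beta> a b + \<gamma> a b) t = tensor_lift \<beta> t + tensor_lift \<gamma> t"
proof -
  have "cbilinear (\<lambda>a b. \<beta> a b + \<gamma> a b)"
    by (rule cbilinearI) (simp_all add: cbilinear_simps[OF assms(1)] cbilinear_simps[OF assms(2)]
        scaleC_add_right)
  note pure = tensor_lift_pure[OF this] tensor_lift_pure[OF assms(1)] tensor_lift_pure[OF assms(2)]
  show ?thesis
    by (induction t rule: tensor_induct)
      (simp_all add: pure tensor_lift_add tensor_lift_scale scaleC_add_right)
qed

lemma tensor_lift_smult:
  assumes "cbilinear \<beta>"
  shows "tensor_lift (\<lambda>a b. c *\<^sub>C \<beta> a b) t = c *\<^sub>C tensor_lift \<beta> t"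
  by (rule clinear_on_tensor_lift[OF complex_vector.subspace_UNIV _ assms, symmetric])
    (simp_all add: clinear_on_def scaleC_add_right scaleC_scaleC mult.commute)

lemma tensor_lift_zero: "tensor_lift (\<lambda>a b. 0) t = 0"
proof -
  have zero: "cbilinear (\<lambda>a b. 0)" by (rule cbilinearI) simp_all
  show ?thesis
    by (induction t rule: tensor_induct)
      (simp_all add: tensor_lift_pure[OF zero] tensor_lift_add tensor_lift_scale)
qed

text \<open>The two hypotheses together say that \<tau> is trilinear.\<close>

lemma cbilinear_tensor_lift_right:
  assumes \<tau>: "\<And>a. cbilinear (\<tau> a)" "\<And>c. cbilinear (\<lambda>a b. \<tau> a b c)"
  shows "cbilinear (\<lambda>a s. tensor_lift (\<tau> a) s)"
proof -
  have "\<tau> (a + a') = (\<lambda>b c. \<tau> a b c + \<tau> a' b c)" "\<tau> (z *\<^sub>C a) = (\<lambda>b c. z *\<^sub>C \<tau> a b c)" for a a' z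
    using cbilinear_add_left[OF \<tau>(2)] cbilinear_scale_left[OF \<tau>(2)] by blast+
  then show ?thesis
    by (intro cbilinearI)
      (simp_all add: tensor_lift_add tensor_lift_scale tensor_lift_plus tensor_lift_smult \<tau>(1))
qed

lemma cbilinear_tensor_lift_left:
  assumes \<tau>: "\<And>a. cbilinear (\<tau> a)" "\<And>c. cbilinear (\<lambda>a b. \<tau> a b c)"
  shows "cbilinear (\<lambda>s c. tensor_lift (\<lambda>a b. \<tau> a b c) s)"
  by (rule cbilinearI)
    (simp_all add: tensor_lift_add tensor_lift_scale cbilinear_add_right[OF \<tau>(1)]
      cbilinear_scale_right[OF \<tau>(1)] tensor_lift_plus tensor_lift_smult \<tau>(2))

lemma tensor_lift_assoc:
  fixes \<tau> :: "'a::complex_vector \<Rightarrow> 'b::complex_vector \<Rightarrow> 'c::complex_vector \<Rightarrow> 'd::complex_vector"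
  assumes \<tau>: "\<And>a. cbilinear (\<tau> a)" "\<And>c. cbilinear (\<lambda>a b. \<tau> a b c)"
  shows "tensor_lift (\<lambda>a s. tensor_lift (\<tau> a) s) (tensor_assoc T) =
    tensor_lift (\<lambda>s c. tensor_lift (\<lambda>a b. \<tau> a b c) s) T"
proof -
  note 1 = cbilinear_tensor_lift_right[OF \<tau>]
  note 2 = cbilinear_tensor_lift_left[OF \<tau>]
  have p: "pure_tensor (a + a') b = pure_tensor a b + pure_tensor a' b"
      "pure_tensor a (b + b') = pure_tensor a b + pure_tensor a b'"
      "pure_tensor (z *\<^sub>C a) b = z *\<^sub>C pure_tensor a b" "pure_tensor a (z *\<^sub>C b) = z *\<^sub>C pure_tensor a b"
    for a a' :: "'x::complex_vector" and b b' :: "'y::complex_vector" and z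
    by (simp_all add: cbilinear_simps[OF cbilinear_pure_tensor])
  have 3: "cbilinear (\<lambda>(a :: 'a) (b :: 'b). pure_tensor a (pure_tensor b c))" for c :: 'c
    by (rule cbilinearI) (simp_all add: p)
  have 4: "cbilinear (\<lambda>s (c :: 'c). tensor_lift (\<lambda>(a :: 'a) (b :: 'b). pure_tensor a (pure_tensor b c)) s)"
    by (rule cbilinear_tensor_lift_left[where \<tau> = "\<lambda>a b c. pure_tensor a (pure_tensor b c)", OF _ 3],
        rule cbilinearI) (simp_all add: p)
  show ?thesis
  proof (induction T rule: tensor_induct)
    case (pure s c)
    show ?case
      unfolding tensor_assoc_def tensor_lift_pure[OF 4] tensor_lift_pure[OF 2]
    proof (induction s rule: tensor_induct)
      case (pure a b)
      show ?case by (simp add: tensor_lift_pure[OF 1] tensor_lift_pure[OF 3] tensor_lift_pure \<tau>)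
    qed (simp_all add: tensor_lift_add tensor_lift_scale)
  qed (simp_all add: tensor_assoc_def tensor_lift_add tensor_lift_scale)
qed

context hopf_algebra
begin

text \<open>The two bracketings of sum \<tau>(h_1, h_2, h_3) coincide: the linear map that \<tau>
  induces on threefold tensors is applied to both sides of the coassociativity axiom.\<close>

lemma sweedler_coassoc:
  assumes \<tau>: "\<And>a. cbilinear (\<tau> a)" "\<And>c. cbilinear (\<lambda>a b. \<tau> a b c)"
  shows "tensor_lift (\<lambda>a b. tensor_lift (\<lambda>p q. \<tau> p q b) (\<Delta> a)) (\<Delta> h) =
    tensor_lift (\<lambda>a b. tensor_lift (\<tau> a) (\<Delta> b)) (\<Delta> h)"
proof -
  note \<Delta> = clinear_on_add[OF comult_linear UNIV_I UNIV_I] clinear_on_scale[OF comult_linear UNIV_I]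
  let ?L = "tensor_lift (\<lambda>s c. tensor_lift (\<lambda>a b. \<tau> a b c) s)"
  let ?R = "tensor_lift (\<lambda>a s. tensor_lift (\<tau> a) s)"
  note 1 = cbilinear_tensor_lift_right[OF \<tau>]
  note 2 = cbilinear_tensor_lift_left[OF \<tau>]
  have "cbilinear (\<lambda>a b. pure_tensor (\<Delta> a) b)"
    by (rule cbilinearI) (simp_all add: \<Delta> cbilinear_simps[OF cbilinear_pure_tensor])
  then have "?L (tensor_lift (\<lambda>a b. pure_tensor (\<Delta> a) b) (\<Delta> h)) =
      tensor_lift (\<lambda>a b. ?L (pure_tensor (\<Delta> a) b)) (\<Delta> h)"
    by (rule clinear_on_tensor_lift[OF complex_vector.subspace_UNIV clinear_tensor_lift _ UNIV_I])
  moreover have "cbilinear (\<lambda>a b. pure_tensor a (\<Delta> b))"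
    by (rule cbilinearI) (simp_all add: \<Delta> cbilinear_simps[OF cbilinear_pure_tensor])
  then have "?R (tensor_lift (\<lambda>a b. pure_tensor a (\<Delta> b)) (\<Delta> h)) =
      tensor_lift (\<lambda>a b. ?R (pure_tensor a (\<Delta> b))) (\<Delta> h)"
    by (rule clinear_on_tensor_lift[OF complex_vector.subspace_UNIV clinear_tensor_lift _ UNIV_I])
  ultimately show ?thesis
    using tensor_lift_assoc[OF \<tau>, of "tensor_lift (\<lambda>a b. pure_tensor (\<Delta> a) b) (\<Delta> h)"]
    by (simp add: coassoc tensor_lift_pure[OF 1] tensor_lift_pure[OF 2])
qed

end

section \<open>The Hopf action on modes, and invariant vectors\<close>

locale hopf_module_voa_action =
  hopf_algebra \<Delta> \<epsilon> S + vertex_operator_algebra V Y vac \<omega>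
  for \<Delta> :: "'h::complex_algebra_1 \<Rightarrow> ('h, 'h) tensor"
    and \<epsilon> :: "'h \<Rightarrow> complex"
    and S :: "'h \<Rightarrow> 'h"
    and V :: "'v::complex_vector set"
    and Y :: "'v \<Rightarrow> int \<Rightarrow> 'v \<Rightarrow> 'v"
    and vac \<omega> :: 'v +
  fixes act :: "'h \<Rightarrow> 'v \<Rightarrow> 'v"
  assumes module_voa: "hopf_module_voa \<Delta> \<epsilon> act V Y \<omega>"
begin

abbreviation VH :: "'v set" where
  "VH \<equiv> invariants \<epsilon> act V"

lemma act_module: "alg_module act V"
  using module_voa by (simp add: hopf_module_voa_def)

lemma act_mem: "v \<in> V \<Longrightarrow> act h v \<in> V"
  and act_linear: "clinear_on V (act h)"
  and act_linear_left: "v \<in> V \<Longrightarrow> clinear_on UNIV (\<lambda>h. act h v)"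
  and act_one: "v \<in> V \<Longrightarrow> act 1 v = v"
  and act_mult: "v \<in> V \<Longrightarrow> act (g * h) v = act g (act h v)"
  using act_module by (simp_all add: alg_module_def)

lemma act_add_left: "v \<in> V \<Longrightarrow> act (g + h) v = act g v + act h v"
  and act_scale_left: "v \<in> V \<Longrightarrow> act (c *\<^sub>C h) v = c *\<^sub>C act h v"
  using act_linear_left by (simp_all add: clinear_on_def)

lemma act_diff_left: "v \<in> V \<Longrightarrow> act (g - h) v = act g v - act h v"
  using clinear_on_diff[OF complex_vector.subspace_UNIV act_linear_left] by blast

lemma act_zero: "act h 0 = 0"
  by (rule clinear_on_zero[OF subspace_V act_linear])

lemmas act_add = clinear_on_add[OF act_linear]
lemmas act_scale = clinear_on_scale[OF act_linear]

lemma counit_add: "\<epsilon> (g + h) = \<epsilon> g + \<epsilon> h"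
  and counit_scale: "\<epsilon> (c *\<^sub>C h) = c * \<epsilon> h"
  using counit_linear by (simp_all add: clinear_on_def scaleC_complex_def)

lemma counit_diff: "\<epsilon> (g - h) = \<epsilon> g - \<epsilon> h"
  using clinear_on_diff[OF complex_vector.subspace_UNIV counit_linear] by blast

lemma antipode_add: "S (g + h) = S g + S h"
  and antipode_scale: "S (c *\<^sub>C h) = c *\<^sub>C S h"
  using antipode_linear by (simp_all add: clinear_on_def)

lemmas mode_add = clinear_on_add[OF mode_linear]
lemmas mode_scale = clinear_on_scale[OF mode_linear]
lemmas mode_add_left = clinear_on_add[OF vertex_map_linear]
lemmas mode_scale_left = clinear_on_scale[OF vertex_map_linear]

lemma act_mode:
  "\<lbrakk>u \<in> V; v \<in> V\<rbrakk> \<Longrightarrow> act h (Y u n v) = tensor_lift (\<lambda>a b. Y (act a u) n (act b v)) (\<Delta> h)"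
  using module_voa by (simp add: hopf_module_voa_def)

lemma cbilinear_antipode: "cbilinear (\<lambda>a b. a * S b)"
  by (rule cbilinearI) (simp_all add: antipode_add antipode_scale mult_scaleC_left
      mult_scaleC_right distrib_left distrib_right)

lemma cbilinear_counit: "cbilinear (\<lambda>a b. \<epsilon> a *\<^sub>C b)" "cbilinear (\<lambda>a b. \<epsilon> b *\<^sub>C a)"
  by (rule cbilinearI, simp_all add: counit_add counit_scale scaleC_add_left scaleC_add_right
      scaleC_scaleC mult.commute)+

text \<open>In Sweedler notation, \<open>(h u)\<^sub>n = \<Sum> h\<^sub>1 u\<^sub>n S(h\<^sub>2)\<close>.\<close>

lemma mode_act:
  assumes u: "u \<in> V" and w: "w \<in> V"
  shows "Y (act h u) n w = tensor_lift (\<lambda>a b. act a (Y u n (act (S b) w))) (\<Delta> h)"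
proof -
  \<comment> \<open>Letting \<open>a\<close> act on a mode applied to S(b) w splits \<open>a\<close>
    once more, and the legs \<open>p\<close>, \<open>q\<close>, \<open>b\<close> are h_1, h_2, h_3.
    After regrouping, h_2 S(h_3) collapses by the antipode axiom, and the counit axiom leaves
    \<open>h\<close> acting on \<open>u\<close>.\<close>
  let ?\<tau> = "\<lambda>p q b. Y (act p u) n (act (q * S b) w)"
  have inner: "tensor_lift (?\<tau> a) (\<Delta> b) = Y (act (\<epsilon> b *\<^sub>C a) u) n w" for a b
  proof -
    have "tensor_lift (?\<tau> a) (\<Delta> b) = Y (act a u) n (act (tensor_lift (\<lambda>p q. p * S q) (\<Delta> b)) w)"
      by (rule clinear_on_tensor_lift[OF complex_vector.subspace_UNIV _ cbilinear_antipode, symmetric])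
        (simp_all add: clinear_on_def u w act_mem act_add_left act_scale_left mode_add mode_scale)
    then show ?thesis
      by (simp add: antipode_right u w act_mem act_scale_left act_one mode_scale mode_scale_left)
  qed
  have "tensor_lift (\<lambda>a b. act a (Y u n (act (S b) w))) (\<Delta> h) =
      tensor_lift (\<lambda>a b. tensor_lift (\<lambda>p q. ?\<tau> p q b) (\<Delta> a)) (\<Delta> h)"
    by (simp add: act_mode act_mem u w act_mult)
  also have "\<dots> = tensor_lift (\<lambda>a b. tensor_lift (?\<tau> a) (\<Delta> b)) (\<Delta> h)"
    by (intro sweedler_coassoc cbilinearI)
      (simp_all add: u w act_mem act_add_left act_scale_left mode_add mode_scale mode_add_left
        mode_scale_left antipode_add antipode_scale mult_scaleC_left mult_scaleC_right
        distrib_left distrib_right)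
  also have "\<dots> = tensor_lift (\<lambda>a b. Y (act (\<epsilon> b *\<^sub>C a) u) n w) (\<Delta> h)"
    by (simp only: inner)
  also have "\<dots> = Y (act (tensor_lift (\<lambda>a b. \<epsilon> b *\<^sub>C a) (\<Delta> h)) u) n w"
    by (rule clinear_on_tensor_lift[OF complex_vector.subspace_UNIV _ cbilinear_counit(2), symmetric])
      (simp_all add: clinear_on_def u w act_mem act_add_left act_scale_left mode_add_left mode_scale_left)
  finally show ?thesis by (simp add: counit_right)
qed

lemma act_antipode:
  assumes "w \<in> V"
  shows "tensor_lift (\<lambda>a b. act (a * S b) w) (\<Delta> h) = \<epsilon> h *\<^sub>C w"
proof -
  have "tensor_lift (\<lambda>a b. act (a * S b) w) (\<Delta> h) = act (tensor_lift (\<lambda>a b. a * S b) (\<Delta> h)) w"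
    by (rule clinear_on_tensor_lift[OF complex_vector.subspace_UNIV act_linear_left[OF assms]
          cbilinear_antipode UNIV_I, symmetric])
  then show ?thesis by (simp add: antipode_right act_scale_left act_one assms)
qed

text \<open>The axioms of an H-module VOA fix \<omega> only. For \<open>vac\<close>, creation and
  \<open>mode_act\<close> with \<open>u\<close> = \<open>vac\<close> give h \<open>vac\<close> = sum
  h_1 S(h_2) \<open>vac\<close>, because \<open>vac\<close> has the identity as its mode of index
  -1.\<close>

lemma act_vac: "act h vac = \<epsilon> h *\<^sub>C vac"
proof -
  have "act h vac = Y (act h vac) (- 1) vac" by (simp add: creation act_mem vac_mem)
  also have "\<dots> = tensor_lift (\<lambda>a b. act (a * S b) vac) (\<Delta> h)"
    by (simp add: mode_act vac_mem vacuum act_mem act_mult)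
  finally show ?thesis by (simp add: act_antipode vac_mem)
qed

lemma act_omega: "act h \<omega> = \<epsilon> h *\<^sub>C \<omega>"
  using module_voa by (simp add: hopf_module_voa_def)

lemma VH_mem: "v \<in> VH \<longleftrightarrow> v \<in> V \<and> (\<forall>h. act h v = \<epsilon> h *\<^sub>C v)"
  by (simp add: invariants_def)

lemma VH_subset: "VH \<subseteq> V"
  by (auto simp: VH_mem)

lemma VH_act: "v \<in> VH \<Longrightarrow> act h v = \<epsilon> h *\<^sub>C v"
  by (simp add: VH_mem)

lemma vac_VH: "vac \<in> VH" and omega_VH: "\<omega> \<in> VH"
  by (simp_all add: VH_mem vac_mem omega_mem act_vac act_omega)

lemma subspace_VH: "csubspace VH"
  unfolding complex_vector.subspace_def
  by (auto simp: VH_mem act_zero act_add act_scale scaleC_add_right scaleC_scaleC mult.commute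
      complex_vector.subspace_0[OF subspace_V] complex_vector.subspace_add[OF subspace_V]
      complex_vector.subspace_scale[OF subspace_V])

text \<open>On an invariant \<open>u\<close> the first leg acts by \<epsilon>, and the counit axiom
  leaves all of \<open>h\<close> on \<open>v\<close>.\<close>

lemma act_mode_invariant:
  assumes u: "u \<in> VH" and v: "v \<in> V"
  shows "act h (Y u n v) = Y u n (act h v)"
proof -
  have uV: "u \<in> V" using u by (simp add: VH_mem)
  have "act h (Y u n v) = tensor_lift (\<lambda>a b. Y u n (act (\<epsilon> a *\<^sub>C b) v)) (\<Delta> h)"
    by (simp add: act_mode uV v VH_act[OF u] mode_scale mode_scale_left act_scale_left act_mem)
  also have "\<dots> = Y u n (act (tensor_lift (\<lambda>a b. \<epsilon> a *\<^sub>C b) (\<Delta> h)) v)"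
    by (rule clinear_on_tensor_lift[OF complex_vector.subspace_UNIV _ cbilinear_counit(1), symmetric])
      (simp_all add: clinear_on_def uV v act_mem act_add_left act_scale_left mode_add mode_scale)
  finally show ?thesis by (simp add: counit_left)
qed

lemma mode_VH: "\<lbrakk>u \<in> VH; v \<in> VH\<rbrakk> \<Longrightarrow> Y u n v \<in> VH"
  using act_mode_invariant[of u v] by (simp add: VH_mem mode_closed mode_scale)

text \<open>For \<open>s\<close> in a simple submodule, \<open>(ker \<epsilon>) s\<close> is zero, and then \<open>s\<close> is invariant, or it
  contains \<open>s\<close>; in the latter case \<open>1 - k\<close> annihilates \<open>s\<close> for some \<open>k \<in> ker \<epsilon>\<close>.\<close>

lemma simple_submodule_invariant_multiple:
  assumes W: "alg_submodule act W V" "simple_alg_module act W" and s: "s \<in> W"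
  shows "\<exists>d. \<epsilon> d = 1 \<and> act d s \<in> VH"
proof -
  have sV: "s \<in> V" using W s by (auto simp: alg_submodule_def)
  let ?N = "{act k s | k. \<epsilon> k = 0}"
  \<comment> \<open>The kernel of \<epsilon> is an ideal of H, so what it produces from
    \<open>s\<close> is a submodule.\<close>
  have "alg_submodule act ?N W"
    unfolding alg_submodule_def
  proof (intro conjI allI ballI)
    show "csubspace ?N"
      unfolding complex_vector.subspace_def
    proof (intro conjI allI ballI)
      have "act (0 *\<^sub>C 1) s = 0" unfolding act_scale_left[OF sV] by simp
      moreover have "\<epsilon> (0 *\<^sub>C 1) = 0" by (simp only: counit_scale) simp
      ultimately show "0 \<in> ?N" by force
      show "x + y \<in> ?N" if xy: "x \<in> ?N" "y \<in> ?N" for x y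
      proof -
        obtain k l where "x = act k s" "y = act l s" "\<epsilon> k = 0" "\<epsilon> l = 0" using xy by auto
        then have "x + y = act (k + l) s \<and> \<epsilon> (k + l) = 0"
          by (simp add: act_add_left sV counit_add)
        then show ?thesis by blast
      qed
      show "c *\<^sub>C x \<in> ?N" if x: "x \<in> ?N" for c x
      proof -
        obtain k where "x = act k s" "\<epsilon> k = 0" using x by auto
        then have "c *\<^sub>C x = act (c *\<^sub>C k) s \<and> \<epsilon> (c *\<^sub>C k) = 0"
          by (simp add: act_scale_left sV counit_scale)
        then show ?thesis by blast
      qed
    qed
    show "?N \<subseteq> W" using W s by (auto simp: alg_submodule_def)
    show "act h x \<in> ?N" if x: "x \<in> ?N" for h x
    proof -
      obtain k where "x = act k s" "\<epsilon> k = 0" using x by auto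
      then have "act h x = act (h * k) s \<and> \<epsilon> (h * k) = 0"
        by (simp add: act_mult sV counit_mult)
      then show ?thesis by blast
    qed
  qed
  then consider "?N = {0}" | "?N = W" using W(2) unfolding simple_alg_module_def by blast
  then show ?thesis
  proof cases
    case 1
    have "act h s = \<epsilon> h *\<^sub>C s" for h
    proof -
      have "\<epsilon> (h - \<epsilon> h *\<^sub>C 1) = 0" by (simp add: counit_diff counit_scale counit_one)
      then have "act (h - \<epsilon> h *\<^sub>C 1) s \<in> ?N" by blast
      then have "act (h - \<epsilon> h *\<^sub>C 1) s = 0" using 1 by blast
      then show ?thesis by (simp add: act_diff_left act_scale_left act_one sV)
    qed
    then have "s \<in> VH" using sV by (simp add: VH_mem)
    then show ?thesis using act_one[OF sV] counit_one by force
  next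
    case 2
    then obtain k where k: "s = act k s" "\<epsilon> k = 0" using s by blast
    have "act (1 - k) s = 0" using k(1) by (simp add: act_diff_left act_one sV)
    moreover have "\<epsilon> (1 - k) = 1" using k(2) by (simp add: counit_diff counit_one)
    ultimately show ?thesis using complex_vector.subspace_0[OF subspace_VH] by metis
  qed
qed

text \<open>Vectors in simple submodules are treated one after another. Once \<open>c\<close> works
  for \<open>G\<close>, some \<open>d\<close> is chosen for c g; the product d c still works on
  \<open>G\<close>, as an element with counit 1 fixes invariant vectors. Arbitrary vectors lie in
  spans of finitely many of these.\<close>

lemma finite_invariant_multiple:
  assumes semisimple: "semisimple_alg_module act V" and F: "finite F" "F \<subseteq> V"
  shows "\<exists>c. \<epsilon> c = 1 \<and> (\<forall>v\<in>F. act c v \<in> VH)"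
proof -
  have simples: "\<exists>c. \<epsilon> c = 1 \<and> (\<forall>g\<in>G. act c g \<in> VH)"
    if "finite G" "\<And>g. g \<in> G \<Longrightarrow> \<exists>W. alg_submodule act W V \<and> simple_alg_module act W \<and> g \<in> W" for G
    using that
  proof (induction G)
    case empty
    then show ?case using counit_one by blast
  next
    case (insert g G)
    then obtain c where c: "\<epsilon> c = 1" "\<And>g. g \<in> G \<Longrightarrow> act c g \<in> VH" by blast
    obtain W where W: "alg_submodule act W V" "simple_alg_module act W" "g \<in> W"
      using insert.prems by blast
    then have "act c g \<in> W" by (auto simp: alg_submodule_def)
    then obtain d where d: "\<epsilon> d = 1" "act d (act c g) \<in> VH"
      using simple_submodule_invariant_multiple[OF W(1,2)] by blast
    have V: "insert g G \<subseteq> V"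
      using insert.prems by (fastforce simp: alg_submodule_def)
    have "act (d * c) x \<in> VH" if "x \<in> insert g G" for x
    proof (cases "x = g")
      case True
      then show ?thesis using d V by (simp add: act_mult)
    next
      case False
      then have "act c x \<in> VH" using that c by auto
      then show ?thesis using that V VH_act[of "act c x" d] d(1) by (auto simp: act_mult scaleC_one)
    qed
    then show ?case using c d by (intro exI[of _ "d * c"]) (simp add: counit_mult)
  qed
  obtain \<W> where \<W>: "\<And>W. W \<in> \<W> \<Longrightarrow> alg_submodule act W V \<and> simple_alg_module act W"
    "internal_direct_sum V \<W> (\<lambda>W. W)"
    using semisimple unfolding semisimple_alg_module_def by blast
  have "\<exists>G. finite G \<and> G \<subseteq> \<Union>\<W> \<and> v \<in> cspan G" if "v \<in> V" for v
  proof -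
    have "\<exists>!f. finite {k. f k \<noteq> 0} \<and> (\<forall>k\<in>\<W>. f k \<in> k) \<and> (\<forall>k. k \<notin> \<W> \<longrightarrow> f k = 0) \<and>
        v = (\<Sum>k | f k \<noteq> 0. f k)"
      using \<W>(2) that unfolding internal_direct_sum_def by (elim conjE) (rule bspec)
    then obtain f where f: "finite {k. f k \<noteq> 0} \<and> (\<forall>k\<in>\<W>. f k \<in> k) \<and> (\<forall>k. k \<notin> \<W> \<longrightarrow> f k = 0) \<and>
        v = (\<Sum>k | f k \<noteq> 0. f k)" by (blast dest: ex1_implies_ex)
    let ?G = "f ` {k. f k \<noteq> 0}"
    have "finite ?G" using f by blast
    moreover have "?G \<subseteq> \<Union>\<W>" using f by blast
    moreover have "(\<Sum>k | f k \<noteq> 0. f k) \<in> cspan ?G"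
      by (intro complex_vector.span_sum complex_vector.span_base) blast
    then have "v \<in> cspan ?G" using f by simp
    ultimately show ?thesis by blast
  qed
  then obtain G where G: "\<And>v. v \<in> V \<Longrightarrow> finite (G v) \<and> G v \<subseteq> \<Union>\<W> \<and> v \<in> cspan (G v)" by metis
  let ?G = "\<Union>v\<in>F. G v"
  have "finite ?G" using F G by auto
  have GW: "\<exists>W\<in>\<W>. g \<in> W" if g: "g \<in> ?G" for g
  proof -
    obtain v where "v \<in> F" "g \<in> G v" using g by blast
    then have "g \<in> \<Union>\<W>" using G[of v] F by (meson subsetD)
    then show ?thesis by blast
  qed
  have "\<exists>W. alg_submodule act W V \<and> simple_alg_module act W \<and> g \<in> W" if g: "g \<in> ?G" for g
  proof -
    obtain W where "W \<in> \<W>" "g \<in> W" using GW[OF g] by blast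
    then show ?thesis using \<W>(1) by blast
  qed
  from simples[OF \<open>finite ?G\<close> this]
  obtain c where c: "\<epsilon> c = 1" "\<And>g. g \<in> ?G \<Longrightarrow> act c g \<in> VH" by blast
  have "g \<in> V" if "g \<in> ?G" for g
    using GW[OF that] \<W>(1) unfolding alg_submodule_def by blast
  have "csubspace {x\<in>V. act c x \<in> VH}"
    using subspace_V subspace_VH unfolding complex_vector.subspace_def
    by (auto simp: act_zero act_add act_scale)
  then have "cspan ?G \<subseteq> {x\<in>V. act c x \<in> VH}"
    using c(2) \<open>\<And>g. g \<in> ?G \<Longrightarrow> g \<in> V\<close>
    by (intro complex_vector.span_minimal subsetI CollectI conjI) blast+
  moreover have "v \<in> cspan ?G" if "v \<in> F" for v
  proof -
    have "v \<in> cspan (G v)" "cspan (G v) \<subseteq> cspan ?G"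
      using G F that by (auto intro!: complex_vector.span_mono)
    then show ?thesis by blast
  qed
  ultimately show ?thesis using c(1) by blast
qed

lemma mode_sum_act:
  assumes "fst ` set xs \<subseteq> V" and w: "w \<in> V"
  shows "mode_sum Y (map (\<lambda>(u, n). (act h u, n)) xs) w =
    tensor_lift (\<lambda>a b. act a (mode_sum Y xs (act (S b) w))) (\<Delta> h)"
  using assms(1)
proof (induction xs)
  case Nil
  then show ?case by (simp add: act_zero tensor_lift_zero)
next
  case (Cons x xs)
  obtain u n where x: "x = (u, n)" by (cases x)
  have u: "u \<in> V" "fst ` set xs \<subseteq> V" using Cons.prems x by auto
  have add: "mode_sum Y xs (v + v') = mode_sum Y xs v + mode_sum Y xs v'"
    if "v \<in> V" "v' \<in> V" for v v'
    using u(2) that by (induction xs) (auto simp: mode_add)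
  have scale: "mode_sum Y xs (c *\<^sub>C v) = c *\<^sub>C mode_sum Y xs v" if "v \<in> V" for v c
    using u(2) that by (induction xs) (auto simp: mode_scale scaleC_add_right)
  have "cbilinear (\<lambda>a b. act a (Y u n (act (S b) w)))"
    by (rule cbilinearI)
      (simp_all add: u w act_mem act_add_left act_scale_left act_add act_scale mode_closed mode_add
        mode_scale antipode_add antipode_scale)
  moreover have "cbilinear (\<lambda>a b. act a (mode_sum Y xs (act (S b) w)))"
    by (rule cbilinearI)
      (simp_all add: u w act_mem act_add_left act_scale_left act_add act_scale mode_sum_mem add scale
        antipode_add antipode_scale)
  moreover have "act a (Y u n (act (S b) w) + mode_sum Y xs (act (S b) w)) =
      act a (Y u n (act (S b) w)) + act a (mode_sum Y xs (act (S b) w))" for a b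
    by (simp add: act_add mode_closed mode_sum_mem act_mem u w)
  ultimately show ?case
    using Cons.IH[OF u(2)] by (simp add: x tensor_lift_plus mode_act u w)
qed

text \<open>If \<open>f\<close> is a sum of modes of vectors \<open>u\<close>, it is also the sum of the modes of the vectors
  \<open>c u\<close> when \<open>\<epsilon> c = 1\<close>, because \<open>f\<close> is invariant under the adjoint action.\<close>

lemma equivariant_mode_sum:
  assumes simple: "simple_voa V Y vac \<omega>" and semisimple: "semisimple_alg_module act V"
    and W: "alg_submodule act W V" "finite_dimensional W" and f: "f \<in> alg_hom act W act V"
  obtains xs where "fst ` set xs \<subseteq> VH" "\<And>w. w \<in> W \<Longrightarrow> f w = mode_sum Y xs w"
proof -
  have WV: "csubspace W" "W \<subseteq> V" "\<And>h w. w \<in> W \<Longrightarrow> act h w \<in> W"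
    using W(1) by (auto simp: alg_submodule_def)
  have f': "clinear_on W f" "f ` W \<subseteq> V" "\<And>h w. w \<in> W \<Longrightarrow> f (act h w) = act h (f w)"
    using f by (auto simp: alg_hom_def)
  obtain xs where xs: "fst ` set xs \<subseteq> V" "\<And>w. w \<in> W \<Longrightarrow> f w = mode_sum Y xs w"
    using simple_voa_density[OF simple WV(1) W(2) WV(2) f'(1,2)] by blast
  obtain c where c: "\<epsilon> c = 1" "\<forall>u\<in>fst ` set xs. act c u \<in> VH"
    using finite_invariant_multiple[OF semisimple finite_imageI[OF finite_set] xs(1)] by blast
  let ?ys = "map (\<lambda>(u, n). (act c u, n)) xs"
  have "mode_sum Y ?ys w = f w" if w: "w \<in> W" for w
  proof -
    have wV: "w \<in> V" "f w \<in> V" using w WV f' by auto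
    have "mode_sum Y ?ys w = tensor_lift (\<lambda>a b. act a (mode_sum Y xs (act (S b) w))) (\<Delta> c)"
      by (rule mode_sum_act[OF xs(1) wV(1)])
    \<comment> \<open>S(b) w stays in \<open>W\<close>, where the sum of modes is \<open>f\<close>,
      and H-linearity moves S(b) past \<open>f\<close>.\<close>
    also have "\<dots> = tensor_lift (\<lambda>a b. act (a * S b) (f w)) (\<Delta> c)"
      by (simp add: w wV WV(3) act_mult f'(3) flip: xs(2))
    finally show ?thesis by (simp add: act_antipode wV c scaleC_one)
  qed
  moreover have "fst ` set ?ys \<subseteq> VH" using c(2) by force
  ultimately show thesis using that by metis
qed

end

section \<open>Multiplicity spaces\<close>

lemma alg_hom_image_submodule:
  assumes M: "alg_module \<rho> M" and f: "f \<in> alg_hom \<rho> M act V"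
  shows "alg_submodule act (f ` M) V"
  unfolding alg_submodule_def
proof (intro conjI allI ballI)
  have M': "csubspace M" "\<And>h x. x \<in> M \<Longrightarrow> \<rho> h x \<in> M" using M by (auto simp: alg_module_def)
  have f': "clinear_on M f" "f ` M \<subseteq> V" "\<And>h x. x \<in> M \<Longrightarrow> f (\<rho> h x) = act h (f x)"
    using f by (auto simp: alg_hom_def)
  show "csubspace (f ` M)"
    unfolding complex_vector.subspace_def
  proof (intro conjI allI ballI)
    show "0 \<in> f ` M"
      using clinear_on_zero[OF M'(1) f'(1)] complex_vector.subspace_0[OF M'(1)] by force
    show "x + y \<in> f ` M" if xy: "x \<in> f ` M" "y \<in> f ` M" for x y
    proof -
      obtain a b where "x = f a" "y = f b" "a \<in> M" "b \<in> M" using xy by blast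
      then have "x + y = f (a + b)" "a + b \<in> M"
        using f'(1) complex_vector.subspace_add[OF M'(1)] by (auto simp: clinear_on_add)
      then show ?thesis by blast
    qed
    show "c *\<^sub>C x \<in> f ` M" if x: "x \<in> f ` M" for c x
    proof -
      obtain a where "x = f a" "a \<in> M" using x by blast
      then have "c *\<^sub>C x = f (c *\<^sub>C a)" "c *\<^sub>C a \<in> M"
        using f'(1) complex_vector.subspace_scale[OF M'(1)] by (auto simp: clinear_on_scale)
      then show ?thesis by blast
    qed
  qed
  show "f ` M \<subseteq> V" by (rule f')
  show "act h x \<in> f ` M" if x: "x \<in> f ` M" for h x
  proof -
    obtain a where "x = f a" "a \<in> M" using x by blast
    then have "act h x = f (\<rho> h a)" "\<rho> h a \<in> M" using M'(2) f'(3) by auto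
    then show ?thesis by blast
  qed
qed

lemma alg_hom_inverse:
  assumes M: "alg_module \<rho> M" and f: "f \<in> alg_hom \<rho> M act V" and inj: "inj_on f M"
  shows "the_inv_into M f \<in> alg_hom act (f ` M) \<rho> M"
proof -
  have M': "csubspace M" "\<And>h x. x \<in> M \<Longrightarrow> \<rho> h x \<in> M" using M by (auto simp: alg_module_def)
  have f': "clinear_on M f" "\<And>h x. x \<in> M \<Longrightarrow> act h (f x) = f (\<rho> h x)"
    using f by (auto simp: alg_hom_def)
  have "clinear_on (f ` M) (the_inv_into M f)"
    unfolding clinear_on_def
    by (auto simp: the_inv_into_f_f[OF inj] M' complex_vector.subspace_add
        complex_vector.subspace_scale simp flip: clinear_on_add[OF f'(1)] clinear_on_scale[OF f'(1)])
  then show ?thesis by (auto simp: alg_hom_def the_inv_into_f_f[OF inj] f' M')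
qed

lemma alg_hom_compose:
  assumes "f \<in> alg_hom \<rho> M act V" "g \<in> alg_hom act V act' W"
  shows "(\<lambda>x. g (f x)) \<in> alg_hom \<rho> M act' W"
  using assms clinear_on_compose[of M f V g]
  by (simp add: alg_hom_def image_subset_iff)

lemma alg_hom_subset: "\<lbrakk>f \<in> alg_hom \<rho> M act W; W \<subseteq> V\<rbrakk> \<Longrightarrow> f \<in> alg_hom \<rho> M act V"
  by (auto simp: alg_hom_def)

text \<open>The preimage is a submodule. With N = {0} this yields injectivity of nonzero
  homomorphisms; with \<open>N\<close> the image of a second homomorphism it compares the two
  images.\<close>

lemma simple_alg_module_preimage:
  assumes M: "simple_alg_module \<rho> M" and f: "f \<in> alg_hom \<rho> M act V"
    and N: "csubspace N" "\<And>h x. x \<in> N \<Longrightarrow> act h x \<in> N"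
  shows "{x\<in>M. f x \<in> N} = {0} \<or> {x\<in>M. f x \<in> N} = M"
proof -
  have M': "csubspace M" "\<And>h x. x \<in> M \<Longrightarrow> \<rho> h x \<in> M"
    using M by (auto simp: simple_alg_module_def alg_module_def)
  have f': "clinear_on M f" "\<And>h x. x \<in> M \<Longrightarrow> f (\<rho> h x) = act h (f x)"
    using f by (auto simp: alg_hom_def)
  have "alg_submodule \<rho> {x\<in>M. f x \<in> N} M"
    using M' N unfolding alg_submodule_def complex_vector.subspace_def
    by (auto simp: f' clinear_on_zero[OF M'(1) f'(1)] clinear_on_add[OF f'(1)]
        clinear_on_scale[OF f'(1)])
  then show ?thesis using M unfolding simple_alg_module_def by blast
qed

lemma simple_alg_module_hom_inj:
  assumes M: "simple_alg_module \<rho> M" and V: "alg_module act V" and f: "f \<in> alg_hom \<rho> M act V"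
    and x: "x \<in> M" "f x \<noteq> 0"
  shows "inj_on f M"
proof -
  have M': "csubspace M" using M by (auto simp: simple_alg_module_def alg_module_def)
  have f': "clinear_on M f" using f by (auto simp: alg_hom_def)
  have V': "csubspace V" "\<And>h. clinear_on V (act h)" using V by (auto simp: alg_module_def)
  have "{x\<in>M. f x \<in> {0}} = {0}"
    using simple_alg_module_preimage[OF M f complex_vector.subspace_single_0] x
      clinear_on_zero[OF V'] by auto
  then have ker: "y = 0" if "y \<in> M" "f y = 0" for y using that by blast
  show ?thesis
  proof (rule inj_onI)
    fix a b assume ab: "a \<in> M" "b \<in> M" "f a = f b"
    then have "f (a - b) = 0" by (simp add: clinear_on_diff[OF M' f'])
    then have "a - b = 0" using ker complex_vector.subspace_diff[OF M'] ab by blast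
    then show "a = b" by simp
  qed
qed

lemma simple_alg_module_cyclic:
  assumes M: "simple_alg_module \<rho> M" and w: "w \<in> M" "w \<noteq> 0" and x: "x \<in> M"
  shows "\<exists>h. x = \<rho> h w"
proof -
  have M': "csubspace M" "\<And>h x. x \<in> M \<Longrightarrow> \<rho> h x \<in> M" "clinear_on UNIV (\<lambda>h. \<rho> h w)"
    "\<rho> 1 w = w" "\<And>g h. \<rho> (g * h) w = \<rho> g (\<rho> h w)"
    using M w by (auto simp: simple_alg_module_def alg_module_def)
  note lin = clinear_on_zero[OF complex_vector.subspace_UNIV M'(3)]
    clinear_on_add[OF M'(3) UNIV_I UNIV_I] clinear_on_scale[OF M'(3) UNIV_I]
  have "alg_submodule \<rho> (range (\<lambda>h. \<rho> h w)) M"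
    unfolding alg_submodule_def complex_vector.subspace_def
    by (auto simp: M'(2) w simp flip: lin M'(5))
  then have "range (\<lambda>h. \<rho> h w) = {0} \<or> range (\<lambda>h. \<rho> h w) = M"
    using M unfolding simple_alg_module_def by blast
  moreover have "w \<in> range (\<lambda>h. \<rho> h w)" using M'(4) by (metis rangeI)
  ultimately show ?thesis using w x by blast
qed

section \<open>Gradings of subspaces stable under L(0)\<close>

context vertex_operator_algebra
begin

lemma L0_linear: "clinear_on V (Y \<omega> 1)"
  by (rule mode_linear[OF omega_mem])

lemma weight_space_eq: "weight_space N Y \<omega> \<mu> = {v\<in>N. Y \<omega> 1 v = \<mu> *\<^sub>C v}"
  by (simp add: weight_space_def virasoro_def)

lemma L0_decomposition:
  assumes "v \<in> V"
  obtains F x where "finite F" "\<And>n. n \<in> F \<Longrightarrow> x n \<in> V \<and> Y \<omega> 1 (x n) = of_int n *\<^sub>C x n"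
    "v = (\<Sum>n\<in>F. x n)"
proof -
  obtain F x where "finite F" "\<And>n. n \<in> F \<Longrightarrow> x n \<in> weight_space V Y \<omega> (of_int n)"
    "v = (\<Sum>n\<in>F. x n)" using weight_decomposition[OF assms] by blast
  then show thesis by (intro that[of F x]) (auto simp: weight_space_eq)
qed

lemma graded_subspace_integer:
  assumes N: "csubspace N" "N \<subseteq> V" "\<And>v. v \<in> N \<Longrightarrow> Y \<omega> 1 v \<in> N"
  shows "internal_direct_sum N UNIV (\<lambda>n::int. weight_space N Y \<omega> (of_int n))"
  unfolding weight_space_eq
proof (rule internal_direct_sum_eigenspaces[OF subspace_V L0_linear N])
  show "inj (of_int :: int \<Rightarrow> complex)" by (simp add: inj_def)
  show "\<exists>F x. finite F \<and> (\<forall>k\<in>F. x k \<in> V \<and> Y \<omega> 1 (x k) = of_int k *\<^sub>C x k) \<and> v = (\<Sum>k\<in>F. x k)"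
    if "v \<in> N" for v
    using L0_decomposition[of v] N(2) that by (metis subsetD)
qed

text \<open>\<open>V\<close> has integer weights, but modules are graded over the complex numbers;
  the integer decomposition is reindexed along \<open>of_int\<close>.\<close>

lemma graded_subspace_complex:
  assumes N: "csubspace N" "N \<subseteq> V" "\<And>v. v \<in> N \<Longrightarrow> Y \<omega> 1 v \<in> N"
  shows "internal_direct_sum N UNIV (weight_space N Y \<omega>)"
proof -
  have "internal_direct_sum N UNIV (\<lambda>\<mu>. {v\<in>N. Y \<omega> 1 v = \<mu> *\<^sub>C v})"
  proof (rule internal_direct_sum_eigenspaces[OF subspace_V L0_linear N])
    show "inj (\<lambda>\<mu>::complex. \<mu>)" by (simp add: inj_def)
    show "\<exists>F x. finite F \<and> (\<forall>\<mu>\<in>F. x \<mu> \<in> V \<and> Y \<omega> 1 (x \<mu>) = \<mu> *\<^sub>C x \<mu>) \<and> v = (\<Sum>\<mu>\<in>F. x \<mu>)"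
      if v: "v \<in> N" for v
    proof -
      obtain F x where F: "finite F" "\<And>n. n \<in> F \<Longrightarrow> x n \<in> V \<and> Y \<omega> 1 (x n) = of_int n *\<^sub>C x n"
        "v = (\<Sum>n\<in>F. x n)" using L0_decomposition[of v] N(2) v by blast
      let ?x = "\<lambda>\<mu> :: complex. x (the_inv of_int \<mu>)"
      have inv: "the_inv (of_int :: int \<Rightarrow> complex) (of_int n) = n" for n
        by (rule the_inv_f_f) (simp add: inj_def)
      have "(\<Sum>\<mu>\<in>(of_int :: int \<Rightarrow> complex) ` F. ?x \<mu>) = (\<Sum>n\<in>F. x n)"
        by (subst sum.reindex) (auto simp: inj_on_def inv)
      then show ?thesis using F inv by (intro exI[of _ "of_int ` F"] exI[of _ ?x]) auto
    qed
  qed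
  then show ?thesis by (simp add: weight_space_eq[abs_def])
qed

text \<open>By \<open>eigenvector_component_mem\<close> each integral component of \<open>v\<close>
  also lies in the eigenspace of \<mu>, and an eigenvector for two different eigenvalues is
  0.\<close>

lemma weight_space_noninteger:
  assumes "\<mu> \<notin> \<int>" "v \<in> V" "Y \<omega> 1 v = \<mu> *\<^sub>C v"
  shows "v = 0"
proof -
  obtain F x where F: "finite F" "\<And>n. n \<in> F \<Longrightarrow> x n \<in> V \<and> Y \<omega> 1 (x n) = of_int n *\<^sub>C x n"
    "v = (\<Sum>n\<in>F. x n)" using L0_decomposition[OF assms(2)] by blast
  let ?N = "{y\<in>V. Y \<omega> 1 y = \<mu> *\<^sub>C y}"
  have N: "csubspace ?N" using subspace_weight_space[of \<mu>] by (simp add: weight_space_eq)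
  have "x n = 0" if n: "n \<in> F" for n
  proof -
    have "x n \<in> ?N"
    proof (rule eigenvector_component_mem[OF subspace_V L0_linear N _ F(1) _ F(2) _ n])
      show "inj_on (of_int :: int \<Rightarrow> complex) F" by (simp add: inj_on_def)
      show "sum x F \<in> ?N" using assms F(3) by simp
      show "Y \<omega> 1 y \<in> ?N" if "y \<in> ?N" for y
        using that complex_vector.subspace_scale[OF N that, of \<mu>] by simp
    qed
    then have "(of_int n - \<mu>) *\<^sub>C x n = 0"
      using F(2)[OF n] by (simp add: complex_vector.scale_left_diff_distrib)
    moreover have "of_int n - \<mu> \<noteq> 0" using assms(1) by auto
    ultimately show ?thesis by simp
  qed
  then show ?thesis using F(3) by simp
qed

lemma weight_space_sub_finite_dim:
  assumes "N \<subseteq> V"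
  shows "finite_dimensional (weight_space N Y \<omega> \<mu>)"
proof (cases "\<mu> \<in> \<int>")
  case True
  then obtain n where "\<mu> = of_int n" by (auto elim: Ints_cases)
  then show ?thesis
    using finite_dimensional_subset[OF weight_finite_dim[of n], of "weight_space N Y \<omega> \<mu>"] assms
    by (auto simp: weight_space_eq)
next
  case False
  then have "weight_space N Y \<omega> \<mu> \<subseteq> {0}"
    using weight_space_noninteger assms by (auto simp: weight_space_eq)
  then have "weight_space N Y \<omega> \<mu> \<subseteq> cspan {}" by simp
  then show ?thesis unfolding finite_dimensional_def by blast
qed

lemma weight_space_sub_bounded:
  assumes "csubspace N" "N \<subseteq> V"
  shows "\<exists>K::int. \<forall>n<K. weight_space N Y \<omega> (\<mu> + of_int n) = {0}"
proof -
  have zero: "0 \<in> weight_space N Y \<omega> \<nu>" for \<nu>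
    using complex_vector.subspace_0[OF assms(1)] by (simp add: weight_space_eq mode_zero_right omega_mem)
  show ?thesis
  proof (cases "\<mu> \<in> \<int>")
    case True
    then obtain m where m: "\<mu> = of_int m" by (auto elim: Ints_cases)
    obtain K where K: "\<forall>n<K. weight_space V Y \<omega> (of_int n) = {0}" using weight_bounded by blast
    have "weight_space N Y \<omega> (\<mu> + of_int n) = {0}" if "n < K - m" for n
    proof -
      have "weight_space N Y \<omega> (of_int (m + n)) \<subseteq> weight_space V Y \<omega> (of_int (m + n))"
        using assms(2) by (auto simp: weight_space_eq)
      also have "\<dots> = {0}" using K that by (simp del: of_int_add)
      finally show ?thesis using zero[of "of_int (m + n)"] by (auto simp: m)
    qed
    then show ?thesis by blast
  next
    case False
    have "weight_space N Y \<omega> (\<mu> + of_int n) = {0}" for n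
    proof -
      have "\<mu> + of_int n \<notin> \<int>" using False Ints_diff[of "\<mu> + of_int n" "of_int n"] by auto
      then have "weight_space N Y \<omega> (\<mu> + of_int n) \<subseteq> {0}"
        using weight_space_noninteger assms(2) unfolding weight_space_eq by blast
      then show ?thesis using zero by blast
    qed
    then show ?thesis by blast
  qed
qed

text \<open>Linearity, truncation, vacuum and Jacobi identity restrict from \<open>V\<close>. The
  grading comes from stability under L(0), a mode of \<omega> in \<open>U\<close>; weight spaces at
  non-integers vanish, and the others lie in those of \<open>V\<close>.\<close>

lemma voa_module_subspace:
  assumes U: "U \<subseteq> V" "\<omega> \<in> U"
    and N: "csubspace N" "N \<subseteq> V" "\<And>u n v. \<lbrakk>u \<in> U; v \<in> N\<rbrakk> \<Longrightarrow> Y u n v \<in> N"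
  shows "voa_module U Y vac \<omega> N Y"
proof unfold_locales
  show "clinear_on N (Y u n)" if "u \<in> U" for u n
    using clinear_on_subset[OF mode_linear N(2)] U that by blast
  show "clinear_on U (\<lambda>u. Y u n w)" if "w \<in> N" for w n
    using clinear_on_subset[OF vertex_map_linear U(1)] N that by blast
  show "internal_direct_sum N UNIV (weight_space N Y \<omega>)"
    using N(3)[OF U(2)] by (rule graded_subspace_complex[OF N(1,2)])
  show "finite_dimensional (weight_space N Y \<omega> \<mu>)"
      "\<exists>K::int. \<forall>n<K. weight_space N Y \<omega> (\<mu> + of_int n) = {0}" for \<mu>
    using weight_space_sub_finite_dim[OF N(2)] weight_space_sub_bounded[OF N(1,2)] by blast+
  show "\<exists>K. \<forall>n\<ge>K. Y u n v = 0" if "u \<in> U" "v \<in> N" for u v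
    using truncation[of u v] U(1) N(2) that by blast
  show "Y vac n v = (if n = - 1 then v else 0)" if "v \<in> N" for v n
    using vacuum[of v n] N(2) that by blast
  show "jacobi_identity Y Y u v x" if "u \<in> U" "v \<in> U" "x \<in> N" for u v x
    using jacobi[of u v x] U(1) N(2) that by blast
qed (use N in auto)

lemma sub_vertex_operator_algebra:
  assumes U: "csubspace U" "U \<subseteq> V" "vac \<in> U" "\<omega> \<in> U" "\<And>u n v. \<lbrakk>u \<in> U; v \<in> U\<rbrakk> \<Longrightarrow> Y u n v \<in> U"
  shows "vertex_operator_algebra U Y vac \<omega>"
proof unfold_locales
  show "internal_direct_sum U UNIV (\<lambda>n::int. weight_space U Y \<omega> (of_int n))"
    using U by (intro graded_subspace_integer) auto
  show "\<exists>N::int. \<forall>n<N. weight_space U Y \<omega> (of_int n) = {0}"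
    using weight_space_sub_bounded[OF U(1,2), of 0] by simp
  show "vac \<in> weight_space U Y \<omega> 0" "\<omega> \<in> weight_space U Y \<omega> 2"
    using vac_weight omega_weight U by (simp_all add: weight_space_def)
  show "clinear_on U (Y u n)" if "u \<in> U" for u n
    using clinear_on_subset[OF mode_linear U(2)] U that by blast
  show "clinear_on U (\<lambda>u. Y u n w)" if "w \<in> U" for w n
    using clinear_on_subset[OF vertex_map_linear U(2)] U that by blast
  obtain c where c: "\<forall>m n. \<forall>v\<in>V.
      virasoro Y \<omega> m (virasoro Y \<omega> n v) - virasoro Y \<omega> n (virasoro Y \<omega> m v) =
        of_int (m - n) *\<^sub>C virasoro Y \<omega> (m + n) v +
        (if m + n = 0 then (of_int (m ^ 3 - m) / 12 * c) *\<^sub>C v else 0)"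
    using virasoro_relations by blast
  show "\<exists>c. \<forall>m n. \<forall>v\<in>U.
      virasoro Y \<omega> m (virasoro Y \<omega> n v) - virasoro Y \<omega> n (virasoro Y \<omega> m v) =
        of_int (m - n) *\<^sub>C virasoro Y \<omega> (m + n) v +
        (if m + n = 0 then (of_int (m ^ 3 - m) / 12 * c) *\<^sub>C v else 0)"
    using c U(2) by (intro exI[of _ c]) blast
  show "Y (virasoro Y \<omega> (- 1) u) n v = of_int (- n) *\<^sub>C Y u (n - 1) v" if "u \<in> U" "v \<in> U" for u v n
    using translation[of u v n] U(2) that by blast
  show "finite_dimensional (weight_space U Y \<omega> (of_int n))" for n
    by (rule weight_space_sub_finite_dim[OF U(2)])
  show "\<exists>K. \<forall>n\<ge>K. Y u n v = 0" if "u \<in> U" "v \<in> U" for u v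
    using truncation[of u v] U(2) that by blast
  show "Y vac n v = (if n = - 1 then v else 0)" "Y v (- 1) vac = v" if "v \<in> U" for v n
    using vacuum[of v n] creation[of v] U(2) that by blast+
  show "Y v n vac = 0" if "v \<in> U" "0 \<le> n" for v n
    using creation_regular[of v n] U(2) that by blast
  show "jacobi_identity Y Y u v x" if "u \<in> U" "v \<in> U" "x \<in> U" for u v x
    using jacobi[of u v x] U(2) that by blast
qed (use U in auto)

end

section \<open>Multiplicity spaces as modules over the invariants\<close>

context hopf_module_voa_action
begin

lemma multiplicity_space_eq: "multiplicity_space \<rho> M w act V = (\<lambda>f. f w) ` alg_hom \<rho> M act V"
  unfolding multiplicity_space_def by blast

lemma subspace_multiplicity_space:
  assumes "w \<in> M"
  shows "csubspace (multiplicity_space \<rho> M w act V)"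
  unfolding complex_vector.subspace_def
proof (intro conjI allI ballI)
  have "(\<lambda>x. 0) \<in> alg_hom \<rho> M act V"
    by (auto simp: alg_hom_def clinear_on_def act_zero complex_vector.subspace_0[OF subspace_V])
  then show "0 \<in> multiplicity_space \<rho> M w act V" unfolding multiplicity_space_eq by force
  show "x + y \<in> multiplicity_space \<rho> M w act V"
    if xy: "x \<in> multiplicity_space \<rho> M w act V" "y \<in> multiplicity_space \<rho> M w act V" for x y
  proof -
    obtain f g where fg: "f \<in> alg_hom \<rho> M act V" "g \<in> alg_hom \<rho> M act V" "x = f w" "y = g w"
      using xy unfolding multiplicity_space_eq by blast
    then have "(\<lambda>z. f z + g z) \<in> alg_hom \<rho> M act V"
      by (auto simp: alg_hom_def clinear_on_def image_subset_iff act_add scaleC_add_right algebra_simps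
          intro!: complex_vector.subspace_add[OF subspace_V])
    then show ?thesis unfolding multiplicity_space_eq fg(3,4) by (rule rev_image_eqI) simp
  qed
  show "c *\<^sub>C x \<in> multiplicity_space \<rho> M w act V"
    if x: "x \<in> multiplicity_space \<rho> M w act V" for c x
  proof -
    obtain f where f: "f \<in> alg_hom \<rho> M act V" "x = f w"
      using x unfolding multiplicity_space_eq by blast
    then have "(\<lambda>z. c *\<^sub>C f z) \<in> alg_hom \<rho> M act V"
      by (auto simp: alg_hom_def clinear_on_def image_subset_iff act_scale scaleC_add_right
          scaleC_scaleC mult.commute intro!: complex_vector.subspace_scale[OF subspace_V])
    then show ?thesis unfolding multiplicity_space_eq f(2) by (rule rev_image_eqI) simp
  qed
qed

lemma multiplicity_space_subset:
  assumes "w \<in> M"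
  shows "multiplicity_space \<rho> M w act V \<subseteq> V"
  using assms unfolding multiplicity_space_eq by (auto simp: alg_hom_def)

text \<open>A mode of an invariant vector is an H-endomorphism of \<open>V\<close>, so it can be
  composed with a homomorphism from \<open>M\<close>.\<close>

lemma mode_multiplicity_space:
  assumes u: "u \<in> VH" and x: "x \<in> multiplicity_space \<rho> M w act V"
  shows "Y u n x \<in> multiplicity_space \<rho> M w act V"
proof -
  have uV: "u \<in> V" using u by (simp add: VH_mem)
  obtain f where f: "f \<in> alg_hom \<rho> M act V" "x = f w"
    using x unfolding multiplicity_space_eq by blast
  have "Y u n \<in> alg_hom act V act V"
    using act_mode_invariant[OF u] mode_linear[OF uV] mode_closed[OF uV] by (auto simp: alg_hom_def)
  from alg_hom_compose[OF f(1) this] show ?thesis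
    unfolding multiplicity_space_eq f(2) by (rule rev_image_eqI) simp
qed

lemma voa_module_multiplicity_space:
  "w \<in> M \<Longrightarrow> voa_module VH Y vac \<omega> (multiplicity_space \<rho> M w act V) Y"
  by (intro voa_module_subspace VH_subset omega_VH subspace_multiplicity_space
      multiplicity_space_subset mode_multiplicity_space)

lemma act_weight_space:
  assumes "v \<in> weight_space V Y \<omega> \<mu>"
  shows "act h v \<in> weight_space V Y \<omega> \<mu>"
  using assms act_mode_invariant[OF omega_VH, of v h 1]
  by (auto simp: weight_space_eq act_mem act_scale)

text \<open>\<open>M = H w\<close> maps into the sum of the finitely many weight spaces that meet \<open>f w\<close>.\<close>

lemma finite_dimensional_hom_image:
  assumes M: "simple_alg_module \<rho> M" "w \<in> M" "w \<noteq> 0" and f: "f \<in> alg_hom \<rho> M act V"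
  shows "finite_dimensional (f ` M)"
proof -
  have f': "f w \<in> V" "\<And>h. f (\<rho> h w) = act h (f w)" using f M(2) by (auto simp: alg_hom_def)
  obtain F x where F: "finite F" "\<And>n. n \<in> F \<Longrightarrow> x n \<in> weight_space V Y \<omega> (of_int n)"
    "f w = (\<Sum>n\<in>F. x n)" using weight_decomposition[OF f'(1)] by blast
  have xV: "x n \<in> V" if "n \<in> F" for n using F(2)[OF that] by (simp add: weight_space_eq)
  let ?U = "\<Union>n\<in>F. weight_space V Y \<omega> (of_int n)"
  have "f ` M \<subseteq> cspan ?U"
  proof
    fix y assume "y \<in> f ` M"
    then obtain h where "y = f (\<rho> h w)" using simple_alg_module_cyclic[OF M] by blast
    then have "y = (\<Sum>n\<in>F. act h (x n))"
      by (simp add: f'(2) F(3) clinear_on_sum[OF subspace_V act_linear xV])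
    also have "\<dots> \<in> cspan ?U"
      using act_weight_space[OF F(2)]
      by (intro complex_vector.span_sum complex_vector.span_base) blast
    finally show "y \<in> cspan ?U" .
  qed
  then show ?thesis
    by (rule finite_dimensional_subset[OF finite_dimensional_UN[OF F(1) weight_finite_dim]])
qed

lemma mode_sum_stable:
  assumes N: "csubspace N" "\<And>u n v. \<lbrakk>u \<in> U; v \<in> N\<rbrakk> \<Longrightarrow> Y u n v \<in> N"
    and xs: "fst ` set xs \<subseteq> U" and v: "v \<in> N"
  shows "mode_sum Y xs v \<in> N"
  using xs
proof (induction xs)
  case Nil
  then show ?case by (simp add: complex_vector.subspace_0[OF N(1)])
next
  case (Cons x xs)
  then show ?case
    by (cases x) (auto intro!: complex_vector.subspace_add[OF N(1)] N(2) v)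
qed

text \<open>A nonzero vector f w of \<open>N\<close> is carried to any g w by modes of invariants.
  \<open>M\<close> is any simple module on any type, so that the trivial module on the complex
  numbers is included.\<close>

lemma simple_multiplicity_space:
  assumes simple: "simple_voa V Y vac \<omega>" and semisimple: "semisimple_alg_module act V"
    and M: "simple_alg_module \<rho> M" "w \<in> M" "w \<noteq> 0"
    and N: "csubspace N" "N \<subseteq> multiplicity_space \<rho> M w act V"
      "\<And>u n v. \<lbrakk>u \<in> VH; v \<in> N\<rbrakk> \<Longrightarrow> Y u n v \<in> N"
  shows "N = {0} \<or> N = multiplicity_space \<rho> M w act V"
proof (rule disjCI)
  have M': "alg_module \<rho> M" using M by (simp add: simple_alg_module_def)
  assume "N \<noteq> multiplicity_space \<rho> M w act V"
  then obtain g where g: "g \<in> alg_hom \<rho> M act V" "g w \<notin> N"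
    using N(2) unfolding multiplicity_space_eq by blast
  have "x = 0" if x: "x \<in> N" for x
  proof (rule ccontr)
    assume "x \<noteq> 0"
    obtain f where f: "f \<in> alg_hom \<rho> M act V" "x = f w"
      using x N(2) unfolding multiplicity_space_eq by blast
    have inj: "inj_on f M"
      using simple_alg_module_hom_inj[OF M(1) act_module f(1) M(2)] f(2) \<open>x \<noteq> 0\<close> by simp
    have "(\<lambda>y. g (the_inv_into M f y)) \<in> alg_hom act (f ` M) act V"
      by (rule alg_hom_compose[OF alg_hom_inverse[OF M' f(1) inj] g(1)])
    then obtain xs where xs: "fst ` set xs \<subseteq> VH"
      "\<And>y. y \<in> f ` M \<Longrightarrow> g (the_inv_into M f y) = mode_sum Y xs y"
      using equivariant_mode_sum[OF simple semisimple alg_hom_image_submodule[OF M' f(1)]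
          finite_dimensional_hom_image[OF M f(1)]] by blast
    have "g w = mode_sum Y xs x"
      using xs(2)[of "f w"] M(2) by (simp add: the_inv_into_f_f[OF inj] f(2))
    also have "\<dots> \<in> N" by (rule mode_sum_stable[OF N(1,3) xs(1) x])
    finally show False using g(2) by simp
  qed
  then show "N = {0}" using complex_vector.subspace_0[OF N(1)] by auto
qed

text \<open>The copy \<open>W\<close> of \<open>M\<close> inside \<open>V\<close> supplies a nonzero
  element of the multiplicity space.\<close>

lemma simple_voa_module_multiplicity_space:
  assumes simple: "simple_voa V Y vac \<omega>" and semisimple: "semisimple_alg_module act V"
    and M: "simple_alg_module \<rho> M" "w \<in> M" "w \<noteq> 0"
    and W: "alg_submodule act W V" "alg_module_iso \<rho> M act W"
  shows "simple_voa_module VH Y vac \<omega> (multiplicity_space \<rho> M w act V) Y"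
proof -
  obtain f where f: "f \<in> alg_hom \<rho> M act W" "inj_on f M"
    using W(2) by (auto simp: alg_module_iso_def bij_betw_def)
  have M': "csubspace M" "clinear_on M f"
    using M f by (auto simp: simple_alg_module_def alg_module_def alg_hom_def)
  have "f w \<in> multiplicity_space \<rho> M w act V"
    using alg_hom_subset[OF f(1)] W(1) unfolding multiplicity_space_eq alg_submodule_def by blast
  moreover have "f w \<noteq> 0"
    using inj_onD[OF f(2), of w 0] clinear_on_zero[OF M'] complex_vector.subspace_0[OF M'(1)] M by auto
  ultimately have "multiplicity_space \<rho> M w act V \<noteq> {0}" by blast
  moreover have "N = {0} \<or> N = multiplicity_space \<rho> M w act V"
    if "csubspace N \<and> N \<subseteq> multiplicity_space \<rho> M w act V \<and> (\<forall>u\<in>VH. \<forall>n. \<forall>w\<in>N. Y u n w \<in> N)" for N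
    using that by (intro simple_multiplicity_space[OF simple semisimple M]) auto
  ultimately show ?thesis
    using voa_module_multiplicity_space[OF M(2)] unfolding simple_voa_module_def by blast
qed

text \<open>An H-map from the one-dimensional module given by \<epsilon> is determined by the image
  of 1, which can be any invariant vector.\<close>

lemma VH_multiplicity_space:
  "multiplicity_space (\<lambda>h x. \<epsilon> h * x) UNIV (1 :: complex) act V = VH"
proof
  show "multiplicity_space (\<lambda>h x. \<epsilon> h * x) UNIV (1 :: complex) act V \<subseteq> VH"
  proof
    fix v assume "v \<in> multiplicity_space (\<lambda>h x. \<epsilon> h * x) UNIV (1 :: complex) act V"
    then obtain f where f: "f \<in> alg_hom (\<lambda>h x. \<epsilon> h * x) UNIV act V" and v: "v = f (1 :: complex)"
      unfolding multiplicity_space_eq by blast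
    have equivariant: "\<forall>h x. f (\<epsilon> h * x) = act h (f x)" using f by (simp add: alg_hom_def)
    have "act h v = \<epsilon> h *\<^sub>C v" for h
    proof -
      have "act h v = f (\<epsilon> h *\<^sub>C 1)"
        unfolding v scaleC_complex_def by (rule equivariant[rule_format, symmetric])
      also have "\<dots> = \<epsilon> h *\<^sub>C v"
        using f unfolding v by (intro clinear_on_scale) (auto simp: alg_hom_def)
      finally show ?thesis .
    qed
    then show "v \<in> VH" using f by (auto simp: VH_mem v alg_hom_def)
  qed
  show "VH \<subseteq> multiplicity_space (\<lambda>h x. \<epsilon> h * x) UNIV (1 :: complex) act V"
  proof
    fix v assume v: "v \<in> VH"
    then have "(\<lambda>c. c *\<^sub>C v) \<in> alg_hom (\<lambda>h x. \<epsilon> h * x) UNIV act V"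
      using VH_subset
      by (auto simp: alg_hom_def clinear_on_def scaleC_add_left scaleC_scaleC scaleC_complex_def
          act_scale VH_act mult.commute intro!: complex_vector.subspace_scale[OF subspace_V])
    then show "v \<in> multiplicity_space (\<lambda>h x. \<epsilon> h * x) UNIV (1 :: complex) act V"
      unfolding multiplicity_space_eq by (rule rev_image_eqI) (simp add: scaleC_one)
  qed
qed

lemma simple_trivial_module: "simple_alg_module (\<lambda>h x. \<epsilon> h * x) (UNIV :: complex set)"
proof -
  have "W = {0} \<or> W = UNIV" if W: "csubspace W" for W :: "complex set"
  proof (rule disjCI)
    assume "W \<noteq> UNIV"
    then obtain y where y: "y \<notin> W" by blast
    have "x = 0" if "x \<in> W" for x
    proof (rule ccontr)
      assume "x \<noteq> 0"
      then have "y = (y / x) *\<^sub>C x" by (simp add: scaleC_complex_def)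
      then show False using complex_vector.subspace_scale[OF W that] y by metis
    qed
    then show "W = {0}" using complex_vector.subspace_0[OF W] by auto
  qed
  moreover have "(UNIV :: complex set) \<noteq> {0}" by (metis UNIV_I singletonD zero_neq_one)
  ultimately show ?thesis
    by (auto simp: simple_alg_module_def alg_module_def alg_submodule_def clinear_on_def
        scaleC_complex_def counit_add counit_scale counit_one counit_mult algebra_simps)
qed

text \<open>An ideal of V^H is in particular a V^H-submodule of the multiplicity space of the
  trivial module. The vacuum is nonzero because its mode of index -1 is the identity on the nonzero
  space \<open>V\<close>.\<close>

lemma simple_voa_VH:
  assumes simple: "simple_voa V Y vac \<omega>" and semisimple: "semisimple_alg_module act V"
  shows "simple_voa VH Y vac \<omega>"
proof -
  have "vertex_operator_algebra VH Y vac \<omega>"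
    by (rule sub_vertex_operator_algebra[OF subspace_VH VH_subset vac_VH omega_VH mode_VH])
  moreover have "vac \<noteq> 0"
  proof
    assume "vac = 0"
    then have "v = 0" if "v \<in> V" for v
      using vacuum[OF that, of "- 1"] mode_zero_left[OF that, of "- 1"] by simp
    then show False
      using simple complex_vector.subspace_0[OF subspace_V] unfolding simple_voa_def by blast
  qed
  then have "VH \<noteq> {0}" using vac_VH by blast
  moreover have "J = {0} \<or> J = VH" if J: "voa_ideal VH Y J" for J
    using simple_multiplicity_space[OF simple semisimple simple_trivial_module, of 1 J] J
    unfolding VH_multiplicity_space voa_ideal_def by auto
  ultimately show ?thesis unfolding simple_voa_def by blast
qed

text \<open>If the modules were not isomorphic, the projection of \<open>f(M) \<oplus> g(M')\<close> onto \<open>f(M)\<close> would be a sum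
  \<open>T\<close> of modes of invariants. A \<open>V\<^sup>H\<close>-isomorphism \<open>\<phi>\<close> with \<open>\<phi> (f w) = g w'\<close> then gives \<open>g w' = \<phi> (T (f w)) = T (g w') = 0\<close>.\<close>

lemma multiplicity_spaces_iso:
  assumes simple: "simple_voa V Y vac \<omega>" and semisimple: "semisimple_alg_module act V"
    and M: "simple_alg_module \<rho> M" "w \<in> M" "w \<noteq> 0"
    and M': "simple_alg_module \<rho>' M'" "w' \<in> M'" "w' \<noteq> 0"
    and nonzero: "multiplicity_space \<rho> M w act V \<noteq> {0}"
    and iso: "voa_module_iso VH (multiplicity_space \<rho> M w act V) Y (multiplicity_space \<rho>' M' w' act V) Y"
  shows "alg_module_iso \<rho> M \<rho>' M'"
proof (rule ccontr)
  assume not_iso: "\<not> alg_module_iso \<rho> M \<rho>' M'"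
  let ?X = "multiplicity_space \<rho> M w act V" and ?X' = "multiplicity_space \<rho>' M' w' act V"
  have alg: "alg_module \<rho> M" "alg_module \<rho>' M'" using M M' by (simp_all add: simple_alg_module_def)
  have X: "csubspace ?X" "csubspace ?X'"
    using subspace_multiplicity_space M(2) M'(2) by blast+
  obtain \<phi> where \<phi>: "clinear_on ?X \<phi>" "bij_betw \<phi> ?X ?X'"
    "\<And>u n x. \<lbrakk>u \<in> VH; x \<in> ?X\<rbrakk> \<Longrightarrow> \<phi> (Y u n x) = Y u n (\<phi> x)"
    using iso unfolding voa_module_iso_def by blast
  obtain x where x: "x \<in> ?X" "x \<noteq> 0" using nonzero complex_vector.subspace_0[OF X(1)] by blast
  have \<phi>x: "\<phi> x \<in> ?X'" using \<phi>(2) x(1) by (auto simp: bij_betw_def)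
  have "\<phi> x \<noteq> 0"
    using \<phi>(2) x clinear_on_zero[OF X(1) \<phi>(1)] complex_vector.subspace_0[OF X(1)]
    by (metis bij_betw_imp_inj_on inj_onD)
  obtain f where f: "f \<in> alg_hom \<rho> M act V" "x = f w"
    using x unfolding multiplicity_space_eq by blast
  obtain g where g: "g \<in> alg_hom \<rho>' M' act V" "\<phi> x = g w'"
    using \<phi>x unfolding multiplicity_space_eq by blast
  have inj: "inj_on f M" "inj_on g M'"
    using simple_alg_module_hom_inj[OF M(1) act_module f(1) M(2)] f(2) x(2)
      simple_alg_module_hom_inj[OF M'(1) act_module g(1) M'(2)] g(2) \<open>\<phi> x \<noteq> 0\<close> by simp_all
  let ?W = "f ` M" and ?W' = "g ` M'"
  have W: "alg_submodule act ?W V" "alg_submodule act ?W' V"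
    using alg_hom_image_submodule alg f(1) g(1) by blast+
  have sub: "csubspace ?W" "csubspace ?W'" "?W \<subseteq> V" "?W' \<subseteq> V"
    and stable: "\<And>h y. y \<in> ?W \<Longrightarrow> act h y \<in> ?W" "\<And>h y. y \<in> ?W' \<Longrightarrow> act h y \<in> ?W'"
    using W by (simp_all only: alg_submodule_def)
  \<comment> \<open>A common nonzero vector makes both preimages full, so f(M) = g(M'), and g^(-1) f
    would be an isomorphism of the simple modules.\<close>
  have disjoint: "y = 0" if y: "y \<in> ?W" "y \<in> ?W'" for y
  proof (rule ccontr)
    assume "y \<noteq> 0"
    obtain a where a: "a \<in> M" "y = f a" using y by blast
    obtain b where b: "b \<in> M'" "y = g b" using y by blast
    have lin: "clinear_on M f" "clinear_on M' g" using f g by (auto simp: alg_hom_def)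
    have "csubspace M" "csubspace M'" using alg by (auto simp: alg_module_def)
    then have "a \<noteq> 0" "b \<noteq> 0" using a b \<open>y \<noteq> 0\<close> clinear_on_zero lin by metis+
    then have "{x\<in>M. f x \<in> ?W'} = M"
      using simple_alg_module_preimage[OF M(1) f(1) sub(2) stable(2)] a y by blast
    moreover have "{x\<in>M'. g x \<in> ?W} = M'"
      using simple_alg_module_preimage[OF M'(1) g(1) sub(1) stable(1)] b y \<open>b \<noteq> 0\<close> by blast
    ultimately have eq: "?W = ?W'" by blast
    have f': "f \<in> alg_hom \<rho> M act ?W'"
      using f(1) eq by (auto simp: alg_hom_def)
    have "bij_betw (the_inv_into M' g) ?W' M'"
      by (rule bij_betw_the_inv_into) (use inj in \<open>simp add: bij_betw_def\<close>)
    moreover have "bij_betw f M ?W'" using inj eq by (simp add: bij_betw_def)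
    ultimately have "bij_betw (\<lambda>x. the_inv_into M' g (f x)) M M'"
      using bij_betw_trans[of f M ?W' "the_inv_into M' g" M'] by (simp add: comp_def)
    with alg_hom_compose[OF f' alg_hom_inverse[OF alg(2) g(1) inj(2)]] not_iso
    show False unfolding alg_module_iso_def by blast
  qed
  let ?Z = "{y + z | y z. y \<in> ?W \<and> z \<in> ?W'}"
  \<comment> \<open>The component of \<open>v\<close> in f(M). Uniqueness behind \<open>THE\<close>
    comes from \<open>disjoint\<close>; values outside \<open>?Z\<close> do not matter.\<close>
  define p where "p v = (THE y. y \<in> ?W \<and> v - y \<in> ?W')" for v
  have p: "p (y + z) = y" if "y \<in> ?W" "z \<in> ?W'" for y z
    unfolding p_def
  proof (rule the_equality)
    show "y \<in> ?W \<and> y + z - y \<in> ?W'" using that by simp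
    fix y' assume y': "y' \<in> ?W \<and> y + z - y' \<in> ?W'"
    have "y' - y \<in> ?W" using y' that complex_vector.subspace_diff[OF sub(1)] by blast
    moreover have "z - (y + z - y') \<in> ?W'" using y' that complex_vector.subspace_diff[OF sub(2)] by blast
    ultimately show "y' = y" using disjoint[of "y' - y"] by simp
  qed
  have Z: "alg_submodule act ?Z V"
    unfolding alg_submodule_def
  proof (intro conjI allI ballI)
    show "csubspace ?Z" by (rule complex_vector.subspace_sums[OF sub(1,2)])
    show "?Z \<subseteq> V" using sub complex_vector.subspace_add[OF subspace_V] by blast
    show "act h v \<in> ?Z" if v: "v \<in> ?Z" for h v
    proof -
      obtain y z where "v = y + z" "y \<in> ?W" "z \<in> ?W'" using v by blast
      moreover from this have "act h v = act h y + act h z" using act_add sub by blast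
      ultimately show ?thesis using stable by blast
    qed
  qed
  have "p \<in> alg_hom act ?Z act V"
    unfolding alg_hom_def clinear_on_def mem_Collect_eq
  proof (intro conjI allI ballI)
    fix v v' assume "v \<in> ?Z" "v' \<in> ?Z"
    then obtain y z y' z' where v: "v = y + z" "v' = y' + z'" "y \<in> ?W" "z \<in> ?W'" "y' \<in> ?W" "z' \<in> ?W'"
      by blast
    then have "y + y' \<in> ?W" "z + z' \<in> ?W'"
      using complex_vector.subspace_add sub by blast+
    then have "p ((y + y') + (z + z')) = y + y'" by (rule p)
    then show "p (v + v') = p v + p v'" using p v by (simp add: algebra_simps)
  next
    fix c v assume "v \<in> ?Z"
    then obtain y z where v: "v = y + z" "y \<in> ?W" "z \<in> ?W'" by blast
    then have "c *\<^sub>C y \<in> ?W" "c *\<^sub>C z \<in> ?W'" using complex_vector.subspace_scale sub by blast+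
    then show "p (c *\<^sub>C v) = c *\<^sub>C p v" using p v by (simp add: scaleC_add_right)
  next
    show "p ` ?Z \<subseteq> V" using p sub(3) by auto
  next
    fix h v assume "v \<in> ?Z"
    then obtain y z where v: "v = y + z" "y \<in> ?W" "z \<in> ?W'" by blast
    then have "act h v = act h y + act h z" using act_add sub by blast
    then show "p (act h v) = act h (p v)" using p v stable by simp
  qed
  moreover have "finite_dimensional ?Z"
  proof -
    obtain B B' where B: "finite B" "?W \<subseteq> cspan B" "finite B'" "?W' \<subseteq> cspan B'"
      using finite_dimensional_hom_image[OF M f(1)] finite_dimensional_hom_image[OF M' g(1)]
      unfolding finite_dimensional_def by blast
    moreover have "cspan B \<subseteq> cspan (B \<union> B')" "cspan B' \<subseteq> cspan (B \<union> B')"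
      by (simp_all add: complex_vector.span_mono)
    ultimately have "?Z \<subseteq> cspan (B \<union> B')" using complex_vector.span_add by blast
    then show ?thesis using B unfolding finite_dimensional_def by blast
  qed
  ultimately obtain xs where xs: "fst ` set xs \<subseteq> VH" "\<And>v. v \<in> ?Z \<Longrightarrow> p v = mode_sum Y xs v"
    using equivariant_mode_sum[OF simple semisimple Z] by blast
  have zero: "0 \<in> ?W" "0 \<in> ?W'" using sub complex_vector.subspace_0 by blast+
  have fw: "f w \<in> ?W" and gw: "g w' \<in> ?W'" using M(2) M'(2) by blast+
  \<comment> \<open>Partial sums stay in the multiplicity space, where \<phi> is additive and
    commutes with each mode of an invariant vector.\<close>
  have "\<phi> (mode_sum Y xs v) = mode_sum Y xs (\<phi> v)" if v: "v \<in> ?X" for v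
    using xs(1)
  proof (induction xs)
    case Nil
    show ?case by (simp add: clinear_on_zero[OF X(1) \<phi>(1)])
  next
    case (Cons a xs)
    obtain u n where a: "a = (u, n)" by (cases a)
    have u: "u \<in> VH" "fst ` set xs \<subseteq> VH" using Cons.prems a by auto
    have "mode_sum Y xs v \<in> ?X"
      by (rule mode_sum_stable[OF X(1) mode_multiplicity_space u(2) v])
    moreover have "Y u n v \<in> ?X" by (rule mode_multiplicity_space[OF u(1) v])
    ultimately have "\<phi> (Y u n v + mode_sum Y xs v) = \<phi> (Y u n v) + \<phi> (mode_sum Y xs v)"
      by (intro clinear_on_add[OF \<phi>(1)])
    then show ?case using Cons.IH[OF u(2)] \<phi>(3)[OF u(1) v] a by simp
  qed
  from this[OF x(1)] have "\<phi> (mode_sum Y xs x) = mode_sum Y xs (\<phi> x)" .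
  \<comment> \<open>In \<open>?Z\<close> the vector \<open>x\<close> is f w + 0 and \<phi> x is 0 +
    g w', so \<open>p\<close> fixes the former and kills the latter.\<close>
  moreover have "mode_sum Y xs x = x"
  proof -
    have "f w + 0 \<in> ?Z" using fw zero(2) by blast
    then show ?thesis using xs(2)[of "f w + 0"] p[OF fw zero(2)] f(2) by simp
  qed
  moreover have "mode_sum Y xs (\<phi> x) = 0"
  proof -
    have "0 + g w' \<in> ?Z" using zero(1) gw by blast
    then show ?thesis using xs(2)[of "0 + g w'"] p[OF zero(1) gw] g(2) by simp
  qed
  ultimately show False using \<open>\<phi> x \<noteq> 0\<close> by simp
qed

end

theorem theorem3p8:
  fixes \<Delta> :: "'h::complex_algebra_1 \<Rightarrow> ('h, 'h) tensor"
    and \<epsilon> :: "'h \<Rightarrow> complex"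
    and S :: "'h \<Rightarrow> 'h"
    and V :: "'v::complex_vector set"
    and Y :: "'v \<Rightarrow> int \<Rightarrow> 'v \<Rightarrow> 'v"
    and vac \<omega> :: 'v
    and act :: "'h \<Rightarrow> 'v \<Rightarrow> 'v"
    and I :: "'i set"
    and \<rho> :: "'i \<Rightarrow> 'h \<Rightarrow> 'm::complex_vector \<Rightarrow> 'm"
    and M :: "'i \<Rightarrow> 'm set"
    and w :: "'i \<Rightarrow> 'm"
  assumes "hopf_algebra \<Delta> \<epsilon> S"
    and "simple_voa V Y vac \<omega>"
    and "hopf_module_voa \<Delta> \<epsilon> act V Y \<omega>"
    and "semisimple_alg_module act V"
    and "simple_constituents act V I \<rho> M"
    and "\<And>i. i \<in> I \<Longrightarrow> w i \<in> M i \<and> w i \<noteq> 0"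
  shows "(simple_voa (invariants \<epsilon> act V) Y vac \<omega> \<and>
          (\<forall>i\<in>I. simple_voa_module (invariants \<epsilon> act V) Y vac \<omega>
                   (multiplicity_space (\<rho> i) (M i) (w i) act V) Y)) \<and>
         (\<forall>i\<in>I. \<forall>j\<in>I.
            voa_module_iso (invariants \<epsilon> act V)
              (multiplicity_space (\<rho> i) (M i) (w i) act V) Y
              (multiplicity_space (\<rho> j) (M j) (w j) act V) Y
            \<longleftrightarrow> i = j)"
proof -
  interpret hopf_algebra \<Delta> \<epsilon> S by (rule assms(1))
  interpret vertex_operator_algebra V Y vac \<omega> using assms(2) by (simp add: simple_voa_def)
  interpret hopf_module_voa_action \<Delta> \<epsilon> S V Y vac \<omega> act by unfold_locales (rule assms(3))
  note constituents = assms(5)[unfolded simple_constituents_def]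
  have M: "simple_alg_module (\<rho> i) (M i)" "w i \<in> M i" "w i \<noteq> 0" if "i \<in> I" for i
    using that constituents assms(6) by blast+
  have modules: "simple_voa_module VH Y vac \<omega> (multiplicity_space (\<rho> i) (M i) (w i) act V) Y"
    if i: "i \<in> I" for i
  proof -
    obtain W where "alg_submodule act W V" "alg_module_iso (\<rho> i) (M i) act W"
      using constituents i by blast
    then show ?thesis by (rule simple_voa_module_multiplicity_space[OF assms(2,4) M[OF i]])
  qed
  have "i = j" if ij: "i \<in> I" "j \<in> I"
    and iso: "voa_module_iso VH (multiplicity_space (\<rho> i) (M i) (w i) act V) Y
        (multiplicity_space (\<rho> j) (M j) (w j) act V) Y" for i j
  proof -
    have "multiplicity_space (\<rho> i) (M i) (w i) act V \<noteq> {0}"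
      using modules[OF ij(1)] by (simp add: simple_voa_module_def)
    from multiplicity_spaces_iso[OF assms(2,4) M[OF ij(1)] M[OF ij(2)] this iso]
    show ?thesis using constituents ij by blast
  qed
  \<comment> \<open>For i = j both sides are the same subspace, with the same vector
    \<open>w i\<close>, so the identity map serves.\<close>
  moreover have "voa_module_iso VH X Y X Y" for X
    unfolding voa_module_iso_def by (intro exI[of _ "\<lambda>x. x"]) (auto simp: clinear_on_def bij_betw_def)
  ultimately show ?thesis
    using simple_voa_VH[OF assms(2,4)] modules by blast
qed

end
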